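(* Let $R$ be a commutative Noetherian domain with field of fractions $Q$, $C$ a finite abelian group, $\mathbf{T}$ a commutative $C$-graded $R$-algebra with an involution $\iota$, $W$ a group with a homomorphism $\nu\colon W\to C$, and let $\mathbf{A}$ be a $C$-graded $R$-algebra, finitely generated as an $R$-module, with a grading-preserving surjection of $R$-algebras $\mathbf{T}[W]\to\mathbf{A}$. Assume that the image of $\mathbf{T}$ in $\mathbf{A}$ is reduced, and that $\iota$, extended to $\mathbf{T}[W]$ by $\iota(w)=w^{-1}$ for $w\in W$, descends to $\mathbf{A}$. Let $M$ be a graded $\mathbf{A}$-module that is $R$-torsion-free, and let $L$ be a field containing $Q$. Then $M$ is polarisable over $L$ if and only if for every $c\in C$, $L\otimes_RM_c$ is a self-dual $(L\otimes_R\mathbf{A}_1)$-module.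
   Context: An $R$-algebra is a ring with a ring homomorphism from $R$ to its centre. A $C$-grading on an $R$-algebra $\mathbf{B}$ is a decomposition $\mathbf{B}=\bigoplus_{c\in C}\mathbf{B}_c$ into $R$-submodules with $\mathbf{B}_c\mathbf{B}_{c'}\subset\mathbf{B}_{cc'}$. $\mathbf{T}[W]$ is $C$-graded by giving $t\cdot w$, $t\in\mathbf{T}_{c'}$, $w\in W$, degree $c'\nu(w)$. A graded $\mathbf{A}$-module is a finitely generated $\mathbf{A}$-module $M$ with a decomposition $M=\bigoplus_{c\in C}M_c$ such that $\mathbf{A}_cM_{c'}\subset M_{cc'}$. An involution on $\mathbf{T}$ is an $R$-module homomorphism $\iota\colon\mathbf{T}\to\mathbf{T}$ with $\iota^2=\mathrm{id}$, $\iota(xy)=\iota(y)\iota(x)$ for all $x,y$, and $\iota(\mathbf{T}_c)=\mathbf{T}_{c^{-1}}$ for all $c\in C$; its extension to $\mathbf{T}[W]$ and to $\mathbf{A}$ is again an anti-multiplicative involution, also denoted by $\iota$. The dual of an $(L\otimes_R\mathbf{A}_1)$-module $N$ is $\mathrm{Hom}_L(N,L)$ with action $(T\phi)(n)=\phi(\iota(T)n)$, and $N$ is self-dual if it is isomorphic to its dual. A polarisation on $M$ over $L$ is a non-degenerate $R$-bilinear pairing $M\otimes_RM\to L$ (that is, its $L$-bilinear extension to $L\otimes_RM$ is non-degenerate) such that for $c\ne c'\in C$ the submodules $M_c$ and $M_{c'}$ are orthogonal, and such that every $T\in\mathbf{A}$ is adjoint to $\iota(T)$. $M$ is polarisable over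 $L$ if it admits a polarisation over $L$. *)

theory Defs
  imports
    Complex_Main
    "HOL-Library.Poly_Mapping"
    "HOL-Library.FuncSet"
    "HOL-Computational_Algebra.Fraction_Field"
    "HOL-Computational_Algebra.Group_Closure"
begin

section \<open>Algebras and gradings\<close>

text \<open>
  A unital ring that may be the zero ring is a type of sort \<open>{ring, monoid_mult}\<close>
  (\<open>ring_1\<close> would impose \<open>0 \<noteq> 1\<close>).  The groups \<open>C\<close> and \<open>W\<close> are written additively: \<open>C\<close> has
  sort \<open>{finite, ab_group_add}\<close>, and \<open>W\<close> has sort \<open>group_add\<close>, which does not assume commutativity.
  The group algebra \<open>T[W]\<close> is the type \<open>'w \<Rightarrow>\<^sub>0 't\<close> with its convolution product, in which
  \<open>t \<cdot> w\<close> is \<open>Poly_Mapping.single w t\<close>.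
\<close>

definition noetherian :: "'r::comm_ring_1 itself \<Rightarrow> bool" where
  "noetherian _ \<longleftrightarrow>
     (\<forall>I :: 'r set. module.subspace (*) I \<longrightarrow> (\<exists>S. finite S \<and> I = module.span (*) S))"

definition ring_homomorphism ::
    "('a::{ring,monoid_mult} \<Rightarrow> 'b::{ring,monoid_mult}) \<Rightarrow> bool" where
  "ring_homomorphism f \<longleftrightarrow>
     (\<forall>x y. f (x + y) = f x + f y) \<and> (\<forall>x y. f (x * y) = f x * f y) \<and> f 1 = 1"

definition is_algebra :: "('r::comm_ring_1 \<Rightarrow> 'b::{ring,monoid_mult}) \<Rightarrow> bool" where
  "is_algebra \<phi> \<longleftrightarrow> ring_homomorphism \<phi> \<and> (\<forall>r b. \<phi> r * b = b * \<phi> r)"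

definition direct_sum :: "('c::finite \<Rightarrow> 'b::ab_group_add set) \<Rightarrow> bool" where
  "direct_sum G \<longleftrightarrow> (\<forall>b. \<exists>!f. (\<forall>c. f c \<in> G c) \<and> b = (\<Sum>c\<in>UNIV. f c))"

definition graded_algebra ::
    "('r::comm_ring_1 \<Rightarrow> 'b::{ring,monoid_mult}) \<Rightarrow> ('c::{finite,ab_group_add} \<Rightarrow> 'b set) \<Rightarrow> bool" where
  "graded_algebra \<phi> G \<longleftrightarrow> is_algebra \<phi> \<and>
     (\<forall>c. module.subspace (\<lambda>r b. \<phi> r * b) (G c)) \<and> direct_sum G \<and>
     (\<forall>c c'. \<forall>x\<in>G c. \<forall>y\<in>G c'. x * y \<in> G (c + c'))"

definition reduced :: "'a::{ring,monoid_mult} set \<Rightarrow> bool" where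
  "reduced S \<longleftrightarrow> (\<forall>x\<in>S. \<forall>n::nat. x ^ n = 0 \<longrightarrow> x = 0)"

definition involution ::
    "('r::comm_ring_1 \<Rightarrow> 't::{ring,monoid_mult}) \<Rightarrow> ('c::{finite,ab_group_add} \<Rightarrow> 't set)
      \<Rightarrow> ('t \<Rightarrow> 't) \<Rightarrow> bool" where
  "involution \<phi> G \<iota> \<longleftrightarrow>
     (\<forall>x y. \<iota> (x + y) = \<iota> x + \<iota> y) \<and> (\<forall>r x. \<iota> (\<phi> r * x) = \<phi> r * \<iota> x) \<and>
     (\<forall>x. \<iota> (\<iota> x) = x) \<and> (\<forall>x y. \<iota> (x * y) = \<iota> y * \<iota> x) \<and> (\<forall>c. \<iota> ` G c = G (- c))"


section \<open>The group algebra \<open>T[W]\<close>\<close>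

text \<open>\<open>\<Sum> t\<^sub>w \<cdot> w\<close> is homogeneous of degree \<open>c\<close> iff each \<open>t\<^sub>w\<close> has degree \<open>c - \<nu>(w)\<close>.\<close>

definition group_algebra_grading ::
    "('c::ab_group_add \<Rightarrow> 't::zero set) \<Rightarrow> ('w \<Rightarrow> 'c) \<Rightarrow> 'c \<Rightarrow> ('w \<Rightarrow>\<^sub>0 't) set" where
  "group_algebra_grading G \<nu> c = {f. \<forall>w. Poly_Mapping.lookup f w \<in> G (c - \<nu> w)}"

definition group_algebra_involution ::
    "('t::comm_monoid_add \<Rightarrow> 't) \<Rightarrow> ('w::group_add \<Rightarrow>\<^sub>0 't) \<Rightarrow> ('w \<Rightarrow>\<^sub>0 't)" where
  "group_algebra_involution \<iota> f =
     (\<Sum>w\<in>Poly_Mapping.keys f. Poly_Mapping.single (- w) (\<iota> (Poly_Mapping.lookup f w)))"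

text \<open>
  Homomorphisms of \<open>R\<close>-algebras \<open>T[W] \<rightarrow> A\<close>.  The last clause at \<open>r = 1\<close> says that \<open>\<pi>\<close> preserves
  the unit, as \<open>Poly_Mapping.single 0 1\<close> is the unit of \<open>T[W]\<close>; the constant \<open>1\<close> is not available
  on \<open>'w \<Rightarrow>\<^sub>0 't\<close> when \<open>T\<close> may be zero.
\<close>

definition group_algebra_hom ::
    "('r::comm_ring_1 \<Rightarrow> 't::{ring,monoid_mult}) \<Rightarrow> ('r \<Rightarrow> 'a::{ring,monoid_mult})
      \<Rightarrow> (('w::group_add \<Rightarrow>\<^sub>0 't) \<Rightarrow> 'a) \<Rightarrow> bool" where
  "group_algebra_hom \<phi>T \<phi>A \<pi> \<longleftrightarrow>
     (\<forall>f g. \<pi> (f + g) = \<pi> f + \<pi> g) \<and> (\<forall>f g. \<pi> (f * g) = \<pi> f * \<pi> g) \<and>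
     (\<forall>r. \<pi> (Poly_Mapping.single 0 (\<phi>T r)) = \<phi>A r)"


section \<open>Modules\<close>

definition left_module :: "('a::{ring,monoid_mult} \<Rightarrow> 'm::ab_group_add \<Rightarrow> 'm) \<Rightarrow> bool" where
  "left_module act \<longleftrightarrow>
     (\<forall>a x y. act a (x + y) = act a x + act a y) \<and> (\<forall>a b x. act (a + b) x = act a x + act b x) \<and>
     (\<forall>a b x. act (a * b) x = act a (act b x)) \<and> (\<forall>x. act 1 x = x)"

definition finitely_generated :: "('a \<Rightarrow> 'm::ab_group_add \<Rightarrow> 'm) \<Rightarrow> bool" where
  "finitely_generated act \<longleftrightarrow> (\<exists>S. finite S \<and> (\<forall>x. \<exists>f. x = (\<Sum>s\<in>S. act (f s) s)))"

definition graded_module ::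
    "('r::comm_ring_1 \<Rightarrow> 'a::{ring,monoid_mult}) \<Rightarrow> ('c::{finite,ab_group_add} \<Rightarrow> 'a set)
      \<Rightarrow> ('a \<Rightarrow> 'm::ab_group_add \<Rightarrow> 'm) \<Rightarrow> ('c \<Rightarrow> 'm set) \<Rightarrow> bool" where
  "graded_module \<phi> GA act GM \<longleftrightarrow> left_module act \<and> finitely_generated act \<and>
     (\<forall>c. module.subspace (\<lambda>r m. act (\<phi> r) m) (GM c)) \<and> direct_sum GM \<and>
     (\<forall>c c'. \<forall>a\<in>GA c. \<forall>m\<in>GM c'. act a m \<in> GM (c + c'))"

definition torsion_free :: "('r::zero \<Rightarrow> 'm::zero \<Rightarrow> 'm) \<Rightarrow> bool" where
  "torsion_free s \<longleftrightarrow> (\<forall>r m. s r m = 0 \<longrightarrow> r = 0 \<or> m = 0)"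


section \<open>Tensor products\<close>

text \<open>
  \<open>X \<otimes>\<^sub>R Y\<close>, for submodules \<open>X\<close>, \<open>Y\<close> of ambient \<open>R\<close>-modules with scalar actions \<open>sx\<close>, \<open>sy\<close>: the
  free abelian group on \<open>X \<times> Y\<close> modulo the usual relations.  Its elements are cosets, and
  \<open>tensor_class sx sy X Y u\<close> is the coset of the formal sum \<open>u\<close>; in particular \<open>x \<otimes> y\<close> is the
  coset of \<open>frag_of (x, y)\<close>.
\<close>

definition tensor_rels ::
    "('r \<Rightarrow> 'x::ab_group_add \<Rightarrow> 'x) \<Rightarrow> ('r \<Rightarrow> 'y::ab_group_add \<Rightarrow> 'y) \<Rightarrow> 'x set \<Rightarrow> 'y set
      \<Rightarrow> ('x \<times> 'y \<Rightarrow>\<^sub>0 int) set" where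
  "tensor_rels sx sy X Y = group_closure
     ({frag_of (x + x', y) - frag_of (x, y) - frag_of (x', y) | x x' y. x \<in> X \<and> x' \<in> X \<and> y \<in> Y} \<union>
      {frag_of (x, y + y') - frag_of (x, y) - frag_of (x, y') | x y y'. x \<in> X \<and> y \<in> Y \<and> y' \<in> Y} \<union>
      {frag_of (sx r x, y) - frag_of (x, sy r y) | r x y. x \<in> X \<and> y \<in> Y})"

definition tensor_class ::
    "('r \<Rightarrow> 'x::ab_group_add \<Rightarrow> 'x) \<Rightarrow> ('r \<Rightarrow> 'y::ab_group_add \<Rightarrow> 'y) \<Rightarrow> 'x set \<Rightarrow> 'y set
      \<Rightarrow> ('x \<times> 'y \<Rightarrow>\<^sub>0 int) \<Rightarrow> ('x \<times> 'y \<Rightarrow>\<^sub>0 int) set" where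
  "tensor_class sx sy X Y u = {v. v - u \<in> tensor_rels sx sy X Y}"

definition tensor_product ::
    "('r \<Rightarrow> 'x::ab_group_add \<Rightarrow> 'x) \<Rightarrow> ('r \<Rightarrow> 'y::ab_group_add \<Rightarrow> 'y) \<Rightarrow> 'x set \<Rightarrow> 'y set
      \<Rightarrow> ('x \<times> 'y \<Rightarrow>\<^sub>0 int) set set" where
  "tensor_product sx sy X Y = tensor_class sx sy X Y ` {u. Poly_Mapping.keys u \<subseteq> X \<times> Y}"


section \<open>Base change\<close>

text \<open>
  \<open>L \<otimes>\<^sub>R N\<close> for a ring homomorphism \<open>\<rho> : R \<rightarrow> L\<close>, an \<open>R\<close>-algebra \<open>\<phi> : R \<rightarrow> A\<close>, an \<open>A\<close>-action
  \<open>act\<close>, and an \<open>R\<close>-submodule \<open>N\<close>.  For a subalgebra \<open>B\<close> of \<open>A\<close>, the set underlying \<open>L \<otimes>\<^sub>R B\<close> is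
  \<open>bc_carrier \<rho> \<phi> (*) B\<close>.
\<close>

definition bc_class ::
    "('r \<Rightarrow> 'l::field) \<Rightarrow> ('r \<Rightarrow> 'a) \<Rightarrow> ('a \<Rightarrow> 'n::ab_group_add \<Rightarrow> 'n) \<Rightarrow> 'n set
      \<Rightarrow> ('l \<times> 'n \<Rightarrow>\<^sub>0 int) \<Rightarrow> ('l \<times> 'n \<Rightarrow>\<^sub>0 int) set" where
  "bc_class \<rho> \<phi> act N = tensor_class (\<lambda>r l. \<rho> r * l) (\<lambda>r n. act (\<phi> r) n) UNIV N"

definition bc_carrier ::
    "('r \<Rightarrow> 'l::field) \<Rightarrow> ('r \<Rightarrow> 'a) \<Rightarrow> ('a \<Rightarrow> 'n::ab_group_add \<Rightarrow> 'n) \<Rightarrow> 'n set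
      \<Rightarrow> ('l \<times> 'n \<Rightarrow>\<^sub>0 int) set set" where
  "bc_carrier \<rho> \<phi> act N = tensor_product (\<lambda>r l. \<rho> r * l) (\<lambda>r n. act (\<phi> r) n) UNIV N"

definition bc_pure ::
    "('r \<Rightarrow> 'l::field) \<Rightarrow> ('r \<Rightarrow> 'a) \<Rightarrow> ('a \<Rightarrow> 'n::ab_group_add \<Rightarrow> 'n) \<Rightarrow> 'n set
      \<Rightarrow> 'l \<Rightarrow> 'n \<Rightarrow> ('l \<times> 'n \<Rightarrow>\<^sub>0 int) set" where
  "bc_pure \<rho> \<phi> act N l n = bc_class \<rho> \<phi> act N (frag_of (l, n))"

text \<open>
  Operations on cosets are given as unions over representatives.  For arguments in the relevant
  carriers all the sets in such a union coincide, so it is the coset of the result computed on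
  any representatives.
\<close>

definition bc_add ::
    "('r \<Rightarrow> 'l::field) \<Rightarrow> ('r \<Rightarrow> 'a) \<Rightarrow> ('a \<Rightarrow> 'n::ab_group_add \<Rightarrow> 'n) \<Rightarrow> 'n set
      \<Rightarrow> ('l \<times> 'n \<Rightarrow>\<^sub>0 int) set \<Rightarrow> ('l \<times> 'n \<Rightarrow>\<^sub>0 int) set \<Rightarrow> ('l \<times> 'n \<Rightarrow>\<^sub>0 int) set" where
  "bc_add \<rho> \<phi> act N x y = (\<Union>u\<in>x. \<Union>v\<in>y. bc_class \<rho> \<phi> act N (u + v))"

text \<open>\<open>(l \<otimes> a) (l' \<otimes> n) = l l' \<otimes> a n\<close>, extended biadditively.\<close>

definition bc_act ::
    "('r \<Rightarrow> 'l::field) \<Rightarrow> ('r \<Rightarrow> 'a) \<Rightarrow> ('a \<Rightarrow> 'n::ab_group_add \<Rightarrow> 'n) \<Rightarrow> 'n set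
      \<Rightarrow> ('l \<times> 'a \<Rightarrow>\<^sub>0 int) set \<Rightarrow> ('l \<times> 'n \<Rightarrow>\<^sub>0 int) set \<Rightarrow> ('l \<times> 'n \<Rightarrow>\<^sub>0 int) set" where
  "bc_act \<rho> \<phi> act N t x = (\<Union>u\<in>t. \<Union>v\<in>x. bc_class \<rho> \<phi> act N
     (frag_extend (\<lambda>(l, a). frag_extend (\<lambda>(l', n). frag_of (l * l', act a n)) v) u))"

text \<open>\<open>id \<otimes> f\<close>.\<close>

definition bc_map ::
    "('r \<Rightarrow> 'l::field) \<Rightarrow> ('r \<Rightarrow> 'a) \<Rightarrow> ('a \<Rightarrow> 'n::ab_group_add \<Rightarrow> 'n) \<Rightarrow> 'n set
      \<Rightarrow> ('n \<Rightarrow> 'n) \<Rightarrow> ('l \<times> 'n \<Rightarrow>\<^sub>0 int) set \<Rightarrow> ('l \<times> 'n \<Rightarrow>\<^sub>0 int) set" where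
  "bc_map \<rho> \<phi> act N f x =
     (\<Union>u\<in>x. bc_class \<rho> \<phi> act N (frag_extend (\<lambda>(l, n). frag_of (l, f n)) u))"

record ('s, 'n) act_module =
  mcarrier :: "'n set"
  madd :: "'n \<Rightarrow> 'n \<Rightarrow> 'n"
  mact :: "'s \<Rightarrow> 'n \<Rightarrow> 'n"

definition base_change ::
    "('r \<Rightarrow> 'l::field) \<Rightarrow> ('r \<Rightarrow> 'a) \<Rightarrow> ('a \<Rightarrow> 'n::ab_group_add \<Rightarrow> 'n) \<Rightarrow> 'n set
      \<Rightarrow> (('l \<times> 'a \<Rightarrow>\<^sub>0 int) set, ('l \<times> 'n \<Rightarrow>\<^sub>0 int) set) act_module" where
  "base_change \<rho> \<phi> act N =
     \<lparr>mcarrier = bc_carrier \<rho> \<phi> act N, madd = bc_add \<rho> \<phi> act N, mact = bc_act \<rho> \<phi> act N\<rparr>"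


section \<open>Self-dual modules\<close>

definition module_isomorphic ::
    "'s set \<Rightarrow> ('s, 'n) act_module \<Rightarrow> ('s, 'p) act_module \<Rightarrow> bool" where
  "module_isomorphic S N P \<longleftrightarrow> (\<exists>\<Phi>. bij_betw \<Phi> (mcarrier N) (mcarrier P) \<and>
     (\<forall>x\<in>mcarrier N. \<forall>y\<in>mcarrier N. \<Phi> (madd N x y) = madd P (\<Phi> x) (\<Phi> y)) \<and>
     (\<forall>T\<in>S. \<forall>x\<in>mcarrier N. \<Phi> (mact N T x) = mact P T (\<Phi> x)))"

text \<open>
  \<open>Hom\<^sub>L(N, L)\<close> with action \<open>(T \<psi>)(n) = \<psi>(\<iota>(T) n)\<close>, where \<open>N\<close> is a module over an \<open>L\<close>-algebra
  with structure map \<open>emb\<close> and involution \<open>\<iota>\<close>.  Functionals are \<open>undefined\<close> off the carrier of \<open>N\<close>.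
\<close>

definition dual_module ::
    "('l::field \<Rightarrow> 's) \<Rightarrow> ('s \<Rightarrow> 's) \<Rightarrow> ('s, 'n) act_module \<Rightarrow> ('s, 'n \<Rightarrow> 'l) act_module" where
  "dual_module emb \<iota> N =
     \<lparr>mcarrier = {\<psi> \<in> extensional (mcarrier N).
        (\<forall>x\<in>mcarrier N. \<forall>y\<in>mcarrier N. \<psi> (madd N x y) = \<psi> x + \<psi> y) \<and>
        (\<forall>l. \<forall>x\<in>mcarrier N. \<psi> (mact N (emb l) x) = l * \<psi> x)},
      madd = (\<lambda>\<psi> \<psi>'. \<lambda>n\<in>mcarrier N. \<psi> n + \<psi>' n),
      mact = (\<lambda>T \<psi>. \<lambda>n\<in>mcarrier N. \<psi> (mact N (\<iota> T) n))\<rparr>"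

text \<open>
  \<open>L \<otimes>\<^sub>R N\<close> is a self-dual \<open>(L \<otimes>\<^sub>R B)\<close>-module, for a subalgebra \<open>B\<close> of \<open>A\<close> stable under \<open>\<iota>\<close>.
\<close>

definition self_dual_base_change ::
    "('r \<Rightarrow> 'l::field) \<Rightarrow> ('r \<Rightarrow> 'a::{ring,monoid_mult}) \<Rightarrow> ('a \<Rightarrow> 'a) \<Rightarrow> 'a set
      \<Rightarrow> ('a \<Rightarrow> 'n::ab_group_add \<Rightarrow> 'n) \<Rightarrow> 'n set \<Rightarrow> bool" where
  "self_dual_base_change \<rho> \<phi> \<iota> B act N \<longleftrightarrow>
     module_isomorphic (bc_carrier \<rho> \<phi> (*) B) (base_change \<rho> \<phi> act N)
       (dual_module (\<lambda>l. bc_pure \<rho> \<phi> (*) B l 1) (bc_map \<rho> \<phi> (*) B \<iota>) (base_change \<rho> \<phi> act N))"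


section \<open>Polarisations\<close>

definition L_bilinear ::
    "('l::field \<Rightarrow> 's) \<Rightarrow> ('s, 'n) act_module \<Rightarrow> ('n \<Rightarrow> 'n \<Rightarrow> 'l) \<Rightarrow> bool" where
  "L_bilinear emb V \<beta> \<longleftrightarrow> (\<forall>x\<in>mcarrier V. \<forall>y\<in>mcarrier V.
     (\<forall>z\<in>mcarrier V. \<beta> (madd V x y) z = \<beta> x z + \<beta> y z \<and> \<beta> z (madd V x y) = \<beta> z x + \<beta> z y) \<and>
     (\<forall>l. \<beta> (mact V (emb l) x) y = l * \<beta> x y \<and> \<beta> x (mact V (emb l) y) = l * \<beta> x y))"

definition non_degenerate :: "'n set \<Rightarrow> 'n \<Rightarrow> ('n \<Rightarrow> 'n \<Rightarrow> 'l::zero) \<Rightarrow> bool" where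
  "non_degenerate V z \<beta> \<longleftrightarrow>
     (\<forall>x\<in>V. (\<forall>y\<in>V. \<beta> x y = 0) \<longrightarrow> x = z) \<and> (\<forall>y\<in>V. (\<forall>x\<in>V. \<beta> x y = 0) \<longrightarrow> y = z)"

text \<open>
  A pairing \<open>M \<otimes>\<^sub>R M \<rightarrow> L\<close> is given by the corresponding \<open>R\<close>-bilinear map \<open>b\<close>.  The map \<open>\<beta>\<close> below is
  its \<open>L\<close>-bilinear extension to \<open>L \<otimes>\<^sub>R M\<close>; it is determined by \<open>b\<close> on the carrier, because the
  elements \<open>1 \<otimes> m\<close> generate \<open>L \<otimes>\<^sub>R M\<close> over \<open>L\<close>.
\<close>

definition polarisation ::
    "('r \<Rightarrow> 'l::field) \<Rightarrow> ('r \<Rightarrow> 'a::{ring,monoid_mult}) \<Rightarrow> ('a \<Rightarrow> 'a)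
      \<Rightarrow> ('a \<Rightarrow> 'm::ab_group_add \<Rightarrow> 'm) \<Rightarrow> ('c \<Rightarrow> 'm set) \<Rightarrow> ('m \<Rightarrow> 'm \<Rightarrow> 'l) \<Rightarrow> bool" where
  "polarisation \<rho> \<phi> \<iota> act GM b \<longleftrightarrow>
     (\<forall>x y z. b (x + y) z = b x z + b y z \<and> b z (x + y) = b z x + b z y) \<and>
     (\<forall>r x y. b (act (\<phi> r) x) y = \<rho> r * b x y \<and> b x (act (\<phi> r) y) = \<rho> r * b x y) \<and>
     (\<exists>\<beta>. L_bilinear (\<lambda>l. bc_pure \<rho> \<phi> (*) UNIV l 1) (base_change \<rho> \<phi> act UNIV) \<beta> \<and>
          (\<forall>x y. \<beta> (bc_pure \<rho> \<phi> act UNIV 1 x) (bc_pure \<rho> \<phi> act UNIV 1 y) = b x y) \<and>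
          non_degenerate (bc_carrier \<rho> \<phi> act UNIV) (bc_class \<rho> \<phi> act UNIV 0) \<beta>) \<and>
     (\<forall>c c'. c \<noteq> c' \<longrightarrow> (\<forall>x\<in>GM c. \<forall>y\<in>GM c'. b x y = 0)) \<and>
     (\<forall>T x y. b (act T x) y = b x (act (\<iota> T) y))"

definition polarisable ::
    "('r \<Rightarrow> 'l::field) \<Rightarrow> ('r \<Rightarrow> 'a::{ring,monoid_mult}) \<Rightarrow> ('a \<Rightarrow> 'a)
      \<Rightarrow> ('a \<Rightarrow> 'm::ab_group_add \<Rightarrow> 'm) \<Rightarrow> ('c \<Rightarrow> 'm set) \<Rightarrow> bool" where
  "polarisable \<rho> \<phi> \<iota> act GM \<longleftrightarrow> (\<exists>b. polarisation \<rho> \<phi> \<iota> act GM b)"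

end

theory Submission
  imports Defs
begin

text \<open>
  A non-degenerate pairing on \<open>L \<otimes>\<^sub>R M\<^sub>c\<close> for which every \<open>a \<in> A\<^sub>0\<close> is adjoint to \<open>\<iota>(a)\<close> is the same as an
  isomorphism of \<open>L \<otimes>\<^sub>R M\<^sub>c\<close> with its dual (\<open>self_dual_iff_form\<close>); surjectivity of the map to the dual
  uses that \<open>M\<^sub>c\<close> is finitely generated over \<open>R\<close>.  A polarisation restricts to such pairings, as
  the graded pieces are orthogonal (\<open>restricted_form\<close>).

  Conversely, pairings \<open>b\<^sub>c\<close> on the \<open>L \<otimes>\<^sub>R M\<^sub>c\<close> are compatible with \<open>A\<^sub>0\<close> only, and nothing relates
  different degrees.  They are replaced as follows.  Let \<open>Q\<close> be the field of fractions of \<open>R\<close>.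
  The image of \<open>Q \<otimes> T\<close> in \<open>Q \<otimes> A\<close> is central, reduced and finite over \<open>Q\<close>.  So for
  homogeneous \<open>t \<in> T\<close>, the power \<open>t\<^sup>n\<close> with \<open>n = |C|\<close>, of degree \<open>0\<close>, generates an ideal generated by an
  idempotent \<open>e\<close> of degree \<open>0\<close>; the image of \<open>t\<close> is a unit on the part cut out by \<open>e\<close>, and zero on that
  cut out by \<open>1 - e\<close>.  As elements of \<open>W\<close> map to homogeneous units, the same holds for monomials \<open>t w\<close>
  (\<open>monomial_idempotent\<close>), and finitely many of these span \<open>A\<close>.  Their idempotents are central and
  generate a partition of unity such that on each of its parts every graded piece of
  \<open>Q \<otimes> A\<close> is zero or contains a unit (\<open>central_decomposition\<close>).

  On one part, the degrees of units form a subgroup \<open>D\<close> of \<open>C\<close>.  Choose a degree \<open>r\<close> in each coset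
  of \<open>D\<close> and units \<open>u\<^sub>\<delta>\<close> of degree \<open>\<delta> \<in> D\<close>, and replace \<open>b\<^sub>r\<^sub>+\<^sub>\<delta>\<close> by the form
  \<open>(u\<^sub>\<delta> x, y) \<mapsto> b\<^sub>r(x, \<iota>(u\<^sub>\<delta>) y)\<close>.  For \<open>a\<close> of degree \<open>d \<in> D\<close>, the element \<open>u\<^sup>-\<^sup>1 a u'\<close> with \<open>u\<close>, \<open>u'\<close> the units
  of the degrees concerned lies in \<open>A\<^sub>0\<close>, and its adjointness to its image under \<open>\<iota>\<close> gives that of \<open>a\<close>
  (\<open>transported_form\<close>).  The sum over all parts is a polarisation (\<open>glued_form\<close>).

  All this is carried out in \<open>A\<close> itself, with explicit denominators from \<open>R\<close>: an idempotent is
  represented by \<open>e\<close> with \<open>e\<^sup>2 = s e\<close>, \<open>s \<noteq> 0\<close>.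
\<close>

section \<open>Linear algebra over a domain\<close>

text \<open>
  Fraction-free Gaussian elimination: a matrix with more rows than columns has a nontrivial
  relation between its rows.  This supplies coordinates on finitely generated modules, algebraic
  relations in finite algebras, and the equivalence of injectivity and surjectivity for
  square matrices.
\<close>

lemma more_rows_than_columns_dependent:
  fixes c :: "'i \<Rightarrow> 's \<Rightarrow> 'r::idom"
  assumes "finite S" and "finite I" and "card S < card I"
  shows "\<exists>r. (\<exists>i\<in>I. r i \<noteq> 0) \<and> (\<forall>s\<in>S. (\<Sum>i\<in>I. r i * c i s) = 0)"
  using assms
proof (induction S arbitrary: I c rule: finite_induct)
  case empty
  then obtain i where "i \<in> I" by fastforce
  then show ?case by (intro exI[of _ "\<lambda>_. 1"]) auto
next
  case (insert s0 S)
  show ?case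
  proof (cases "\<exists>i0\<in>I. c i0 s0 \<noteq> 0")
    case False
    have "card S < card I" using insert by simp
    with insert.IH[of I c] insert.prems obtain r
      where "\<exists>i\<in>I. r i \<noteq> 0" "\<forall>s\<in>S. (\<Sum>i\<in>I. r i * c i s) = 0" by blast
    with False show ?thesis by (intro exI[of _ r]) auto
  next
    case True
    then obtain i0 where i0: "i0 \<in> I" "c i0 s0 \<noteq> 0" by blast
    define J where "J = I - {i0}"
    have J: "finite J" "card S < card J" "i0 \<notin> J" "I = insert i0 J"
      using insert i0 by (auto simp: J_def)
    define c' where "c' i s = c i0 s0 * c i s - c i s0 * c i0 s" for i s
    from insert.IH[of J c'] J obtain r i1
      where i1: "i1 \<in> J" "r i1 \<noteq> 0" and r: "\<And>s. s \<in> S \<Longrightarrow> (\<Sum>i\<in>J. r i * c' i s) = 0"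
      by blast
    define r' where "r' i = (if i = i0 then - (\<Sum>i\<in>J. r i * c i s0) else r i * c i0 s0)" for i
    have split: "(\<Sum>i\<in>I. r' i * c i s) =
        - (\<Sum>i\<in>J. r i * c i s0) * c i0 s + (\<Sum>i\<in>J. r i * c i0 s0 * c i s)" for s
      unfolding J(4) using J(1,3) by (auto simp: r'_def intro!: sum.cong)
    have "(\<Sum>i\<in>I. r' i * c i s) = 0" if "s \<in> insert s0 S" for s
    proof (cases "s = s0")
      case True
      then show ?thesis unfolding split by (simp add: sum_distrib_left sum_distrib_right ac_simps)
    next
      case False
      with that have "(\<Sum>i\<in>J. r i * c' i s) = 0" using r by blast
      then show ?thesis unfolding split
        by (simp add: c'_def sum_distrib_left sum_distrib_right algebra_simps sum_subtractf)
    qed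
    moreover have "r' i1 \<noteq> 0" "i1 \<in> I" using i1 i0 J by (auto simp: r'_def)
    ultimately show ?thesis by blast
  qed
qed

text \<open>
  A finitely generated module \<open>N\<close> over a domain has, up to the denominator \<open>D\<close>, coordinates
  \<open>h\<close> with respect to a maximal independent set \<open>B\<close> of generators.  Torsion elements have
  coordinates zero.
\<close>

lemma finitely_generated_coordinates:
  fixes s :: "'r::idom \<Rightarrow> 'm::ab_group_add \<Rightarrow> 'm"
  assumes "module s" and N: "module.subspace s N" and G: "finite G" "G \<subseteq> N"
    and gen: "\<forall>n\<in>N. \<exists>f. n = (\<Sum>g\<in>G. s (f g) g)"
  obtains B D h where "finite B" and "B \<subseteq> N" and "D \<noteq> 0"
    and "\<And>n. n \<in> N \<Longrightarrow> s D n = (\<Sum>b\<in>B. s (h b n) b)"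
    and "\<And>b x y. b \<in> B \<Longrightarrow> x \<in> N \<Longrightarrow> y \<in> N \<Longrightarrow> h b (x + y) = h b x + h b y"
    and "\<And>b r x. b \<in> B \<Longrightarrow> x \<in> N \<Longrightarrow> h b (s r x) = r * h b x"
    and "\<And>b b'. b \<in> B \<Longrightarrow> b' \<in> B \<Longrightarrow> h b b' = (if b = b' then D else 0)"
proof -
  interpret module s by fact
  define indep where "indep B \<longleftrightarrow> (\<forall>f. (\<Sum>b\<in>B. s (f b) b) = 0 \<longrightarrow> (\<forall>b\<in>B. f b = 0))" for B
  let ?F = "{B. B \<subseteq> G \<and> indep B}"
  have "finite ?F" using G(1) by simp
  moreover have "{} \<in> ?F" by (simp add: indep_def)
  ultimately have "\<exists>B\<in>?F. \<forall>B'\<in>?F. B \<subseteq> B' \<longrightarrow> B = B'"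
    by (intro finite_has_maximal) auto
  then obtain B where B: "B \<subseteq> G" "indep B"
    and max: "\<And>B'. B' \<subseteq> G \<Longrightarrow> indep B' \<Longrightarrow> B \<subseteq> B' \<Longrightarrow> B = B'"
    by (metis (no_types, lifting) mem_Collect_eq)
  have finB: "finite B" using B(1) G(1) finite_subset by blast
  have indepD: "f b = 0" if "(\<Sum>b\<in>B. s (f b) b) = 0" "b \<in> B" for f b
    using B(2)[unfolded indep_def, rule_format, of f] that by blast
  have uniq: "f b = g b" if "(\<Sum>b\<in>B. s (f b) b) = (\<Sum>b\<in>B. s (g b) b)" "b \<in> B" for f g b
  proof -
    have "(\<Sum>b\<in>B. s (f b - g b) b) = 0"
      using that(1) by (simp add: scale_left_diff_distrib sum_subtractf)
    with indepD[of "\<lambda>b. f b - g b"] that(2) have "f b - g b = 0" by blast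
    then show ?thesis by simp
  qed
  have "\<exists>d k. d \<noteq> 0 \<and> s d g = (\<Sum>b\<in>B. s (k b) b)" if g: "g \<in> G" for g
  proof (cases "g \<in> B")
    case True
    have "(\<Sum>b\<in>B. s (if b = g then 1 else 0) b) = (\<Sum>b\<in>B. if b = g then b else 0)"
      by (intro sum.cong) auto
    then have "s 1 g = (\<Sum>b\<in>B. s (if b = g then 1 else 0) b)" using True finB by simp
    then show ?thesis by (intro exI[of _ 1] exI) auto
  next
    case False
    then have "\<not> indep (insert g B)" using max[of "insert g B"] B g by blast
    then obtain f b0 where f: "(\<Sum>b\<in>insert g B. s (f b) b) = 0" "b0 \<in> insert g B" "f b0 \<noteq> 0"
      unfolding indep_def by blast
    have eq: "s (f g) g = - (\<Sum>b\<in>B. s (f b) b)"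
      using f(1) False finB by (simp add: eq_neg_iff_add_eq_0)
    have "f g \<noteq> 0"
    proof
      assume 0: "f g = 0"
      then have "(\<Sum>b\<in>B. s (f b) b) = 0" using eq by simp
      then have "\<forall>b\<in>B. f b = 0" using indepD by blast
      with 0 f show False by auto
    qed
    moreover have "s (f g) g = (\<Sum>b\<in>B. s (- f b) b)"
      using eq by (simp add: sum_negf)
    ultimately show ?thesis by (intro exI[of _ "f g"] exI[of _ "\<lambda>b. - f b"]) simp
  qed
  then obtain d k where d: "\<And>g. g \<in> G \<Longrightarrow> d g \<noteq> 0"
    and k: "\<And>g. g \<in> G \<Longrightarrow> s (d g) g = (\<Sum>b\<in>B. s (k g b) b)"
    by metis
  define D where "D = prod d G"
  have D: "D \<noteq> 0" using d G(1) by (simp add: D_def)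
  have "\<exists>h. s D n = (\<Sum>b\<in>B. s (h b) b)" if n: "n \<in> N" for n
  proof -
    obtain f where f: "n = (\<Sum>g\<in>G. s (f g) g)" using gen n by blast
    have "s D n = (\<Sum>g\<in>G. s (f g * prod d (G - {g})) (s (d g) g))"
      unfolding f scale_sum_right
      by (intro sum.cong refl) (simp add: D_def prod.remove[OF G(1)] ac_simps)
    also have "\<dots> = (\<Sum>g\<in>G. \<Sum>b\<in>B. s (f g * prod d (G - {g}) * k g b) b)"
      by (intro sum.cong refl) (simp add: k scale_sum_right)
    also have "\<dots> = (\<Sum>b\<in>B. s (\<Sum>g\<in>G. f g * prod d (G - {g}) * k g b) b)"
      by (subst sum.swap) (simp add: scale_sum_left)
    finally show ?thesis
      by (rule exI[of _ "\<lambda>b. \<Sum>g\<in>G. f g * prod d (G - {g}) * k g b"])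
  qed
  then obtain h where h: "\<And>n. n \<in> N \<Longrightarrow> s D n = (\<Sum>b\<in>B. s (h n b) b)" by metis
  show thesis
  proof (rule that[of B D "\<lambda>b n. h n b"])
    show "finite B" "D \<noteq> 0" by fact+
    show BN: "B \<subseteq> N" using B(1) G(2) by blast
    show "s D n = (\<Sum>b\<in>B. s (h n b) b)" if "n \<in> N" for n using h that .
    show "h (x + y) b = h x b + h y b" if "b \<in> B" "x \<in> N" "y \<in> N" for b x y
    proof (rule uniq[where g = "\<lambda>b. h x b + h y b", OF _ \<open>b \<in> B\<close>])
      show "(\<Sum>b\<in>B. s (h (x + y) b) b) = (\<Sum>b\<in>B. s (h x b + h y b) b)"
        using that h subspace_add[OF N]
        by (simp add: scale_left_distrib sum.distrib flip: h) (simp add: scale_right_distrib)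
    qed
    show "h (s r x) b = r * h x b" if "b \<in> B" "x \<in> N" for b r x
    proof (rule uniq[where g = "\<lambda>b. r * h x b", OF _ \<open>b \<in> B\<close>])
      have "(\<Sum>b\<in>B. s (r * h x b) b) = s r (s D x)"
        by (simp add: h[OF that(2)] scale_sum_right)
      also have "\<dots> = s D (s r x)" by (simp add: mult.commute)
      also have "\<dots> = (\<Sum>b\<in>B. s (h (s r x) b) b)" using h subspace_scale[OF N] that by blast
      finally show "(\<Sum>b\<in>B. s (h (s r x) b) b) = (\<Sum>b\<in>B. s (r * h x b) b)" ..
    qed
    show "h b' b = (if b = b' then D else 0)" if "b \<in> B" "b' \<in> B" for b b'
    proof (rule uniq[where g = "\<lambda>b. if b = b' then D else 0", OF _ \<open>b \<in> B\<close>])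
      have "(\<Sum>b\<in>B. s (if b = b' then D else 0) b) = (\<Sum>b\<in>B. if b = b' then s D b else 0)"
        by (intro sum.cong) auto
      then show "(\<Sum>b\<in>B. s (h b' b) b) = (\<Sum>b\<in>B. s (if b = b' then D else 0) b)"
        using that BN finB h[of b'] by auto
    qed
  qed
qed

section \<open>Direct sums\<close>

text \<open>The projection of \<open>b\<close> to the summand of index \<open>c\<close>.\<close>

definition component :: "('c::finite \<Rightarrow> 'b::ab_group_add set) \<Rightarrow> 'c \<Rightarrow> 'b \<Rightarrow> 'b" where
  "component G c b = (THE f. (\<forall>c. f c \<in> G c) \<and> b = (\<Sum>c\<in>UNIV. f c)) c"

lemma component_props:
  assumes "direct_sum G"
  shows component_in: "component G c b \<in> G c" and sum_component: "(\<Sum>c\<in>UNIV. component G c b) = b"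
proof -
  have "\<exists>!f. (\<forall>c. f c \<in> G c) \<and> b = (\<Sum>c\<in>UNIV. f c)" using assms unfolding direct_sum_def by blast
  from theI'[OF this] show "component G c b \<in> G c" "(\<Sum>c\<in>UNIV. component G c b) = b"
    unfolding component_def by auto
qed

lemma component_unique:
  assumes "direct_sum G" and "\<And>c. f c \<in> G c" and "b = (\<Sum>c\<in>UNIV. f c)"
  shows "component G c b = f c"
proof -
  have ex1: "\<exists>!f. (\<forall>c. f c \<in> G c) \<and> b = (\<Sum>c\<in>UNIV. f c)"
    using assms(1) unfolding direct_sum_def by blast
  have "(THE f. (\<forall>c. f c \<in> G c) \<and> b = (\<Sum>c\<in>UNIV. f c)) = f"
    by (rule the1_equality[OF ex1]) (use assms in auto)
  then show ?thesis by (simp add: component_def)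
qed

text \<open>A finite direct sum decomposition of an abelian group into subsets closed under addition.\<close>

locale graded_group =
  fixes G :: "'c::finite \<Rightarrow> 'b::ab_group_add set"
  assumes direct: "direct_sum G" and zero_in: "0 \<in> G c"
    and add_in: "x \<in> G c \<Longrightarrow> y \<in> G c \<Longrightarrow> x + y \<in> G c"
begin

lemma component_homogeneous:
  assumes "x \<in> G d"
  shows "component G c x = (if c = d then x else 0)"
  by (rule component_unique[OF direct]) (use assms zero_in in auto)

lemma component_add: "component G c (x + y) = component G c x + component G c y"
  by (rule component_unique[OF direct])
    (auto simp: component_in[OF direct] sum_component[OF direct] sum.distrib add_in)

lemma component_0: "component G c 0 = 0"
  using component_homogeneous[OF zero_in, of c c] by simp

lemma component_sum: "component G c (sum f I) = (\<Sum>i\<in>I. component G c (f i))"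
  by (induction I rule: infinite_finite_induct) (auto simp: component_0 component_add)

end

text \<open>\<open>|C| c = 0\<close>, since translation by \<open>c\<close> preserves the sum of all elements of \<open>C\<close>.\<close>

lemma card_multiple_eq_0:
  fixes c :: "'c::{finite,ab_group_add}"
  shows "(\<Sum>i<card (UNIV :: 'c set). c) = 0"
proof -
  have "(\<Sum>g\<in>UNIV. g + c) = (\<Sum>g\<in>UNIV. g)"
    by (rule sum.reindex_bij_witness[of _ "\<lambda>g. g - c" "\<lambda>g. g + c"]) auto
  then have "(\<Sum>g\<in>(UNIV :: 'c set). c) = 0" by (simp add: sum.distrib)
  moreover have "(\<Sum>g\<in>A. c) = (\<Sum>i<card A. c)" if "finite A" for A :: "'c set"
    using that by (induction A rule: finite_induct) (auto simp: add.commute)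
  ultimately show ?thesis by simp
qed

section \<open>Formal sums\<close>

text \<open>The additive extension of \<open>F\<close> from generators to formal sums.\<close>

definition frag_eval :: "('k \<Rightarrow> 'l::comm_ring_1) \<Rightarrow> ('k \<Rightarrow>\<^sub>0 int) \<Rightarrow> 'l" where
  "frag_eval F u = (\<Sum>k\<in>Poly_Mapping.keys u. of_int (Poly_Mapping.lookup u k) * F k)"

lemma frag_eval_superset:
  assumes "finite S" and "Poly_Mapping.keys u \<subseteq> S"
  shows "frag_eval F u = (\<Sum>k\<in>S. of_int (Poly_Mapping.lookup u k) * F k)"
  unfolding frag_eval_def
  by (rule sum.mono_neutral_left) (use assms in \<open>auto simp: in_keys_iff\<close>)

lemma frag_eval_of [simp]: "frag_eval F (frag_of k) = F k"
  by (simp add: frag_eval_def)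

lemma frag_eval_0 [simp]: "frag_eval F 0 = 0"
  by (simp add: frag_eval_def)

lemma frag_eval_diff: "frag_eval F (u - v) = frag_eval F u - frag_eval F v"
proof -
  let ?S = "Poly_Mapping.keys u \<union> Poly_Mapping.keys v"
  have "frag_eval F w = (\<Sum>k\<in>?S. of_int (Poly_Mapping.lookup w k) * F k)"
    if "w \<in> {u, v, u - v}" for w
    by (rule frag_eval_superset) (use that keys_diff[of u v] in auto)
  then show ?thesis
    by (simp add: lookup_minus left_diff_distrib sum_subtractf)
qed

lemma frag_eval_minus: "frag_eval F (- u) = - frag_eval F u"
  using frag_eval_diff[of F 0 u] by simp

lemma frag_eval_add: "frag_eval F (u + v) = frag_eval F u + frag_eval F v"
  using frag_eval_diff[of F u "- v"] by (simp add: frag_eval_minus)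

lemma frag_eval_sum: "frag_eval F (\<Sum>i\<in>I. f i) = (\<Sum>i\<in>I. frag_eval F (f i))"
  by (induction I rule: infinite_finite_induct) (auto simp: frag_eval_add)

lemma frag_eval_cong:
  assumes "\<And>k. k \<in> Poly_Mapping.keys u \<Longrightarrow> F k = H k"
  shows "frag_eval F u = frag_eval H u"
  unfolding frag_eval_def using assms by (intro sum.cong) auto

lemma frag_eval_extend: "frag_eval F (frag_extend h u) = frag_eval (\<lambda>k. frag_eval F (h k)) u"
proof -
  have "Poly_Mapping.keys u \<subseteq> UNIV" by simp
  then show ?thesis
    by (induction u rule: frag_induction) (auto simp: frag_extend_diff frag_eval_diff)
qed

text \<open>
  The value \<open>\<Sum> l g(n)\<close> of a function \<open>g\<close> on a formal sum \<open>\<Sum> l \<otimes> n\<close>; the operation \<open>id \<otimes> f\<close> on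
  formal sums; and the biadditive action given by \<open>(l \<otimes> a) (l' \<otimes> n) = l l' \<otimes> a n\<close>.
\<close>

definition tensor_eval :: "('n \<Rightarrow> 'l::field) \<Rightarrow> ('l \<times> 'n \<Rightarrow>\<^sub>0 int) \<Rightarrow> 'l" where
  "tensor_eval g = frag_eval (\<lambda>p. fst p * g (snd p))"

definition formal_map :: "('n \<Rightarrow> 'p) \<Rightarrow> ('l \<times> 'n \<Rightarrow>\<^sub>0 int) \<Rightarrow> ('l \<times> 'p \<Rightarrow>\<^sub>0 int)" where
  "formal_map f = frag_extend (\<lambda>(l, n). frag_of (l, f n))"

definition formal_act ::
    "('a \<Rightarrow> 'n \<Rightarrow> 'n) \<Rightarrow> ('l::field \<times> 'a \<Rightarrow>\<^sub>0 int) \<Rightarrow> ('l \<times> 'n \<Rightarrow>\<^sub>0 int) \<Rightarrow> ('l \<times> 'n \<Rightarrow>\<^sub>0 int)" where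
  "formal_act act t v =
     frag_extend (\<lambda>(l, a). frag_extend (\<lambda>(l', n). frag_of (l * l', act a n)) v) t"

lemma tensor_eval_of [simp]: "tensor_eval g (frag_of (l, n)) = l * g n"
  by (simp add: tensor_eval_def)

lemma tensor_eval_0 [simp]: "tensor_eval g 0 = 0"
  by (simp add: tensor_eval_def)

lemma tensor_eval_diff: "tensor_eval g (u - v) = tensor_eval g u - tensor_eval g v"
  by (simp add: tensor_eval_def frag_eval_diff)

lemma tensor_eval_add: "tensor_eval g (u + v) = tensor_eval g u + tensor_eval g v"
  by (simp add: tensor_eval_def frag_eval_add)

lemma tensor_eval_sum: "tensor_eval g (\<Sum>i\<in>I. f i) = (\<Sum>i\<in>I. tensor_eval g (f i))"
  by (simp add: tensor_eval_def frag_eval_sum)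

lemma tensor_eval_cong:
  assumes "Poly_Mapping.keys u \<subseteq> UNIV \<times> N" and "\<And>n. n \<in> N \<Longrightarrow> g n = h n"
  shows "tensor_eval g u = tensor_eval h u"
  unfolding tensor_eval_def by (rule frag_eval_cong) (use assms in auto)

lemma tensor_eval_map: "tensor_eval g (formal_map f u) = tensor_eval (\<lambda>n. g (f n)) u"
  by (simp add: tensor_eval_def formal_map_def frag_eval_extend case_prod_beta)

lemma tensor_eval_act:
  "tensor_eval g (formal_act act t u) = tensor_eval (\<lambda>a. tensor_eval (\<lambda>n. g (act a n)) u) t"
proof -
  have "frag_eval (\<lambda>p. fst p * g (snd p))
          (frag_extend (\<lambda>(l', n). frag_of (l * l', act a n)) u) =
        l * frag_eval (\<lambda>p. fst p * g (act a (snd p))) u" for l a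
    unfolding frag_eval_extend
    by (simp add: frag_eval_def case_prod_beta sum_distrib_left ac_simps)
  then show ?thesis
    by (simp add: tensor_eval_def formal_act_def frag_eval_extend case_prod_beta)
qed

lemma tensor_eval_plus: "tensor_eval (\<lambda>n. g n + h n) u = tensor_eval g u + tensor_eval h u"
  by (simp add: tensor_eval_def frag_eval_def case_prod_beta algebra_simps sum.distrib)

lemma tensor_eval_scale: "tensor_eval (\<lambda>n. k * g n) u = k * tensor_eval g u"
  by (simp add: tensor_eval_def frag_eval_def case_prod_beta sum_distrib_left ac_simps)

lemma tensor_eval_zero [simp]: "tensor_eval (\<lambda>n. 0) u = 0"
  by (simp add: tensor_eval_def frag_eval_def case_prod_beta)

lemma tensor_eval_sum_fun:
  "tensor_eval (\<lambda>n. \<Sum>i\<in>I. g i n) u = (\<Sum>i\<in>I. tensor_eval (g i) u)"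
  by (induction I rule: infinite_finite_induct) (auto simp: tensor_eval_plus)

lemma tensor_eval_swap:
  "tensor_eval (\<lambda>x. tensor_eval (\<lambda>y. b x y) v) u = tensor_eval (\<lambda>y. tensor_eval (\<lambda>x. b x y) u) v"
  unfolding tensor_eval_def frag_eval_def case_prod_beta sum_distrib_left
  by (subst sum.swap) (simp add: ac_simps)

lemma formal_map_diff: "formal_map f (u - v) = formal_map f u - formal_map f v"
  by (simp add: formal_map_def frag_extend_diff)

lemma keys_formal_map:
  assumes "Poly_Mapping.keys u \<subseteq> UNIV \<times> N" and "\<And>n. n \<in> N \<Longrightarrow> f n \<in> N'"
  shows "Poly_Mapping.keys (formal_map f u) \<subseteq> UNIV \<times> N'"
  unfolding formal_map_def by (rule order_trans[OF keys_frag_extend]) (use assms in fastforce)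

lemma keys_formal_act:
  assumes "Poly_Mapping.keys t \<subseteq> UNIV \<times> B" and "Poly_Mapping.keys u \<subseteq> UNIV \<times> N"
    and "\<And>a n. a \<in> B \<Longrightarrow> n \<in> N \<Longrightarrow> act a n \<in> N"
  shows "Poly_Mapping.keys (formal_act act t u) \<subseteq> UNIV \<times> N"
proof -
  have "Poly_Mapping.keys (frag_extend (\<lambda>(l', n). frag_of (l * l', act a n)) u) \<subseteq> UNIV \<times> N"
    if "a \<in> B" for l a
    by (rule order_trans[OF keys_frag_extend]) (use assms that in fastforce)
  then show ?thesis unfolding formal_act_def
    by (intro order_trans[OF keys_frag_extend]) (use assms in fastforce)
qed

lemma formal_act_diff_left: "formal_act act (s - t) u = formal_act act s u - formal_act act t u"
  by (simp add: formal_act_def frag_extend_diff)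

lemma formal_act_diff_right: "formal_act act t (u - v) = formal_act act t u - formal_act act t v"
proof -
  have "Poly_Mapping.keys t \<subseteq> UNIV" by simp
  then show ?thesis
  proof (induction t rule: frag_induction)
    case (diff a b)
    then show ?case by (simp add: formal_act_diff_left)
  qed (auto simp: formal_act_def frag_extend_diff)
qed

lemma formal_act_0_left [simp]: "formal_act act 0 u = 0"
  by (simp add: formal_act_def)

lemma formal_act_0_right [simp]: "formal_act act t 0 = 0"
  using formal_act_diff_right[of act t 0 0] by simp

lemma formal_act_of [simp]:
  "formal_act act (frag_of (l, a)) (frag_of (l', n)) = frag_of (l * l', act a n)"
  by (simp add: formal_act_def)

section \<open>Scalar extension along a domain into a field\<close>

text \<open>
  \<open>N\<close> ranges over \<open>R\<close>-submodules of a fixed \<open>A\<close>-module.  Elements of \<open>L \<otimes>\<^sub>R N\<close> are handled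
  through formal sums representing them; \<open>rels N\<close> is the group of formal sums
  representing zero.
\<close>

locale scalar_extension =
  fixes \<rho> :: "'r::idom \<Rightarrow> 'l::field"
    and \<phi> :: "'r \<Rightarrow> 'a::{ring,monoid_mult}"
    and act :: "'a \<Rightarrow> 'n::ab_group_add \<Rightarrow> 'n"
  assumes rho_hom: "ring_homomorphism \<rho>" and rho_eq_0: "\<rho> r = 0 \<Longrightarrow> r = 0"
    and alg: "is_algebra \<phi>" and left_module: "left_module act"
begin

lemma rho_add: "\<rho> (x + y) = \<rho> x + \<rho> y" and rho_mult: "\<rho> (x * y) = \<rho> x * \<rho> y" and rho_1: "\<rho> 1 = 1"
  using rho_hom by (auto simp: ring_homomorphism_def)

lemma phi_add: "\<phi> (x + y) = \<phi> x + \<phi> y" and phi_mult: "\<phi> (x * y) = \<phi> x * \<phi> y" and phi_1: "\<phi> 1 = 1"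
  and phi_central: "\<phi> r * b = b * \<phi> r"
  using alg unfolding is_algebra_def ring_homomorphism_def by blast+

lemma act_add_right: "act a (x + y) = act a x + act a y"
  and act_add_left: "act (a + b) x = act a x + act b x"
  and act_mult: "act (a * b) x = act a (act b x)" and act_1: "act 1 x = x"
  using left_module by (auto simp: left_module_def)

lemma act_0_right [simp]: "act a 0 = 0"
  using act_add_right[of a 0 0] by simp

lemma act_0_left [simp]: "act 0 x = 0"
  using act_add_left[of 0 0 x] by simp

lemma act_sum_right: "act a (sum f I) = (\<Sum>i\<in>I. act a (f i))"
  by (induction I rule: infinite_finite_induct) (auto simp: act_add_right)

lemma act_sum_left: "act (sum f I) x = (\<Sum>i\<in>I. act (f i) x)"
  by (induction I rule: infinite_finite_induct) (auto simp: act_add_left)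

lemma act_phi_commute: "act (\<phi> r) (act a x) = act a (act (\<phi> r) x)"
  by (simp add: phi_central flip: act_mult)

lemma module_act: "module (\<lambda>r m. act (\<phi> r) m)"
  by unfold_locales (auto simp: act_add_right act_add_left act_mult phi_add phi_mult phi_1 act_1)

lemma regular: "scalar_extension \<rho> \<phi> (*)"
  by unfold_locales (simp_all add: rho_hom rho_eq_0 alg left_module_def algebra_simps)

abbreviation submodule :: "'n set \<Rightarrow> bool" where
  "submodule \<equiv> module.subspace (\<lambda>r m. act (\<phi> r) m)"

lemma submodule_0: "submodule N \<Longrightarrow> 0 \<in> N"
  and submodule_add: "submodule N \<Longrightarrow> x \<in> N \<Longrightarrow> y \<in> N \<Longrightarrow> x + y \<in> N"
  and submodule_scale: "submodule N \<Longrightarrow> x \<in> N \<Longrightarrow> act (\<phi> r) x \<in> N"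
  using module.subspace_0[OF module_act] module.subspace_add[OF module_act]
    module.subspace_scale[OF module_act] by auto

lemma submodule_UNIV: "submodule UNIV"
  by (rule module.subspace_UNIV[OF module_act])

text \<open>\<open>Hom\<^sub>R(N, L)\<close>; by adjunction these are the \<open>L\<close>-linear functionals on \<open>L \<otimes>\<^sub>R N\<close>.\<close>

definition functional :: "'n set \<Rightarrow> ('n \<Rightarrow> 'l) \<Rightarrow> bool" where
  "functional N g \<longleftrightarrow> (\<forall>x\<in>N. \<forall>y\<in>N. g (x + y) = g x + g y) \<and> (\<forall>r. \<forall>x\<in>N. g (act (\<phi> r) x) = \<rho> r * g x)"

lemma functional_0:
  assumes "functional N g" and "0 \<in> N"
  shows "g 0 = 0"
proof -
  have "g (0 + 0) = g 0 + g 0" using assms unfolding functional_def by blast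
  then have "g 0 + g 0 = g 0 + 0" by simp
  then show ?thesis by (rule add_left_imp_eq)
qed

lemma functional_sum:
  assumes "functional N g" and "submodule N" and "\<And>i. i \<in> I \<Longrightarrow> f i \<in> N"
  shows "g (sum f I) = (\<Sum>i\<in>I. g (f i)) \<and> sum f I \<in> N"
  using assms(3)
proof (induction I rule: infinite_finite_induct)
  case (insert i I)
  then show ?case using assms(1,2) by (auto simp: functional_def submodule_add)
qed (use functional_0[OF assms(1)] submodule_0[OF assms(2)] in auto)

abbreviation rels :: "'n set \<Rightarrow> ('l \<times> 'n \<Rightarrow>\<^sub>0 int) set" where
  "rels N \<equiv> tensor_rels (\<lambda>r l. \<rho> r * l) (\<lambda>r n. act (\<phi> r) n) UNIV N"

abbreviation cls :: "'n set \<Rightarrow> ('l \<times> 'n \<Rightarrow>\<^sub>0 int) \<Rightarrow> ('l \<times> 'n \<Rightarrow>\<^sub>0 int) set" where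
  "cls N \<equiv> bc_class \<rho> \<phi> act N"

abbreviation formal :: "'x set \<Rightarrow> ('l \<times> 'x \<Rightarrow>\<^sub>0 int) set" where
  "formal N \<equiv> {u. Poly_Mapping.keys u \<subseteq> UNIV \<times> N}"

lemma rels_0: "0 \<in> rels N" and rels_diff: "u \<in> rels N \<Longrightarrow> v \<in> rels N \<Longrightarrow> u - v \<in> rels N"
  and rels_add: "u \<in> rels N \<Longrightarrow> v \<in> rels N \<Longrightarrow> u + v \<in> rels N"
  and rels_minus: "u \<in> rels N \<Longrightarrow> - u \<in> rels N"
  unfolding tensor_rels_def by (auto intro: group_closure.diff group_closure_add)

lemma rels_sum: "(\<And>i. i \<in> I \<Longrightarrow> f i \<in> rels N) \<Longrightarrow> sum f I \<in> rels N"
  by (induction I rule: infinite_finite_induct) (auto intro: rels_0 rels_add)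

lemma rels_left: "y \<in> N \<Longrightarrow> frag_of (l + l', y) - frag_of (l, y) - frag_of (l', y) \<in> rels N"
  and rels_right: "y \<in> N \<Longrightarrow> y' \<in> N \<Longrightarrow> frag_of (l, y + y') - frag_of (l, y) - frag_of (l, y') \<in> rels N"
  and rels_scale: "y \<in> N \<Longrightarrow> frag_of (\<rho> r * l, y) - frag_of (l, act (\<phi> r) y) \<in> rels N"
  unfolding tensor_rels_def by (rule group_closure.base; blast)+

lemma rels_induct [consumes 1, case_names left right scale zero diff]:
  assumes "u \<in> rels N"
    and "\<And>l l' y. y \<in> N \<Longrightarrow> P (frag_of (l + l', y) - frag_of (l, y) - frag_of (l', y))"
    and "\<And>l y y'. y \<in> N \<Longrightarrow> y' \<in> N \<Longrightarrow> P (frag_of (l, y + y') - frag_of (l, y) - frag_of (l, y'))"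
    and "\<And>r l y. y \<in> N \<Longrightarrow> P (frag_of (\<rho> r * l, y) - frag_of (l, act (\<phi> r) y))"
    and "P 0" and "\<And>u v. P u \<Longrightarrow> P v \<Longrightarrow> P (u - v)"
  shows "P u"
  using assms(1) unfolding tensor_rels_def
proof (induction rule: group_closure.induct)
  case (base s)
  then show ?case using assms(2-5) by auto
next
  case (diff s t)
  then show ?case using assms(6) by auto
qed

lemma rels_formal:
  assumes N: "submodule N" and "u \<in> rels N"
  shows "u \<in> formal N"
  using assms(2)
proof (induction rule: rels_induct)
  case (diff u v)
  then show ?case using keys_diff[of u v] by auto
qed (use submodule_add[OF N] submodule_scale[OF N] in
    \<open>auto dest!: keys_diff[THEN subsetD]\<close>)

lemma cls_eq_iff: "cls N u = cls N v \<longleftrightarrow> u - v \<in> rels N"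
proof
  assume "cls N u = cls N v"
  moreover have "u \<in> cls N u" by (simp add: bc_class_def tensor_class_def rels_0)
  ultimately show "u - v \<in> rels N" by (simp add: bc_class_def tensor_class_def)
next
  assume uv: "u - v \<in> rels N"
  have "w - u \<in> rels N \<longleftrightarrow> w - v \<in> rels N" for w
    using rels_add[OF _ uv, of "w - u"] rels_diff[OF _ uv, of "w - v"] by auto
  then show "cls N u = cls N v" by (auto simp: bc_class_def tensor_class_def)
qed

lemma in_cls: "v \<in> cls N u \<longleftrightarrow> v - u \<in> rels N"
  by (simp add: bc_class_def tensor_class_def)

lemma cls_self: "u \<in> cls N u"
  by (simp add: in_cls rels_0)

lemma in_cls_formal:
  assumes "submodule N" and "u \<in> formal N" and "v \<in> cls N u"
  shows "v \<in> formal N"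
proof -
  have "v - u \<in> formal N" using rels_formal assms in_cls by blast
  then show ?thesis using assms(2) keys_add[of "v - u" u] by auto
qed

lemma carrier_eq: "bc_carrier \<rho> \<phi> act N = cls N ` formal N"
  by (simp add: bc_carrier_def tensor_product_def bc_class_def)

lemma cls_in_carrier [simp]: "u \<in> formal N \<Longrightarrow> cls N u \<in> bc_carrier \<rho> \<phi> act N"
  by (simp add: carrier_eq)

lemma cls_UN:
  assumes "\<And>v. v \<in> cls N u \<Longrightarrow> H v = H u"
  shows "(\<Union>v\<in>cls N u. H v) = H u"
  using assms cls_self by blast

lemma bc_add_cls: "bc_add \<rho> \<phi> act N (cls N u) (cls N v) = cls N (u + v)"
proof -
  have "cls N (u' + v') = cls N (u + v)" if "u' \<in> cls N u" "v' \<in> cls N v" for u' v'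
  proof -
    have "(u' - u) + (v' - v) \<in> rels N" using that by (auto simp: in_cls intro: rels_add)
    then show ?thesis by (simp add: cls_eq_iff algebra_simps)
  qed
  then show ?thesis unfolding bc_add_def using cls_self by (intro antisym) blast+
qed

lemma tensor_eval_rels:
  assumes "submodule N" and "functional N g" and "u \<in> rels N"
  shows "tensor_eval g u = 0"
  using assms(3)
  by (induction rule: rels_induct)
    (use assms(2) in \<open>auto simp: functional_def tensor_eval_diff tensor_eval_add algebra_simps\<close>)

lemma tensor_eval_cls:
  assumes "submodule N" and "functional N g" and "v \<in> cls N u"
  shows "tensor_eval g v = tensor_eval g u"
  using tensor_eval_rels[OF assms(1,2), of "v - u"] assms(3) by (simp add: in_cls tensor_eval_diff)

end

lemma (in scalar_extension) formal_act_rels: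
  assumes N: "submodule N" and B: "\<And>a n. a \<in> B \<Longrightarrow> n \<in> N \<Longrightarrow> act a n \<in> N"
  shows formal_act_rels_right: "t \<in> formal B \<Longrightarrow> u \<in> rels N \<Longrightarrow> formal_act act t u \<in> rels N"
    and formal_act_rels_left: "t \<in> tensor_rels (\<lambda>r l. \<rho> r * l) (\<lambda>r a. \<phi> r * a) UNIV B \<Longrightarrow>
      u \<in> formal N \<Longrightarrow> formal_act act t u \<in> rels N"
proof -
  interpret reg: scalar_extension \<rho> \<phi> "(*)" by (rule regular)
  assume "t \<in> formal B" and u: "u \<in> rels N"
  then have "Poly_Mapping.keys t \<subseteq> UNIV \<times> B" by simp
  then show "formal_act act t u \<in> rels N"
  proof (induction t rule: frag_induction)
    case (one x)
    obtain l a where x: "x = (l, a)" "a \<in> B" using one by auto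
    show ?case using u
    proof (induction rule: rels_induct)
      case (left l1 l2 y)
      then show ?case using rels_left[of "act a y" N "l * l1" "l * l2"] B x
        by (simp add: formal_act_diff_right distrib_left)
    next
      case (right l1 y y')
      then show ?case using rels_right[of "act a y" N "act a y'" "l * l1"] B x
        by (simp add: formal_act_diff_right act_add_right)
    next
      case (scale r l1 y)
      then show ?case using rels_scale[of "act a y" N r "l * l1"] B x
        by (simp add: formal_act_diff_right act_phi_commute ac_simps)
    qed (auto simp: formal_act_diff_right rels_0 rels_diff)
  qed (auto simp: formal_act_diff_left rels_0 rels_diff)
next
  interpret reg: scalar_extension \<rho> \<phi> "(*)" by (rule regular)
  assume t: "t \<in> reg.rels B" and "u \<in> formal N"
  then have "Poly_Mapping.keys u \<subseteq> UNIV \<times> N" by simp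
  then show "formal_act act t u \<in> rels N"
  proof (induction u rule: frag_induction)
    case (one x)
    obtain l n where x: "x = (l, n)" "n \<in> N" using one by auto
    show ?case using t
    proof (induction rule: reg.rels_induct)
      case (left l1 l2 y)
      then show ?case using rels_left[of "act y n" N "l1 * l" "l2 * l"] B x
        by (simp add: formal_act_diff_left distrib_right)
    next
      case (right l1 y y')
      then show ?case using rels_right[of "act y n" N "act y' n" "l1 * l"] B x
        by (simp add: formal_act_diff_left act_add_left)
    next
      case (scale r l1 y)
      then show ?case using rels_scale[of "act y n" N r "l1 * l"] B x
        by (simp add: formal_act_diff_left act_mult ac_simps)
    qed (auto simp: formal_act_diff_left rels_0 rels_diff)
  qed (auto simp: formal_act_diff_right rels_0 rels_diff)
qed

context scalar_extension
begin

lemma bc_act_cls: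
  assumes N: "submodule N" and B: "module.subspace (\<lambda>r a. \<phi> r * a) B"
    and BN: "\<And>a n. a \<in> B \<Longrightarrow> n \<in> N \<Longrightarrow> act a n \<in> N"
    and t: "t \<in> formal B" and u: "u \<in> formal N"
  shows "bc_act \<rho> \<phi> act N (bc_class \<rho> \<phi> (*) B t) (cls N u) = cls N (formal_act act t u)"
proof -
  interpret reg: scalar_extension \<rho> \<phi> "(*)" by (rule regular)
  have "cls N (formal_act act t' u') = cls N (formal_act act t u)"
    if "t' \<in> reg.cls B t" "u' \<in> cls N u" for t' u'
  proof -
    have "t' \<in> formal B" using reg.in_cls_formal[OF B t that(1)] .
    then have "formal_act act t' (u' - u) \<in> rels N"
      using that(2) by (intro formal_act_rels_right[OF N BN]) (auto simp: in_cls)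
    moreover have "formal_act act (t' - t) u \<in> rels N"
      using that(1) u by (intro formal_act_rels_left[OF N BN]) (auto simp: reg.in_cls)
    ultimately have "formal_act act t' (u' - u) + formal_act act (t' - t) u \<in> rels N"
      by (rule rels_add)
    then show ?thesis by (simp add: cls_eq_iff formal_act_diff_left formal_act_diff_right)
  qed
  then show ?thesis
    unfolding bc_act_def formal_act_def[symmetric] using cls_self[of u] reg.cls_self[of t B]
    by (intro antisym) blast+
qed

lemma bc_map_cls:
  assumes N: "submodule N" and u: "u \<in> formal N"
    and f: "\<And>n. n \<in> N \<Longrightarrow> f n \<in> N" "\<And>x y. f (x + y) = f x + f y"
      "\<And>r x. f (act (\<phi> r) x) = act (\<phi> r) (f x)"
  shows "bc_map \<rho> \<phi> act N f (cls N u) = cls N (formal_map f u)"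
proof -
  have "formal_map f w \<in> rels N" if "w \<in> rels N" for w
    using that
  proof (induction rule: rels_induct)
    case (left l l' y)
    then show ?case using rels_left[of "f y" N l l'] f
      by (simp add: formal_map_diff) (simp add: formal_map_def)
  next
    case (right l y y')
    then show ?case using rels_right[of "f y" N "f y'" l] f
      by (simp add: formal_map_diff) (simp add: formal_map_def)
  next
    case (scale r l y)
    then show ?case using rels_scale[of "f y" N r l] f
      by (simp add: formal_map_diff) (simp add: formal_map_def)
  next
    case zero
    then show ?case by (simp add: formal_map_def rels_0)
  qed (simp add: formal_map_diff rels_diff)
  then have "cls N (formal_map f v) = cls N (formal_map f u)" if "v \<in> cls N u" for v
    using that by (simp add: in_cls cls_eq_iff flip: formal_map_diff)
  then show ?thesis
    unfolding bc_map_def formal_map_def[symmetric] by (rule cls_UN)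
qed

end

section \<open>Bilinear forms, polarisations and self-duality\<close>

context scalar_extension
begin

lemma rho_0: "\<rho> 0 = 0"
proof -
  have "\<rho> 0 + \<rho> 0 = \<rho> 0 + 0" using rho_add[of 0 0] by simp
  then show ?thesis by (rule add_left_imp_eq)
qed

definition finitely_generated_submodule :: "'n set \<Rightarrow> bool" where
  "finitely_generated_submodule N \<longleftrightarrow> submodule N \<and>
     (\<exists>G. finite G \<and> G \<subseteq> N \<and> (\<forall>n\<in>N. \<exists>f. n = (\<Sum>g\<in>G. act (\<phi> (f g)) g)))"

lemma finitely_generated_submoduleD: "finitely_generated_submodule N \<Longrightarrow> submodule N"
  by (simp add: finitely_generated_submodule_def)

lemma coordinates:
  assumes "finitely_generated_submodule N"
  obtains B D h where "finite B" and "B \<subseteq> N" and "D \<noteq> 0"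
    and "\<And>n. n \<in> N \<Longrightarrow> act (\<phi> D) n = (\<Sum>b\<in>B. act (\<phi> (h b n)) b)"
    and "\<And>b. b \<in> B \<Longrightarrow> functional N (\<lambda>n. \<rho> (h b n))"
    and "\<And>b b'. b \<in> B \<Longrightarrow> b' \<in> B \<Longrightarrow> h b b' = (if b = b' then D else 0)"
proof -
  obtain G where G: "finite G" "G \<subseteq> N" "\<forall>n\<in>N. \<exists>f. n = (\<Sum>g\<in>G. act (\<phi> (f g)) g)"
    and N: "submodule N"
    using assms unfolding finitely_generated_submodule_def by blast
  obtain B D h where "finite B" "B \<subseteq> N" "D \<noteq> 0"
    "\<And>n. n \<in> N \<Longrightarrow> act (\<phi> D) n = (\<Sum>b\<in>B. act (\<phi> (h b n)) b)"
    and h: "\<And>b x y. b \<in> B \<Longrightarrow> x \<in> N \<Longrightarrow> y \<in> N \<Longrightarrow> h b (x + y) = h b x + h b y"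
      "\<And>b r x. b \<in> B \<Longrightarrow> x \<in> N \<Longrightarrow> h b (act (\<phi> r) x) = r * h b x"
    and "\<And>b b'. b \<in> B \<Longrightarrow> b' \<in> B \<Longrightarrow> h b b' = (if b = b' then D else 0)"
    by (rule finitely_generated_coordinates[OF module_act N G]) blast
  moreover have "functional N (\<lambda>n. \<rho> (h b n))" if "b \<in> B" for b
    using h[OF that] by (simp add: functional_def rho_add rho_mult)
  ultimately show thesis using that by blast
qed

lemma frag_of_zero_rels: "y \<in> N \<Longrightarrow> frag_of (0, y) \<in> rels N"
  using rels_left[of y N 0 0] rels_minus[of "- frag_of (0, y)"] by simp

lemma frag_of_diff_rels:
  assumes "y \<in> N"
  shows "frag_of (l - l', y) - (frag_of (l, y) - frag_of (l', y)) \<in> rels N"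
  using rels_minus[OF rels_left[OF assms, of "l - l'" l']] by (simp add: algebra_simps)

lemma frag_of_sum_rels:
  assumes N: "submodule N" and "finite I" and "\<And>i. i \<in> I \<Longrightarrow> f i \<in> N"
  shows "frag_of (l, sum f I) - (\<Sum>i\<in>I. frag_of (l, f i)) \<in> rels N"
  using assms(2,3)
proof (induction I rule: finite_induct)
  case empty
  have "frag_of (l, 0 + 0) - frag_of (l, 0) - frag_of (l, 0) \<in> rels N"
    by (rule rels_right) (use submodule_0[OF N] in auto)
  then show ?case using rels_minus[of "- frag_of (l, 0)" N] by simp
next
  case (insert i I)
  have "sum f I \<in> N"
    using insert by (intro module.subspace_sum[OF module_act N]) auto
  then have "frag_of (l, f i + sum f I) - frag_of (l, f i) - frag_of (l, sum f I) \<in> rels N"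
    using insert by (intro rels_right) auto
  from rels_add[OF this insert.IH] show ?case using insert by (simp add: algebra_simps)
qed

text \<open>
  Functionals separate the points of \<open>L \<otimes>\<^sub>R N\<close>.  With the coordinates of the previous lemma,
  \<open>u\<close> is congruent to \<open>\<Sum>\<^sub>b D\<^sup>-\<^sup>1 h\<^sub>b(u) \<otimes> b\<close>.
\<close>

lemma rels_iff:
  assumes fg: "finitely_generated_submodule N" and u: "u \<in> formal N"
  shows "u \<in> rels N \<longleftrightarrow> (\<forall>g. functional N g \<longrightarrow> tensor_eval g u = 0)"
proof
  assume "u \<in> rels N"
  then show "\<forall>g. functional N g \<longrightarrow> tensor_eval g u = 0"
    using tensor_eval_rels finitely_generated_submoduleD[OF fg] by blast
next
  assume zero: "\<forall>g. functional N g \<longrightarrow> tensor_eval g u = 0"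
  have N: "submodule N" by (rule finitely_generated_submoduleD[OF fg])
  obtain B D h where B: "finite B" "B \<subseteq> N" "D \<noteq> 0"
    and D: "\<And>n. n \<in> N \<Longrightarrow> act (\<phi> D) n = (\<Sum>b\<in>B. act (\<phi> (h b n)) b)"
    and h: "\<And>b. b \<in> B \<Longrightarrow> functional N (\<lambda>n. \<rho> (h b n))"
    by (rule coordinates[OF fg]) blast
  define E where "E b v = tensor_eval (\<lambda>n. \<rho> (h b n)) v / \<rho> D" for b v
  have D0: "\<rho> D \<noteq> 0" using B(3) rho_eq_0 by blast
  have "Poly_Mapping.keys u \<subseteq> UNIV \<times> N" using u by simp
  then have "u - (\<Sum>b\<in>B. frag_of (E b u, b)) \<in> rels N"
  proof (induction u rule: frag_induction)
    case zero
    have "(\<Sum>b\<in>B. frag_of (0, b)) \<in> rels N"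
      using B(2) by (intro rels_sum frag_of_zero_rels) auto
    from rels_minus[OF this] show ?case by (simp add: E_def)
  next
    case (one x)
    then obtain l n where x: "x = (l, n)" "n \<in> N" by auto
    define k where "k = l / \<rho> D"
    have l: "l = \<rho> D * k" using D0 by (simp add: k_def)
    have hN: "act (\<phi> (h b n)) b \<in> N" if "b \<in> B" for b
      using submodule_scale[OF N] B that by blast
    have "frag_of (l, n) - frag_of (k, act (\<phi> D) n) \<in> rels N"
      unfolding l by (rule rels_scale) fact
    moreover have "frag_of (k, act (\<phi> D) n) - (\<Sum>b\<in>B. frag_of (k, act (\<phi> (h b n)) b)) \<in> rels N"
      unfolding D[OF x(2)] by (rule frag_of_sum_rels[OF N B(1)]) (use hN in auto)
    moreover have "(\<Sum>b\<in>B. frag_of (\<rho> (h b n) * k, b) - frag_of (k, act (\<phi> (h b n)) b)) \<in> rels N"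
      using B(2) by (intro rels_sum rels_scale) auto
    ultimately have "(frag_of (l, n) - frag_of (k, act (\<phi> D) n)) +
        (frag_of (k, act (\<phi> D) n) - (\<Sum>b\<in>B. frag_of (k, act (\<phi> (h b n)) b))) -
        (\<Sum>b\<in>B. frag_of (\<rho> (h b n) * k, b) - frag_of (k, act (\<phi> (h b n)) b)) \<in> rels N"
      by (rule rels_diff[OF rels_add])
    then show ?case by (simp add: x E_def k_def sum_subtractf ac_simps)
  next
    case (diff v w)
    have "(\<Sum>b\<in>B. frag_of (E b v - E b w, b) - (frag_of (E b v, b) - frag_of (E b w, b))) \<in> rels N"
      using B(2) by (intro rels_sum frag_of_diff_rels) auto
    from rels_diff[OF rels_diff[OF diff] this]
    moreover have "E b (v - w) = E b v - E b w" for b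
      by (simp add: E_def tensor_eval_diff diff_divide_distrib)
    ultimately show ?case by (simp only: sum_subtractf) (simp add: algebra_simps)
  qed
  moreover have "(\<Sum>b\<in>B. frag_of (E b u, b)) \<in> rels N"
    using B(2) zero h by (intro rels_sum) (auto simp: E_def intro!: frag_of_zero_rels)
  ultimately have "u - (\<Sum>b\<in>B. frag_of (E b u, b)) + (\<Sum>b\<in>B. frag_of (E b u, b)) \<in> rels N"
    by (rule rels_add)
  then show "u \<in> rels N" by simp
qed

definition bilinear_on :: "'n set \<Rightarrow> ('n \<Rightarrow> 'n \<Rightarrow> 'l) \<Rightarrow> bool" where
  "bilinear_on N b \<longleftrightarrow> (\<forall>x\<in>N. functional N (b x) \<and> functional N (\<lambda>y. b y x))"

text \<open>
  Non-degeneracy of the extension of \<open>b\<close> to \<open>L \<otimes>\<^sub>R N\<close>, in terms of formal sums: an element in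
  the left or right kernel is annihilated by all functionals, and so is zero.
\<close>

definition nondegenerate_on :: "'n set \<Rightarrow> ('n \<Rightarrow> 'n \<Rightarrow> 'l) \<Rightarrow> bool" where
  "nondegenerate_on N b \<longleftrightarrow> (\<forall>u\<in>formal N.
     (\<forall>y\<in>N. tensor_eval (\<lambda>x. b x y) u = 0) \<or> (\<forall>x\<in>N. tensor_eval (b x) u = 0) \<longrightarrow>
     (\<forall>g. functional N g \<longrightarrow> tensor_eval g u = 0))"

lemma nondegenerate_onD:
  assumes "nondegenerate_on N b" and "u \<in> formal N"
    and "(\<forall>y\<in>N. tensor_eval (\<lambda>x. b x y) u = 0) \<or> (\<forall>x\<in>N. tensor_eval (b x) u = 0)"
    and "functional N g"
  shows "tensor_eval g u = 0"
  using assms unfolding nondegenerate_on_def by blast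

text \<open>
  The \<open>L\<close>-bilinear extension of \<open>b\<close> to \<open>L \<otimes>\<^sub>R N\<close>, computed on chosen representatives; the choice
  does not matter when \<open>b\<close> is \<open>R\<close>-bilinear.
\<close>

definition pairing :: "('n \<Rightarrow> 'n \<Rightarrow> 'l) \<Rightarrow> ('l \<times> 'n \<Rightarrow>\<^sub>0 int) set \<Rightarrow> ('l \<times> 'n \<Rightarrow>\<^sub>0 int) set \<Rightarrow> 'l" where
  "pairing b X Y = tensor_eval (\<lambda>x. tensor_eval (b x) (SOME v. v \<in> Y)) (SOME u. u \<in> X)"

lemma functional_tensor_eval:
  assumes "\<And>y. y \<in> N \<Longrightarrow> functional N (\<lambda>x. b x y)" and "v \<in> formal N" and N: "submodule N"
  shows "functional N (\<lambda>x. tensor_eval (b x) v)"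
proof -
  have "tensor_eval (b (x + x')) v = tensor_eval (b x) v + tensor_eval (b x') v"
    if "x \<in> N" "x' \<in> N" for x x'
    unfolding tensor_eval_plus[symmetric]
    by (rule tensor_eval_cong[of _ N]) (use assms that in \<open>auto simp: functional_def\<close>)
  moreover have "tensor_eval (b (act (\<phi> r) x)) v = \<rho> r * tensor_eval (b x) v"
    if "x \<in> N" for x r
    unfolding tensor_eval_scale[symmetric]
    by (rule tensor_eval_cong[of _ N]) (use assms that in \<open>auto simp: functional_def\<close>)
  ultimately show ?thesis by (simp add: functional_def)
qed

lemma pairing_cls:
  assumes N: "submodule N" and b: "bilinear_on N b" and u: "u \<in> formal N" and v: "v \<in> formal N"
  shows "pairing b (cls N u) (cls N v) = tensor_eval (\<lambda>x. tensor_eval (b x) v) u"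
proof -
  define u' where "u' = (SOME u'. u' \<in> cls N u)"
  define v' where "v' = (SOME v'. v' \<in> cls N v)"
  have u': "u' \<in> cls N u" and v': "v' \<in> cls N v"
    unfolding u'_def v'_def by (rule someI, rule cls_self)+
  have "pairing b (cls N u) (cls N v) = tensor_eval (\<lambda>x. tensor_eval (b x) v') u'"
    by (simp add: pairing_def u'_def v'_def)
  also have "\<dots> = tensor_eval (\<lambda>x. tensor_eval (b x) v) u'"
    by (rule tensor_eval_cong[of _ N])
      (use in_cls_formal[OF N u u'] tensor_eval_cls[OF N _ v'] b in \<open>auto simp: bilinear_on_def\<close>)
  also have "\<dots> = tensor_eval (\<lambda>x. tensor_eval (b x) v) u"
    by (rule tensor_eval_cls[OF N functional_tensor_eval[OF _ v N] u'])
      (use b in \<open>auto simp: bilinear_on_def\<close>)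
  finally show ?thesis .
qed

text \<open>\<open>B\<close> is an \<open>R\<close>-submodule of \<open>A\<close> containing \<open>1\<close> and preserving the submodule \<open>N\<close>.\<close>

definition acts_on :: "'a set \<Rightarrow> 'n set \<Rightarrow> bool" where
  "acts_on B N \<longleftrightarrow> submodule N \<and> module.subspace (\<lambda>r a. \<phi> r * a) B \<and> 1 \<in> B \<and>
     (\<forall>a\<in>B. \<forall>n\<in>N. act a n \<in> N)"

lemma bc_act_scalar:
  assumes "acts_on B N" and "u \<in> formal N"
  shows "bc_act \<rho> \<phi> act N (bc_pure \<rho> \<phi> (*) B l 1) (cls N u) =
    cls N (formal_act act (frag_of (l, 1)) u)"
  unfolding bc_pure_def
  by (rule bc_act_cls) (use assms in \<open>auto simp: acts_on_def\<close>)

lemma formal_act_scalar_formal: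
  assumes "acts_on B N" and "u \<in> formal N"
  shows "formal_act act (frag_of (l, 1)) u \<in> formal N"
  using keys_formal_act[of "frag_of (l, 1)" "{1}" u N act] assms by (simp add: act_1)

lemma tensor_eval_act_scalar:
  "tensor_eval g (formal_act act (frag_of (l, 1)) u) = l * tensor_eval g u"
  by (simp add: tensor_eval_act act_1)

lemma formal_add: "u \<in> formal N \<Longrightarrow> v \<in> formal N \<Longrightarrow> u + v \<in> formal N"
  and formal_diff: "u \<in> formal N \<Longrightarrow> v \<in> formal N \<Longrightarrow> u - v \<in> formal N"
  using keys_add[of u v] keys_diff[of u v] by auto

lemma L_bilinear_pairing:
  assumes BN: "acts_on B N" and b: "bilinear_on N b"
  shows "L_bilinear (\<lambda>l. bc_pure \<rho> \<phi> (*) B l 1) (base_change \<rho> \<phi> act N) (pairing b)"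
proof -
  have N: "submodule N" using BN by (simp add: acts_on_def)
  note [simp] = pairing_cls[OF N b] bc_add_cls bc_act_scalar[OF BN] tensor_eval_add
    tensor_eval_plus tensor_eval_act_scalar tensor_eval_scale
  show ?thesis
    unfolding L_bilinear_def base_change_def act_module.simps carrier_eq
    using formal_add[of _ N] formal_act_scalar_formal[OF BN] by simp
qed

text \<open>An \<open>L\<close>-linear functional on \<open>L \<otimes>\<^sub>R N\<close> is determined by its restriction to \<open>N\<close>.\<close>

lemma carrier_functional:
  assumes BN: "acts_on B N"
    and add: "\<And>X Y. X \<in> bc_carrier \<rho> \<phi> act N \<Longrightarrow> Y \<in> bc_carrier \<rho> \<phi> act N \<Longrightarrow>
      \<psi> (bc_add \<rho> \<phi> act N X Y) = \<psi> X + \<psi> Y"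
    and scale: "\<And>l X. X \<in> bc_carrier \<rho> \<phi> act N \<Longrightarrow>
      \<psi> (bc_act \<rho> \<phi> act N (bc_pure \<rho> \<phi> (*) B l 1) X) = l * \<psi> X"
  shows carrier_functional_eval: "u \<in> formal N \<Longrightarrow>
      \<psi> (cls N u) = tensor_eval (\<lambda>n. \<psi> (cls N (frag_of (1, n)))) u"
    and carrier_functional_functional: "functional N (\<lambda>n. \<psi> (cls N (frag_of (1, n))))"
proof -
  have N: "submodule N" using BN by (simp add: acts_on_def)
  have add': "\<psi> (cls N (u + v)) = \<psi> (cls N u) + \<psi> (cls N v)" if "u \<in> formal N" "v \<in> formal N" for u v
    using add[of "cls N u" "cls N v"] that by (simp add: bc_add_cls)
  have pure: "\<psi> (cls N (frag_of (l, n))) = l * \<psi> (cls N (frag_of (1, n)))" if "n \<in> N" for l n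
    using scale[of "cls N (frag_of (1, n))" l] that bc_act_scalar[OF BN, of "frag_of (1, n)" l]
    by (simp add: act_1)
  have "\<psi> (cls N u) = tensor_eval (\<lambda>n. \<psi> (cls N (frag_of (1, n)))) u \<and> u \<in> formal N"
    if "Poly_Mapping.keys u \<subseteq> UNIV \<times> N" for u
    using that
  proof (induction u rule: frag_induction)
    case zero
    have "\<psi> (cls N 0) + \<psi> (cls N 0) = \<psi> (cls N 0) + 0" using add'[of 0 0] by simp
    then have "\<psi> (cls N 0) = 0" by (rule add_left_imp_eq)
    then show ?case by simp
  next
    case (one x)
    then show ?case using pure[of "snd x" "fst x"] by (cases x) auto
  next
    case (diff a b)
    then show ?case using add'[of "a - b" b] formal_diff[of a N b] by (simp add: tensor_eval_diff)
  qed
  then show "u \<in> formal N \<Longrightarrow> \<psi> (cls N u) = tensor_eval (\<lambda>n. \<psi> (cls N (frag_of (1, n)))) u"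
    by simp
  have "\<psi> (cls N (frag_of (1, x + y))) = \<psi> (cls N (frag_of (1, x))) + \<psi> (cls N (frag_of (1, y)))"
    if "x \<in> N" "y \<in> N" for x y
  proof -
    have "cls N (frag_of (1, x + y)) = cls N (frag_of (1, x) + frag_of (1, y))"
      using rels_right[OF that, of 1] by (simp add: cls_eq_iff algebra_simps)
    then show ?thesis using add' that formal_add by simp
  qed
  moreover have "\<psi> (cls N (frag_of (1, act (\<phi> r) x))) = \<rho> r * \<psi> (cls N (frag_of (1, x)))"
    if "x \<in> N" for r x
  proof -
    have "cls N (frag_of (1, act (\<phi> r) x)) = cls N (frag_of (\<rho> r, x))"
      using rels_minus[OF rels_scale[OF that, of r 1]] by (simp add: cls_eq_iff)
    then show ?thesis using pure[OF that, of "\<rho> r"] by simp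
  qed
  ultimately show "functional N (\<lambda>n. \<psi> (cls N (frag_of (1, n))))" by (simp add: functional_def)
qed

lemma acts_on_UNIV: "acts_on UNIV UNIV"
proof -
  interpret reg: scalar_extension \<rho> \<phi> "(*)" by (rule regular)
  show ?thesis by (simp add: acts_on_def submodule_UNIV reg.submodule_UNIV)
qed

text \<open>
  The \<open>L\<close>-bilinear extension of a pairing can be eliminated from the notion of a polarisation,
  since it is determined by the pairing.
\<close>

lemma polarisable_iff_form:
  assumes fg: "finitely_generated_submodule UNIV"
  shows "polarisable \<rho> \<phi> \<iota> act GM \<longleftrightarrow>
    (\<exists>b. bilinear_on UNIV b \<and> nondegenerate_on UNIV b \<and>
      (\<forall>c c'. c \<noteq> c' \<longrightarrow> (\<forall>x\<in>GM c. \<forall>y\<in>GM c'. b x y = 0)) \<and>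
      (\<forall>T x y. b (act T x) y = b x (act (\<iota> T) y)))"
proof
  assume "polarisable \<rho> \<phi> \<iota> act GM"
  then obtain b \<beta> where add: "\<forall>x y z. b (x + y) z = b x z + b y z \<and> b z (x + y) = b z x + b z y"
    and scale: "\<forall>r x y. b (act (\<phi> r) x) y = \<rho> r * b x y \<and> b x (act (\<phi> r) y) = \<rho> r * b x y"
    and \<beta>: "L_bilinear (\<lambda>l. bc_pure \<rho> \<phi> (*) UNIV l 1) (base_change \<rho> \<phi> act UNIV) \<beta>"
    and \<beta>b: "\<And>x y. \<beta> (bc_pure \<rho> \<phi> act UNIV 1 x) (bc_pure \<rho> \<phi> act UNIV 1 y) = b x y"
    and nd: "non_degenerate (bc_carrier \<rho> \<phi> act UNIV) (bc_class \<rho> \<phi> act UNIV 0) \<beta>"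
    and orth: "\<forall>c c'. c \<noteq> c' \<longrightarrow> (\<forall>x\<in>GM c. \<forall>y\<in>GM c'. b x y = 0)"
    and adj: "\<forall>T x y. b (act T x) y = b x (act (\<iota> T) y)"
    unfolding polarisable_def polarisation_def by blast
  let ?V = "bc_carrier \<rho> \<phi> act UNIV"
  note U = acts_on_UNIV
  have "bilinear_on UNIV b" using add scale by (simp add: bilinear_on_def functional_def)
  moreover have "nondegenerate_on UNIV b"
    unfolding nondegenerate_on_def
  proof (intro ballI impI)
    fix u :: "'l \<times> 'n \<Rightarrow>\<^sub>0 int"
    assume "u \<in> formal UNIV"
    assume ker: "(\<forall>y\<in>UNIV. tensor_eval (\<lambda>x. b x y) u = 0) \<or> (\<forall>x\<in>UNIV. tensor_eval (b x) u = 0)"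
    have left: "\<beta> (cls UNIV v) Y = tensor_eval (\<lambda>x. \<beta> (cls UNIV (frag_of (1, x))) Y) v" if "Y \<in> ?V" for v Y
      by (rule carrier_functional_eval[OF U, where \<psi> = "\<lambda>X. \<beta> X Y"])
        (use \<beta> that in \<open>auto simp: L_bilinear_def base_change_def\<close>)
    have right: "\<beta> Y (cls UNIV v) = tensor_eval (\<lambda>x. \<beta> Y (cls UNIV (frag_of (1, x)))) v" if "Y \<in> ?V" for v Y
      by (rule carrier_functional_eval[OF U, where \<psi> = "\<lambda>X. \<beta> Y X"])
        (use \<beta> that in \<open>auto simp: L_bilinear_def base_change_def\<close>)
    have b: "\<beta> (cls UNIV (frag_of (1, x))) (cls UNIV (frag_of (1, y))) = b x y" for x y
      using \<beta>b by (simp add: bc_pure_def)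
    have "(\<forall>Y\<in>?V. \<beta> (cls UNIV u) Y = 0) \<or> (\<forall>X\<in>?V. \<beta> X (cls UNIV u) = 0)"
      using ker
    proof (elim disj_forward)
      assume *: "\<forall>y\<in>UNIV. tensor_eval (\<lambda>x. b x y) u = 0"
      have "\<beta> (cls UNIV u) (cls UNIV (frag_of (1, y))) = 0" for y
        using * by (subst left) (simp_all add: b)
      then have "\<beta> (cls UNIV u) (cls UNIV v) = 0" for v
        by (subst right) simp_all
      then show "\<forall>Y\<in>?V. \<beta> (cls UNIV u) Y = 0" by (auto simp: carrier_eq)
    next
      assume *: "\<forall>x\<in>UNIV. tensor_eval (b x) u = 0"
      have "\<beta> (cls UNIV (frag_of (1, x))) (cls UNIV u) = 0" for x
        using * by (subst right) (simp_all add: b)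
      then have "\<beta> (cls UNIV v) (cls UNIV u) = 0" for v
        by (subst left) simp_all
      then show "\<forall>X\<in>?V. \<beta> X (cls UNIV u) = 0" by (auto simp: carrier_eq)
    qed
    then have "cls UNIV u = cls UNIV 0" using nd unfolding non_degenerate_def by auto
    then have "u \<in> rels UNIV" by (simp add: cls_eq_iff)
    then show "\<forall>g. functional UNIV g \<longrightarrow> tensor_eval g u = 0"
      using rels_iff[OF fg] by simp
  qed
  ultimately show "\<exists>b. bilinear_on UNIV b \<and> nondegenerate_on UNIV b \<and>
      (\<forall>c c'. c \<noteq> c' \<longrightarrow> (\<forall>x\<in>GM c. \<forall>y\<in>GM c'. b x y = 0)) \<and>
      (\<forall>T x y. b (act T x) y = b x (act (\<iota> T) y))" using orth adj by blast
next
  assume "\<exists>b. bilinear_on UNIV b \<and> nondegenerate_on UNIV b \<and>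
      (\<forall>c c'. c \<noteq> c' \<longrightarrow> (\<forall>x\<in>GM c. \<forall>y\<in>GM c'. b x y = 0)) \<and>
      (\<forall>T x y. b (act T x) y = b x (act (\<iota> T) y))"
  then obtain b where b: "bilinear_on UNIV b" and nd: "nondegenerate_on UNIV b"
    and orth: "\<forall>c c'. c \<noteq> c' \<longrightarrow> (\<forall>x\<in>GM c. \<forall>y\<in>GM c'. b x y = 0)"
    and adj: "\<forall>T x y. b (act T x) y = b x (act (\<iota> T) y)" by blast
  note pair = pairing_cls[OF submodule_UNIV b]
  have zero: "cls UNIV u = cls UNIV 0"
    if "(\<forall>y. tensor_eval (\<lambda>x. b x y) u = 0) \<or> (\<forall>x. tensor_eval (b x) u = 0)" for u
  proof -
    have "\<forall>g. functional UNIV g \<longrightarrow> tensor_eval g u = 0"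
      by (intro allI impI nondegenerate_onD[OF nd]) (use that in simp_all)
    then have "u \<in> rels UNIV" by (subst rels_iff[OF fg]) auto
    then show ?thesis by (simp add: cls_eq_iff)
  qed
  have "non_degenerate (bc_carrier \<rho> \<phi> act UNIV) (bc_class \<rho> \<phi> act UNIV 0) (pairing b)"
    unfolding non_degenerate_def
  proof (intro conjI ballI impI)
    fix X assume X: "X \<in> bc_carrier \<rho> \<phi> act UNIV"
    then obtain u where u: "X = cls UNIV u" by (auto simp: carrier_eq)
    {
      assume *: "\<forall>Y\<in>bc_carrier \<rho> \<phi> act UNIV. pairing b X Y = 0"
      have "tensor_eval (\<lambda>x. b x y) u = 0" for y
        using *[rule_format, of "cls UNIV (frag_of (1, y))"] by (simp add: u pair)
      then show "X = cls UNIV 0" unfolding u by (intro zero) blast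
    next
      assume *: "\<forall>Y\<in>bc_carrier \<rho> \<phi> act UNIV. pairing b Y X = 0"
      have "tensor_eval (b x) u = 0" for x
        using *[rule_format, of "cls UNIV (frag_of (1, x))"] by (simp add: u pair)
      then show "X = cls UNIV 0" unfolding u by (intro zero) blast
    }
  qed
  moreover have "pairing b (bc_pure \<rho> \<phi> act UNIV 1 x) (bc_pure \<rho> \<phi> act UNIV 1 y) = b x y" for x y
    by (simp add: bc_pure_def pair)
  ultimately have "polarisation \<rho> \<phi> \<iota> act GM b"
    unfolding polarisation_def using b L_bilinear_pairing[OF acts_on_UNIV b] orth adj
    by (auto simp: bilinear_on_def functional_def)
  then show "polarisable \<rho> \<phi> \<iota> act GM" unfolding polarisable_def by blast
qed

text \<open>
  On a finitely generated module, the functional \<open>g\<close> is represented by an element of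
  \<open>L \<otimes>\<^sub>R N\<close> under a non-degenerate form.  On a basis \<open>B\<close> this is a relation between the rows of
  the Gram matrix and the row of values of \<open>g\<close>, in which the latter must occur.
\<close>

lemma functional_represented:
  assumes fg: "finitely_generated_submodule N" and b: "bilinear_on N b" and nd: "nondegenerate_on N b"
    and g: "functional N g"
  obtains u where "u \<in> formal N" and "\<And>y. y \<in> N \<Longrightarrow> tensor_eval (\<lambda>x. b x y) u = g y"
proof -
  have N: "submodule N" by (rule finitely_generated_submoduleD[OF fg])
  obtain B D h where B: "finite B" "B \<subseteq> N" "D \<noteq> 0"
    and D: "\<And>n. n \<in> N \<Longrightarrow> act (\<phi> D) n = (\<Sum>b\<in>B. act (\<phi> (h b n)) b)"
    and h: "\<And>b. b \<in> B \<Longrightarrow> functional N (\<lambda>n. \<rho> (h b n))"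
    and delta: "\<And>b b'. b \<in> B \<Longrightarrow> b' \<in> B \<Longrightarrow> h b b' = (if b = b' then D else 0)"
    by (rule coordinates[OF fg]) blast
  have D0: "\<rho> D \<noteq> 0" using B(3) rho_eq_0 by blast
  \<comment> \<open>functionals are determined by their values on \<open>B\<close>\<close>
  have ext: "f y = f' y" if f: "functional N f" "functional N f'" and eq: "\<And>z. z \<in> B \<Longrightarrow> f z = f' z"
    and y: "y \<in> N" for f f' y
  proof -
    have hN: "act (\<phi> (h z y)) z \<in> N" if "z \<in> B" for z
      using submodule_scale[OF N] B that by blast
    have *: "\<rho> D * f y = (\<Sum>z\<in>B. \<rho> (h z y) * f z)" if "functional N f" for f
    proof -
      have "\<rho> D * f y = f (act (\<phi> D) y)" using that y by (simp add: functional_def)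
      also have "\<dots> = (\<Sum>z\<in>B. f (act (\<phi> (h z y)) z))"
        unfolding D[OF y] by (rule functional_sum[OF that N, THEN conjunct1]) (rule hN)
      also have "\<dots> = (\<Sum>z\<in>B. \<rho> (h z y) * f z)"
        using that B(2) by (intro sum.cong) (auto simp: functional_def)
      finally show ?thesis .
    qed
    have "\<rho> D * f y = \<rho> D * f' y"
      unfolding *[OF f(1)] *[OF f(2)] using eq by (intro sum.cong) auto
    then show ?thesis using D0 by simp
  qed
  define c where "c i z = (case i of None \<Rightarrow> g z | Some x \<Rightarrow> b x z)" for i z
  let ?I = "insert None (Some ` B)"
  have "card B < card ?I" using B(1) by (simp add: card_image)
  then obtain r i where i: "i \<in> ?I" "r i \<noteq> 0" and r: "\<And>z. z \<in> B \<Longrightarrow> (\<Sum>i\<in>?I. r i * c i z) = 0"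
    using more_rows_than_columns_dependent[OF B(1), of ?I c] B(1) by blast
  have r': "r None * g z + (\<Sum>x\<in>B. r (Some x) * b x z) = 0" if "z \<in> B" for z
    using r[OF that] B(1) by (simp add: c_def sum.reindex)
  have fun_b: "functional N (\<lambda>y. tensor_eval (\<lambda>x. b x y) v)" if "v \<in> formal N" for v
    by (rule functional_tensor_eval[OF _ that N]) (use b in \<open>auto simp: bilinear_on_def\<close>)
  have fin: "(\<Sum>x\<in>B. frag_of (k x, x)) \<in> formal N" for k :: "'n \<Rightarrow> 'l"
    using B(2) by (auto dest!: keys_sum[THEN subsetD])
  \<comment> \<open>otherwise the rows of the Gram matrix are dependent, against non-degeneracy\<close>
  have "r None \<noteq> 0"
  proof
    assume None: "r None = 0"
    define v where "v = (\<Sum>x\<in>B. frag_of (r (Some x), x))"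
    have v: "v \<in> formal N" using fin by (simp add: v_def)
    have "functional N (\<lambda>_. 0)" by (simp add: functional_def)
    then have "tensor_eval (\<lambda>x. b x y) v = 0" if "y \<in> N" for y
      by (rule ext[OF fun_b[OF v] _ _ that]) (use r' None in \<open>simp add: v_def tensor_eval_sum\<close>)
    then have zero: "tensor_eval f v = 0" if "functional N f" for f
      using nondegenerate_onD[OF nd v _ that] by blast
    obtain x where x: "x \<in> B" "r (Some x) \<noteq> 0" using i None by auto
    have "tensor_eval (\<lambda>n. \<rho> (h x n)) v = (\<Sum>z\<in>B. r (Some z) * \<rho> (if x = z then D else 0))"
      using delta x by (simp add: v_def tensor_eval_sum)
    also have "\<dots> = (\<Sum>z\<in>B. if x = z then r (Some z) * \<rho> D else 0)"
      by (intro sum.cong) (auto simp: rho_0)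
    also have "\<dots> = r (Some x) * \<rho> D" using x B(1) by simp
    finally show False using zero[OF h[OF x(1)]] x D0 by simp
  qed
  define u where "u = (\<Sum>x\<in>B. frag_of (- r (Some x) / r None, x))"
  show thesis
  proof (rule that[of u])
    show u: "u \<in> formal N" using fin by (simp add: u_def)
    show "tensor_eval (\<lambda>x. b x y) u = g y" if "y \<in> N" for y
    proof (rule ext[OF fun_b[OF u] g _ that])
      fix z assume z: "z \<in> B"
      have "tensor_eval (\<lambda>x. b x z) u = - (\<Sum>x\<in>B. r (Some x) * b x z) / r None"
        by (simp add: u_def tensor_eval_sum sum_negf sum_divide_distrib)
      also have "(\<Sum>x\<in>B. r (Some x) * b x z) = - (r None * g z)"
        using r'[OF z] by (simp add: eq_neg_iff_add_eq_0 add.commute)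
      also have "- (- (r None * g z)) / r None = g z" using \<open>r None \<noteq> 0\<close> by simp
      finally show "tensor_eval (\<lambda>x. b x z) u = g z" .
    qed
  qed
qed

end

context scalar_extension
begin

text \<open>
  An isomorphism \<open>\<Phi>\<close> from \<open>L \<otimes>\<^sub>R N\<close> to its dual corresponds to \<open>b(x, y) = \<Phi>(1 \<otimes> x)(1 \<otimes> y)\<close>.
  Compatibility of \<open>\<Phi>\<close> with \<open>l \<otimes> 1 \<in> L \<otimes>\<^sub>R B\<close> is its \<open>L\<close>-linearity, and compatibility with
  \<open>1 \<otimes> a\<close> is adjointness of \<open>a\<close> and \<open>\<iota> a\<close>.
\<close>

lemma self_dual_iff_form:
  assumes BN: "acts_on B N" and fg: "finitely_generated_submodule N"
    and \<iota>: "\<And>x y. \<iota> (x + y) = \<iota> x + \<iota> y" "\<And>r x. \<iota> (\<phi> r * x) = \<phi> r * \<iota> x" "\<iota> 1 = 1"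
      "\<And>a. a \<in> B \<Longrightarrow> \<iota> a \<in> B"
  shows "self_dual_base_change \<rho> \<phi> \<iota> B act N \<longleftrightarrow>
    (\<exists>b. bilinear_on N b \<and> nondegenerate_on N b \<and>
      (\<forall>a\<in>B. \<forall>x\<in>N. \<forall>y\<in>N. b (act a x) y = b x (act (\<iota> a) y)))"
proof -
  interpret reg: scalar_extension \<rho> \<phi> "(*)" by (rule regular)
  have N: "submodule N" and B: "reg.submodule B" and B1: "1 \<in> B"
    and actN: "\<And>a n. a \<in> B \<Longrightarrow> n \<in> N \<Longrightarrow> act a n \<in> N"
    using BN by (auto simp: acts_on_def)
  let ?V = "bc_carrier \<rho> \<phi> act N"
  let ?S = "bc_carrier \<rho> \<phi> (*) B"
  let ?pure = "\<lambda>l. bc_pure \<rho> \<phi> (*) B l 1"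
  let ?\<iota> = "bc_map \<rho> \<phi> (*) B \<iota>"
  let ?act = "bc_act \<rho> \<phi> act N"
  let ?add = "bc_add \<rho> \<phi> act N"
  define dual where "dual = {\<psi> \<in> extensional ?V.
        (\<forall>x\<in>?V. \<forall>y\<in>?V. \<psi> (?add x y) = \<psi> x + \<psi> y) \<and>
        (\<forall>l. \<forall>x\<in>?V. \<psi> (?act (?pure l) x) = l * \<psi> x)}"
  have self_dual: "self_dual_base_change \<rho> \<phi> \<iota> B act N \<longleftrightarrow> (\<exists>\<Phi>. bij_betw \<Phi> ?V dual \<and>
     (\<forall>x\<in>?V. \<forall>y\<in>?V. \<Phi> (?add x y) = (\<lambda>n\<in>?V. \<Phi> x n + \<Phi> y n)) \<and>
     (\<forall>T\<in>?S. \<forall>x\<in>?V. \<Phi> (?act T x) = (\<lambda>n\<in>?V. \<Phi> x (?act (?\<iota> T) n))))"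
    by (simp add: self_dual_base_change_def module_isomorphic_def base_change_def
        dual_module_def dual_def)
  have \<iota>_cls: "?\<iota> (reg.cls B t) = reg.cls B (formal_map \<iota> t)" if "t \<in> formal B" for t
    by (rule reg.bc_map_cls[OF B that]) (use \<iota> in auto)
  have act_cls: "?act (reg.cls B t) (cls N u) = cls N (formal_act act t u)"
    if "t \<in> formal B" "u \<in> formal N" for t u
    by (rule bc_act_cls[OF N B actN that])
  show ?thesis
    unfolding self_dual
  proof
    assume "\<exists>\<Phi>. bij_betw \<Phi> ?V dual \<and>
     (\<forall>x\<in>?V. \<forall>y\<in>?V. \<Phi> (?add x y) = (\<lambda>n\<in>?V. \<Phi> x n + \<Phi> y n)) \<and>
     (\<forall>T\<in>?S. \<forall>x\<in>?V. \<Phi> (?act T x) = (\<lambda>n\<in>?V. \<Phi> x (?act (?\<iota> T) n)))"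
    then obtain \<Phi> where bij: "bij_betw \<Phi> ?V dual"
      and add: "\<And>X X' Y. X \<in> ?V \<Longrightarrow> X' \<in> ?V \<Longrightarrow> Y \<in> ?V \<Longrightarrow> \<Phi> (?add X X') Y = \<Phi> X Y + \<Phi> X' Y"
      and act: "\<And>T X Y. T \<in> ?S \<Longrightarrow> X \<in> ?V \<Longrightarrow> Y \<in> ?V \<Longrightarrow> \<Phi> (?act T X) Y = \<Phi> X (?act (?\<iota> T) Y)"
      by auto
    have dual: "\<Phi> X \<in> dual" if "X \<in> ?V" for X using bij that bij_betwE by blast
    define e where "e n = cls N (frag_of (1, n))" for n
    have e: "e n \<in> ?V" if "n \<in> N" for n using that by (simp add: e_def)
    define b where "b x y = \<Phi> (e x) (e y)" for x y
    have dual_eval: "\<psi> (cls N u) = tensor_eval (\<lambda>n. \<psi> (e n)) u" if "\<psi> \<in> dual" "u \<in> formal N" for \<psi> u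
      unfolding e_def
      by (rule carrier_functional_eval[OF BN _ _ that(2)]) (use that(1) in \<open>auto simp: dual_def\<close>)
    have dual_functional: "functional N (\<lambda>n. \<psi> (e n))" if "\<psi> \<in> dual" for \<psi>
      unfolding e_def
      by (rule carrier_functional_functional[OF BN]) (use that(1) in \<open>auto simp: dual_def\<close>)
    have scal: "\<Phi> (?act (?pure l) X) Y = l * \<Phi> X Y" if "X \<in> ?V" "Y \<in> ?V" for l X Y
    proof -
      have "?\<iota> (?pure l) = ?pure l"
        using \<iota>_cls[of "frag_of (l, 1)"] B1 \<iota>(3) by (simp add: bc_pure_def formal_map_def)
      moreover have "?pure l \<in> ?S" using B1 by (simp add: bc_pure_def)
      ultimately show ?thesis using act[of "?pure l" X Y] that dual[of X] by (simp add: dual_def)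
    qed
    have left_eval: "\<Phi> (cls N u) Y = tensor_eval (\<lambda>n. \<Phi> (e n) Y) u" if "Y \<in> ?V" "u \<in> formal N" for Y u
      unfolding e_def
      by (rule carrier_functional_eval[OF BN, where \<psi> = "\<lambda>X. \<Phi> X Y"]) (use that add scal in auto)
    have left_functional: "functional N (\<lambda>n. \<Phi> (e n) Y)" if "Y \<in> ?V" for Y
      unfolding e_def
      by (rule carrier_functional_functional[OF BN, where \<psi> = "\<lambda>X. \<Phi> X Y"]) (use that add scal in auto)
    have bil: "bilinear_on N b"
      unfolding bilinear_on_def b_def using dual_functional dual e left_functional by blast
    moreover have "nondegenerate_on N b"
      unfolding nondegenerate_on_def
    proof (intro ballI impI allI)
      fix u g
      assume u: "u \<in> formal N" and g: "functional N g"
      assume "(\<forall>y\<in>N. tensor_eval (\<lambda>x. b x y) u = 0) \<or> (\<forall>x\<in>N. tensor_eval (b x) u = 0)"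
      then show "tensor_eval g u = 0"
      proof
        assume *: "\<forall>y\<in>N. tensor_eval (\<lambda>x. b x y) u = 0"
        have "\<Phi> (cls N u) = \<Phi> (cls N 0)"
        proof (rule extensionalityI[of _ ?V])
          fix Y assume "Y \<in> ?V"
          then obtain v where v: "Y = cls N v" "v \<in> formal N" by (auto simp: carrier_eq)
          have "\<Phi> (cls N u) (e n) = 0" if "n \<in> N" for n
            using left_eval[OF e[OF that] u] * that by (simp add: b_def)
          then have "\<Phi> (cls N u) Y = tensor_eval (\<lambda>n. 0) v"
            unfolding v(1) dual_eval[OF dual[OF cls_in_carrier[OF u]] v(2)]
            by (intro tensor_eval_cong[of _ N]) (use v(2) in auto)
          moreover have "\<Phi> (cls N 0) Y = 0" using left_eval[OF \<open>Y \<in> ?V\<close>, of 0] by simp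
          ultimately show "\<Phi> (cls N u) Y = \<Phi> (cls N 0) Y" by simp
        qed (use dual[of "cls N u"] dual[of "cls N 0"] u in \<open>auto simp: dual_def\<close>)
        then have "cls N u = cls N 0"
          using bij u by (auto simp: bij_betw_def dest!: inj_onD)
        then show ?thesis using rels_iff[OF fg u] g by (simp add: cls_eq_iff)
      next
        assume *: "\<forall>x\<in>N. tensor_eval (b x) u = 0"
        have *: "\<Phi> X (cls N u) = 0" if "X \<in> ?V" for X
        proof -
          obtain v where v: "X = cls N v" "v \<in> formal N" using \<open>X \<in> ?V\<close> by (auto simp: carrier_eq)
          have "\<Phi> (e n) (cls N u) = 0" if "n \<in> N" for n
            using dual_eval[OF dual[OF e[OF that]] u] * that by (simp add: b_def[abs_def])
          then have "\<Phi> X (cls N u) = tensor_eval (\<lambda>n. 0) v"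
            unfolding v(1) left_eval[OF cls_in_carrier[OF u] v(2)]
            by (intro tensor_eval_cong[of _ N]) (use v(2) in auto)
          then show ?thesis by simp
        qed
        \<comment> \<open>\<open>\<Phi>\<close> is surjective, so some \<open>\<Phi> X\<close> is the extension of \<open>g\<close>\<close>
        define G where "G = restrict (\<lambda>X. tensor_eval g (SOME v. v \<in> X)) ?V"
        have G: "G (cls N v) = tensor_eval g v" if "v \<in> formal N" for v
        proof -
          have "(SOME w. w \<in> cls N v) \<in> cls N v" by (rule someI) (rule cls_self)
          from tensor_eval_cls[OF N g this] show ?thesis using that by (simp add: G_def)
        qed
        have "G \<in> dual"
          unfolding dual_def carrier_eq
          using G formal_add[of _ N] formal_act_scalar_formal[OF BN]
          by (auto simp: bc_add_cls bc_act_scalar[OF BN] tensor_eval_add tensor_eval_act_scalar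
              G_def carrier_eq)
        then obtain X where "X \<in> ?V" "\<Phi> X = G" using bij by (auto simp: bij_betw_def)
        then show ?thesis using * G[OF u] by metis
      qed
    qed
    moreover have "b (act a x) y = b x (act (\<iota> a) y)" if "a \<in> B" "x \<in> N" "y \<in> N" for a x y
    proof -
      have a: "frag_of (1, a) \<in> formal B" "frag_of (1, \<iota> a) \<in> formal B"
        using that \<iota>(4) by auto
      have "\<Phi> (?act (reg.cls B (frag_of (1, a))) (e x)) (e y) =
          \<Phi> (e x) (?act (?\<iota> (reg.cls B (frag_of (1, a)))) (e y))"
        by (rule act) (use a that e in auto)
      then show ?thesis
        using that a unfolding e_def \<iota>_cls[OF a(1)] b_def
        by (simp add: formal_map_def act_cls)
    qed
    ultimately show "\<exists>b. bilinear_on N b \<and> nondegenerate_on N b \<and>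
      (\<forall>a\<in>B. \<forall>x\<in>N. \<forall>y\<in>N. b (act a x) y = b x (act (\<iota> a) y))" by blast
  next
    assume "\<exists>b. bilinear_on N b \<and> nondegenerate_on N b \<and>
      (\<forall>a\<in>B. \<forall>x\<in>N. \<forall>y\<in>N. b (act a x) y = b x (act (\<iota> a) y))"
    then obtain b where b: "bilinear_on N b" and nd: "nondegenerate_on N b"
      and adj: "\<And>a x y. a \<in> B \<Longrightarrow> x \<in> N \<Longrightarrow> y \<in> N \<Longrightarrow> b (act a x) y = b x (act (\<iota> a) y)" by blast
    note pair = pairing_cls[OF N b]
    define \<Phi> where "\<Phi> X = restrict (pairing b X) ?V" for X
    have \<Phi>: "\<Phi> (cls N u) (cls N v) = tensor_eval (\<lambda>x. tensor_eval (b x) v) u"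
      if "u \<in> formal N" "v \<in> formal N" for u v
      using that pair by (simp add: \<Phi>_def)
    have \<Phi>_dual: "\<Phi> X \<in> dual" if "X \<in> ?V" for X
    proof -
      have "?add Y Z \<in> ?V" "?act (?pure l) Y \<in> ?V" if YZ: "Y \<in> ?V" "Z \<in> ?V" for Y Z l
      proof -
        obtain u v where uv: "Y = cls N u" "u \<in> formal N" "Z = cls N v" "v \<in> formal N"
          using YZ by (auto simp: carrier_eq)
        show "?add Y Z \<in> ?V" "?act (?pure l) Y \<in> ?V"
          unfolding uv(1,3) bc_add_cls bc_act_scalar[OF BN uv(2)]
          by (rule cls_in_carrier formal_add[OF uv(2,4)] formal_act_scalar_formal[OF BN uv(2)])+
      qed
      then show ?thesis
        using L_bilinear_pairing[OF BN b] that
        by (auto simp: dual_def L_bilinear_def base_change_def \<Phi>_def)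
    qed
    have "inj_on \<Phi> ?V"
    proof (rule inj_onI)
      fix X Y assume "X \<in> ?V" "Y \<in> ?V" and eq: "\<Phi> X = \<Phi> Y"
      then obtain u v where uv: "X = cls N u" "u \<in> formal N" "Y = cls N v" "v \<in> formal N"
        by (auto simp: carrier_eq)
      have "tensor_eval (\<lambda>x. b x y) (u - v) = 0" if "y \<in> N" for y
        using \<Phi>[OF uv(2), of "frag_of (1, y)"] \<Phi>[OF uv(4), of "frag_of (1, y)"] that eq
        by (simp add: uv(1,3) tensor_eval_diff)
      then have "\<forall>g. functional N g \<longrightarrow> tensor_eval g (u - v) = 0"
        by (intro allI impI nondegenerate_onD[OF nd formal_diff[OF uv(2,4)]]) auto
      then have "u - v \<in> rels N" using rels_iff[OF fg formal_diff[OF uv(2,4)]] by blast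
      then show "X = Y" by (simp add: uv cls_eq_iff)
    qed
    moreover have "\<psi> \<in> \<Phi> ` ?V" if \<psi>: "\<psi> \<in> dual" for \<psi>
    proof -
      have eval: "\<psi> (cls N u) = tensor_eval (\<lambda>n. \<psi> (cls N (frag_of (1, n)))) u" if "u \<in> formal N" for u
        by (rule carrier_functional_eval[OF BN _ _ that]) (use \<psi> in \<open>auto simp: dual_def\<close>)
      have "functional N (\<lambda>n. \<psi> (cls N (frag_of (1, n))))"
        by (rule carrier_functional_functional[OF BN]) (use \<psi> in \<open>auto simp: dual_def\<close>)
      from functional_represented[OF fg b nd this] obtain u where u: "u \<in> formal N"
        and eq: "\<And>y. y \<in> N \<Longrightarrow> tensor_eval (\<lambda>x. b x y) u = \<psi> (cls N (frag_of (1, y)))" by blast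
      have "\<Phi> (cls N u) = \<psi>"
      proof (rule extensionalityI[of _ ?V])
        fix Y assume "Y \<in> ?V"
        then obtain v where v: "Y = cls N v" "v \<in> formal N" by (auto simp: carrier_eq)
        have "\<Phi> (cls N u) Y = tensor_eval (\<lambda>y. tensor_eval (\<lambda>x. b x y) u) v"
          unfolding v(1) \<Phi>[OF u v(2)] by (rule tensor_eval_swap)
        also have "\<dots> = \<psi> Y"
          unfolding v(1) eval[OF v(2)] by (rule tensor_eval_cong[of _ N]) (use v(2) eq in auto)
        finally show "\<Phi> (cls N u) Y = \<psi> Y" .
      qed (use \<psi> in \<open>auto simp: dual_def \<Phi>_def\<close>)
      then show ?thesis using u by (metis cls_in_carrier imageI)
    qed
    ultimately have "bij_betw \<Phi> ?V dual" using \<Phi>_dual by (auto simp: bij_betw_def)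
    moreover have "\<Phi> (?add X Y) = (\<lambda>n\<in>?V. \<Phi> X n + \<Phi> Y n)" if XY: "X \<in> ?V" "Y \<in> ?V" for X Y
    proof -
      obtain u v where uv: "X = cls N u" "u \<in> formal N" "Y = cls N v" "v \<in> formal N"
        using XY by (auto simp: carrier_eq)
      show ?thesis
      proof (rule extensionalityI[of _ ?V])
        fix Z assume "Z \<in> ?V"
        then obtain w where w: "Z = cls N w" "w \<in> formal N" by (auto simp: carrier_eq)
        show "\<Phi> (?add X Y) Z = (\<lambda>n\<in>?V. \<Phi> X n + \<Phi> Y n) Z"
          unfolding uv(1,3) w(1) bc_add_cls
          using w(2) by (simp only: \<Phi>[OF formal_add[OF uv(2,4)] w(2)] \<Phi>[OF uv(2) w(2)] \<Phi>[OF uv(4) w(2)]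
              restrict_apply' cls_in_carrier tensor_eval_add)
      qed (simp_all add: \<Phi>_def)
    qed
    moreover have "\<Phi> (?act T X) = (\<lambda>n\<in>?V. \<Phi> X (?act (?\<iota> T) n))" if TX: "T \<in> ?S" "X \<in> ?V" for T X
    proof -
      obtain t u where tu: "T = reg.cls B t" "t \<in> formal B" "X = cls N u" "u \<in> formal N"
        using TX by (auto simp: carrier_eq reg.carrier_eq)
      have \<iota>t: "formal_map \<iota> t \<in> formal B"
        using keys_formal_map[of t B \<iota> B] tu(2) \<iota>(4) by auto
      have fa: "formal_act act s w \<in> formal N" if "s \<in> formal B" "w \<in> formal N" for s w
        using keys_formal_act[of s B w N act] that actN by auto
      show ?thesis
      proof (rule extensionalityI[of _ ?V])
        fix Z assume "Z \<in> ?V"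
        then obtain w where w: "Z = cls N w" "w \<in> formal N" by (auto simp: carrier_eq)
        have "\<Phi> (?act T X) Z = tensor_eval (\<lambda>a. tensor_eval (\<lambda>x. tensor_eval (b (act a x)) w) u) t"
          unfolding tu(1,3) w(1) act_cls[OF tu(2,4)] \<Phi>[OF fa[OF tu(2,4)] w(2)] tensor_eval_act ..
        also have "\<dots> = tensor_eval (\<lambda>a. tensor_eval (\<lambda>x. tensor_eval (\<lambda>y. b x (act (\<iota> a) y)) w) u) t"
          by (intro tensor_eval_cong[OF _ tensor_eval_cong[OF _ tensor_eval_cong]])
            (use tu w adj in \<open>auto intro: tensor_eval_cong\<close>)
        also have "\<dots> = tensor_eval (\<lambda>x. tensor_eval (\<lambda>a. tensor_eval (\<lambda>y. b x (act (\<iota> a) y)) w) t) u"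
          by (rule tensor_eval_swap)
        also have "\<dots> = \<Phi> X (?act (?\<iota> T) Z)"
          unfolding tu(1,3) w(1) \<iota>_cls[OF tu(2)] act_cls[OF \<iota>t w(2)] \<Phi>[OF tu(4) fa[OF \<iota>t w(2)]]
            tensor_eval_act tensor_eval_map ..
        finally show "\<Phi> (?act T X) Z = (\<lambda>n\<in>?V. \<Phi> X (?act (?\<iota> T) n)) Z"
          using \<open>Z \<in> ?V\<close> by simp
      qed (simp_all add: \<Phi>_def)
    qed
    ultimately show "\<exists>\<Phi>. bij_betw \<Phi> ?V dual \<and>
     (\<forall>x\<in>?V. \<forall>y\<in>?V. \<Phi> (?add x y) = (\<lambda>n\<in>?V. \<Phi> x n + \<Phi> y n)) \<and>
     (\<forall>T\<in>?S. \<forall>x\<in>?V. \<Phi> (?act T x) = (\<lambda>n\<in>?V. \<Phi> x (?act (?\<iota> T) n)))" by blast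
  qed
qed

end

section \<open>Gluing forms over the graded pieces\<close>

locale graded_alg =
  fixes \<phi> :: "'r::comm_ring_1 \<Rightarrow> 'a::{ring,monoid_mult}"
    and G :: "'c::{finite,ab_group_add} \<Rightarrow> 'a set"
  assumes graded: "graded_algebra \<phi> G"
begin

lemma phi_add: "\<phi> (x + y) = \<phi> x + \<phi> y" and phi_mult: "\<phi> (x * y) = \<phi> x * \<phi> y" and phi_1: "\<phi> 1 = 1"
  and phi_central: "\<phi> r * b = b * \<phi> r"
  using graded unfolding graded_algebra_def is_algebra_def ring_homomorphism_def by blast+

lemma module: "module (\<lambda>r b. \<phi> r * b)"
  by unfold_locales (simp_all add: phi_add phi_mult phi_1 algebra_simps)

lemma subspace: "module.subspace (\<lambda>r b. \<phi> r * b) (G c)"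
  using graded by (simp add: graded_algebra_def)

sublocale graded_group G
proof
  show "direct_sum G" using graded by (simp add: graded_algebra_def)
qed (use module.subspace_0[OF module subspace] module.subspace_add[OF module subspace] in auto)

lemma mult_degree: "a \<in> G c \<Longrightarrow> b \<in> G d \<Longrightarrow> a * b \<in> G (c + d)"
  using graded by (simp add: graded_algebra_def)

text \<open>The degree-zero component of \<open>1\<close> is a left unit for homogeneous elements, hence equals \<open>1\<close>.\<close>

lemma one_degree: "1 \<in> G 0"
proof -
  define f where "f c = component G c 1" for c
  have f: "f c \<in> G c" "(\<Sum>c\<in>UNIV. f c) = 1" for c
    by (simp_all add: f_def component_in[OF direct] sum_component[OF direct])
  have hom: "f 0 * b = b" if b: "b \<in> G d" for b d
  proof -
    have "component G d b = f (d - d) * b"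
    proof (rule component_unique[OF direct, where f = "\<lambda>c. f (c - d) * b"])
      show "f (c - d) * b \<in> G c" for c
        using mult_degree[OF f(1) b, of "c - d"] by simp
      have "(\<Sum>c\<in>UNIV. f (c - d) * b) = (\<Sum>c\<in>UNIV. f c * b)"
        by (rule sum.reindex_bij_witness[of _ "\<lambda>c. c + d" "\<lambda>c. c - d"]) auto
      also have "\<dots> = b" using f(2) by (simp flip: sum_distrib_right)
      finally show "b = (\<Sum>c\<in>UNIV. f (c - d) * b)" ..
    qed
    then show ?thesis using component_homogeneous[OF b, of d] by simp
  qed
  have "f 0 * 1 = (\<Sum>c\<in>UNIV. f 0 * f c)"
    unfolding sum_distrib_left[symmetric] f(2) ..
  also have "\<dots> = 1" using hom[OF f(1)] f(2) by simp
  finally show ?thesis using f(1)[of 0] by simp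
qed

lemma phi_degree: "\<phi> r \<in> G 0"
  using module.subspace_scale[OF module subspace one_degree, of r] by simp

lemma diff_degree: "a \<in> G c \<Longrightarrow> b \<in> G c \<Longrightarrow> a - b \<in> G c"
  by (rule module.subspace_diff[OF module subspace])

lemma power_degree: "a \<in> G c \<Longrightarrow> a ^ k \<in> G (\<Sum>i<k. c)"
  by (induction k) (auto simp: one_degree add.commute[of _ c] intro: mult_degree)

lemma sum_degree: "(\<And>i. i \<in> I \<Longrightarrow> f i \<in> G c) \<Longrightarrow> sum f I \<in> G c"
  by (rule module.subspace_sum[OF module subspace])

end

text \<open>The degree-zero part of the centre.\<close>

definition central0 :: "('c::zero \<Rightarrow> 'a::times set) \<Rightarrow> 'a set" where
  "central0 GA = {z \<in> GA 0. \<forall>a. z * a = a * z}"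

text \<open>
  A multiple \<open>p\<close> of a central idempotent of degree zero cuts out a factor of \<open>A\<close>, after
  inverting the non-zero elements of \<open>R\<close>.  Its piece of degree \<open>d\<close> contains a unit if
  \<open>unit_degree \<phi> GA p d\<close>, and is zero if \<open>null_degree \<phi> GA p d\<close>.
\<close>

definition unit_degree ::
    "('r::zero \<Rightarrow> 'a::times) \<Rightarrow> ('c::uminus \<Rightarrow> 'a set) \<Rightarrow> 'a \<Rightarrow> 'c \<Rightarrow> bool" where
  "unit_degree \<phi> GA p d \<longleftrightarrow> (\<exists>u\<in>GA d. \<exists>u'\<in>GA (- d). \<exists>s. s \<noteq> 0 \<and> u * u' * p = \<phi> s * p \<and> u' * u * p = \<phi> s * p)"

definition null_degree ::
    "('r::zero \<Rightarrow> 'a::mult_zero) \<Rightarrow> ('c \<Rightarrow> 'a set) \<Rightarrow> 'a \<Rightarrow> 'c \<Rightarrow> bool" where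
  "null_degree \<phi> GA p d \<longleftrightarrow> (\<forall>a\<in>GA d. \<exists>s. s \<noteq> 0 \<and> \<phi> s * (p * a) = 0)"

text \<open>
  A graded torsion-free \<open>A\<close>-module, and an \<open>R\<close>-linear, unital and anti-multiplicative map \<open>\<iota>\<close> on \<open>A\<close>
  that negates degrees.
\<close>

locale graded_setting = scalar_extension \<rho> \<phi> act
  for \<rho> :: "'r::idom \<Rightarrow> 'l::field"
    and \<phi> :: "'r \<Rightarrow> 'a::{ring,monoid_mult}"
    and act :: "'a \<Rightarrow> 'm::ab_group_add \<Rightarrow> 'm" +
  fixes GA :: "'c::{finite,ab_group_add} \<Rightarrow> 'a set"
    and GM :: "'c \<Rightarrow> 'm set"
    and \<iota> :: "'a \<Rightarrow> 'a"
  assumes graded_algebra: "graded_algebra \<phi> GA"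
    and graded_module: "graded_module \<phi> GA act GM"
    and torsion_free: "torsion_free (\<lambda>r m. act (\<phi> r) m)"
    and iota_add: "\<iota> (x + y) = \<iota> x + \<iota> y"
    and iota_scale: "\<iota> (\<phi> r * x) = \<phi> r * \<iota> x"
    and iota_mult: "\<iota> (x * y) = \<iota> y * \<iota> x"
    and iota_1: "\<iota> 1 = 1"
    and iota_degree: "a \<in> GA c \<Longrightarrow> \<iota> a \<in> GA (- c)"
begin

lemma GM_submodule: "submodule (GM c)"
  using graded_module by (simp add: graded_module_def)

sublocale gA: graded_alg \<phi> GA
  by unfold_locales (rule graded_algebra)

sublocale gM: graded_group GM
  using graded_module submodule_0[OF GM_submodule] submodule_add[OF GM_submodule]
  by unfold_locales (auto simp: graded_module_def)

abbreviation comp :: "'c \<Rightarrow> 'm \<Rightarrow> 'm" where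
  "comp \<equiv> component GM"

lemma act_degree: "a \<in> GA c \<Longrightarrow> x \<in> GM d \<Longrightarrow> c + d = e \<Longrightarrow> act a x \<in> GM e"
  using graded_module by (auto simp: graded_module_def)

lemma comp_in: "comp c x \<in> GM c"
  by (rule component_in[OF gM.direct])

lemma sum_comp: "(\<Sum>c\<in>UNIV. comp c x) = x"
  by (rule sum_component[OF gM.direct])

lemma comp_act:
  assumes a: "a \<in> GA d"
  shows "comp c (act a x) = act a (comp (c - d) x)"
proof (rule component_unique[OF gM.direct, where f = "\<lambda>c. act a (comp (c - d) x)"])
  show "act a (comp (c - d) x) \<in> GM c" for c
    by (rule act_degree[OF a comp_in]) simp
  have "(\<Sum>c\<in>UNIV. act a (comp (c - d) x)) = (\<Sum>c\<in>UNIV. act a (comp c x))"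
    by (rule sum.reindex_bij_witness[of _ "\<lambda>c. c + d" "\<lambda>c. c - d"]) auto
  also have "\<dots> = act a x" by (simp add: sum_comp flip: act_sum_right)
  finally show "act a x = (\<Sum>c\<in>UNIV. act a (comp (c - d) x))" ..
qed

lemma comp_act_0: "a \<in> GA 0 \<Longrightarrow> comp c (act a x) = act a (comp c x)"
  using comp_act[of a 0 c x] by simp

lemma functional_act_comp:
  assumes "functional (GM r) g" and "a \<in> GA d" and "d + c = r"
  shows "functional UNIV (\<lambda>x. g (act a (comp c x)))"
proof -
  have *: "act a (comp c x) \<in> GM r" for x
    using act_degree[OF assms(2) comp_in assms(3)] .
  show ?thesis
    using assms(1) * unfolding functional_def
    by (simp add: gM.component_add act_add_right comp_act_0[OF gA.phi_degree] act_phi_commute[symmetric])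
qed

lemma functional_act:
  assumes "functional UNIV g"
  shows "functional N (\<lambda>x. g (act a x))"
  using assms unfolding functional_def by (simp add: act_add_right act_phi_commute[symmetric])

lemma functional_add_fun: "functional N g \<Longrightarrow> functional N h \<Longrightarrow> functional N (\<lambda>x. g x + h x)"
  and functional_scale_fun: "functional N g \<Longrightarrow> functional N (\<lambda>x. k * g x)"
  by (auto simp: functional_def algebra_simps)

lemma functional_sum_fun: "(\<And>i. i \<in> I \<Longrightarrow> functional N (g i)) \<Longrightarrow> functional N (\<lambda>x. \<Sum>i\<in>I. g i x)"
  by (induction I rule: infinite_finite_induct)
    (auto simp: functional_add_fun, auto simp: functional_def)

lemma functional_comp_sum:
  assumes "functional UNIV g"
  shows "g x = (\<Sum>c\<in>UNIV. g (comp c x))"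
  using functional_sum[OF assms submodule_UNIV, of UNIV "\<lambda>c. comp c x"] by (simp add: sum_comp)

lemma iota_0: "\<iota> 0 = 0"
proof -
  have "\<iota> 0 + \<iota> 0 = \<iota> 0 + 0" using iota_add[of 0 0] by simp
  then show ?thesis by (rule add_left_imp_eq)
qed

lemma iota_sum: "\<iota> (sum f I) = (\<Sum>i\<in>I. \<iota> (f i))"
  by (induction I rule: infinite_finite_induct) (auto simp: iota_0 iota_add)

lemma iota_phi: "\<iota> (\<phi> r) = \<phi> r"
  using iota_scale[of r 1] by (simp add: iota_1)

lemma torsion_acts_as_zero:
  assumes "r \<noteq> 0" and "\<phi> r * a = 0"
  shows "act a x = 0"
proof -
  have "act (\<phi> r) (act a x) = 0" using assms(2) by (simp flip: act_mult)
  then show ?thesis using torsion_free assms(1) unfolding torsion_free_def by blast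
qed

lemma unit_degree_0: "unit_degree \<phi> GA p 0"
  unfolding unit_degree_def using gA.one_degree phi_1
  by (intro bexI[of _ 1] exI[of _ 1]) auto

lemma unit_degree_minus: "unit_degree \<phi> GA p d \<Longrightarrow> unit_degree \<phi> GA p (- d)"
  unfolding unit_degree_def by (metis minus_minus)

lemma unit_degree_add:
  assumes p: "p \<in> central0 GA" and "unit_degree \<phi> GA p d" and "unit_degree \<phi> GA p e"
  shows "unit_degree \<phi> GA p (d + e)"
proof -
  obtain u u' s where u: "u \<in> GA d" "u' \<in> GA (- d)" "s \<noteq> 0" "u * u' * p = \<phi> s * p" "u' * u * p = \<phi> s * p"
    using assms(2) unfolding unit_degree_def by blast
  obtain v v' t where v: "v \<in> GA e" "v' \<in> GA (- e)" "t \<noteq> 0" "v * v' * p = \<phi> t * p" "v' * v * p = \<phi> t * p"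
    using assms(3) unfolding unit_degree_def by blast
  have pc: "a * p = p * a" for a using p by (simp add: central0_def)
  have 1: "(u * v) * (v' * u') * p = \<phi> (s * t) * p"
  proof -
    have "(u * v) * (v' * u') * p = u * (v * v' * p) * u'" using pc[of u'] by (simp add: mult.assoc)
    also have "\<dots> = \<phi> t * (u * u' * p)"
      using v(4) pc[of u'] phi_central[of t u] by (metis mult.assoc)
    finally show ?thesis using u(4) by (simp add: phi_mult mult.assoc mult.commute[of s t])
  qed
  have 2: "(v' * u') * (u * v) * p = \<phi> (s * t) * p"
  proof -
    have "(v' * u') * (u * v) * p = v' * (u' * u * p) * v" using pc[of v] by (simp add: mult.assoc)
    also have "\<dots> = \<phi> s * (v' * v * p)"
      using u(5) pc[of v] phi_central[of s v'] by (metis mult.assoc)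
    finally show ?thesis using v(5) by (simp add: phi_mult mult.assoc)
  qed
  have "u * v \<in> GA (d + e)" "v' * u' \<in> GA (- (d + e))"
    using gA.mult_degree[OF u(1) v(1)] gA.mult_degree[OF v(2) u(2)] by (simp_all add: add.commute)
  then show ?thesis unfolding unit_degree_def using 1 2 u(3) v(3)
    by (intro bexI[of _ "u * v"] bexI[of _ "v' * u'"] exI[of _ "s * t"]) auto
qed

end

text \<open>On each \<open>L \<otimes>\<^sub>R M\<^sub>c\<close>, a non-degenerate form for which every \<open>a \<in> A\<^sub>0\<close> is adjoint to \<open>\<iota> a\<close>.\<close>

locale graded_setting_forms = graded_setting \<rho> \<phi> act GA GM \<iota>
  for \<rho> :: "'r::idom \<Rightarrow> 'l::field"
    and \<phi> :: "'r \<Rightarrow> 'a::{ring,monoid_mult}"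
    and act :: "'a \<Rightarrow> 'm::ab_group_add \<Rightarrow> 'm"
    and GA :: "'c::{finite,ab_group_add} \<Rightarrow> 'a set"
    and GM :: "'c \<Rightarrow> 'm set"
    and \<iota> :: "'a \<Rightarrow> 'a" +
  fixes b :: "'c \<Rightarrow> 'm \<Rightarrow> 'm \<Rightarrow> 'l"
  assumes b_bilinear: "bilinear_on (GM c) (b c)"
    and b_nondegenerate: "nondegenerate_on (GM c) (b c)"
    and b_adjoint: "a \<in> GA 0 \<Longrightarrow> x \<in> GM c \<Longrightarrow> y \<in> GM c \<Longrightarrow> b c (act a x) y = b c x (act (\<iota> a) y)"
begin

lemma b_left: "x \<in> GM c \<Longrightarrow> functional (GM c) (b c x)"
  and b_right: "y \<in> GM c \<Longrightarrow> functional (GM c) (\<lambda>x. b c x y)"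
  using b_bilinear by (auto simp: bilinear_on_def)

lemma b_scale_left: "x \<in> GM c \<Longrightarrow> y \<in> GM c \<Longrightarrow> b c (act (\<phi> r) x) y = \<rho> r * b c x y"
  and b_scale_right: "x \<in> GM c \<Longrightarrow> y \<in> GM c \<Longrightarrow> b c x (act (\<phi> r) y) = \<rho> r * b c x y"
  using b_left b_right by (auto simp: functional_def)

lemma b_zero: "y \<in> GM c \<Longrightarrow> b c 0 y = 0" "x \<in> GM c \<Longrightarrow> b c x 0 = 0"
  using functional_0[OF b_right gM.zero_in] functional_0[OF b_left gM.zero_in] by auto

text \<open>
  The forms \<open>b c\<close> need only be compatible with \<open>A\<^sub>0\<close>.  On the part of \<open>M\<close> cut out by \<open>p\<close>, keep
  the form in one degree \<open>r\<close> of each coset of the group of unit degrees, and transport it to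
  degree \<open>r + \<delta>\<close> along a unit \<open>u\<close> of degree \<open>\<delta>\<close> by \<open>\<beta>(u x, y) = b\<^sub>r(x, \<iota>(u) y)\<close>.  Then all
  homogeneous elements of \<open>A\<close> are adjoint to their images under \<open>\<iota>\<close>.
\<close>

lemma transported_form:
  assumes p: "p \<in> central0 GA" and dich: "\<And>d. unit_degree \<phi> GA p d \<or> null_degree \<phi> GA p d"
  obtains \<beta> where "bilinear_on UNIV \<beta>"
    and "\<And>c c' x y. c \<noteq> c' \<Longrightarrow> x \<in> GM c \<Longrightarrow> y \<in> GM c' \<Longrightarrow> \<beta> x y = 0"
    and "\<And>a x y. \<beta> (act a x) y = \<beta> x (act (\<iota> a) y)"
    and "\<And>g u. functional UNIV g \<Longrightarrow> (\<And>y. tensor_eval (\<lambda>x. \<beta> x y) u = 0) \<Longrightarrow>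
      tensor_eval (\<lambda>x. g (act p x)) u = 0"
    and "\<And>g u. functional UNIV g \<Longrightarrow> (\<And>x. tensor_eval (\<beta> x) u = 0) \<Longrightarrow>
      tensor_eval (\<lambda>y. g (act (\<iota> p) y)) u = 0"
    and "\<And>a a' x y. p * a = p * a' \<Longrightarrow> \<beta> (act a x) y = \<beta> (act a' x) y"
proof -
  have p0: "p \<in> GA 0" and pc: "\<And>a. a * p = p * a" using p by (auto simp: central0_def)
  have pc': "a * (p * b) = p * (a * b)" for a b by (metis mult.assoc pc)
  define D where "D = {d. unit_degree \<phi> GA p d}"
  have D_add: "d \<in> D \<Longrightarrow> e \<in> D \<Longrightarrow> d + e \<in> D" and D_minus: "d \<in> D \<Longrightarrow> - d \<in> D" and D_0: "0 \<in> D" for d e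
    using unit_degree_add[OF p] unit_degree_minus unit_degree_0 by (auto simp: D_def)
  have "\<forall>d. \<exists>u u' s. d \<in> D \<longrightarrow> u \<in> GA d \<and> u' \<in> GA (- d) \<and> s \<noteq> 0 \<and> u * u' * p = \<phi> s * p \<and> u' * u * p = \<phi> s * p"
    unfolding D_def unit_degree_def by blast
  then obtain U U' s where
    U: "d \<in> D \<Longrightarrow> U d \<in> GA d" and U': "d \<in> D \<Longrightarrow> U' d \<in> GA (- d)" and s: "d \<in> D \<Longrightarrow> s d \<noteq> 0"
    and UU': "d \<in> D \<Longrightarrow> U d * U' d * p = \<phi> (s d) * p" and U'U: "d \<in> D \<Longrightarrow> U' d * U d * p = \<phi> (s d) * p" for d
    by metis
  have rho_s: "\<rho> (s d) \<noteq> 0" if "d \<in> D" for d using s[OF that] rho_eq_0 by blast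
  \<comment> \<open>a base point, common to all degrees in the coset of \<open>c\<close> modulo \<open>D\<close>\<close>
  define rep where "rep c = (SOME r. c - r \<in> D)" for c
  define \<delta> where "\<delta> c = c - rep c" for c
  have \<delta>D: "\<delta> c \<in> D" for c
    unfolding \<delta>_def rep_def by (rule someI[of _ c]) (simp add: D_0)
  have rep_add: "rep (c + d) = rep c" if "d \<in> D" for c d
  proof -
    have "c + d - r \<in> D \<longleftrightarrow> c - r \<in> D" for r
      using D_add[OF _ D_minus[OF that], of "c + d - r"] D_add[OF _ that, of "c - r"]
      by (auto simp: algebra_simps)
    then show ?thesis by (simp add: rep_def)
  qed
  have to_rep: "act a x \<in> GM (rep c)" if "a \<in> GA (- \<delta> c)" "x \<in> GM c" for a c x
    by (rule act_degree[OF that]) (simp add: \<delta>_def)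
  have from_rep: "act a z \<in> GM c" if "a \<in> GA (\<delta> c)" "z \<in> GM (rep c)" for a c z
    by (rule act_degree[OF that]) (simp add: \<delta>_def)
  have U'p: "U' (\<delta> c) * p \<in> GA (- \<delta> c)" for c
    using gA.mult_degree[OF U'[OF \<delta>D] p0] by simp
  have \<iota>U: "\<iota> (U (\<delta> c)) \<in> GA (- \<delta> c)" for c
    by (rule iota_degree[OF U[OF \<delta>D]])
  have \<iota>U': "\<iota> (U' (\<delta> c)) \<in> GA (\<delta> c)" for c
    using iota_degree[OF U'[OF \<delta>D]] by simp
  have \<iota>0: "\<iota> a \<in> GA 0" if "a \<in> GA 0" for a using iota_degree[OF that] by simp
  have deg0: "act a x \<in> GM c" if "a \<in> GA 0" "x \<in> GM c" for a c x
    by (rule act_degree[OF that]) simp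
  \<comment> \<open>the factor is needed because \<open>U'\<close> is only \<open>s\<close> times an inverse of \<open>U\<close>\<close>
  define F where "F c x y = inverse (\<rho> (s (\<delta> c))) * b (rep c) (act (U' (\<delta> c) * p) x) (act (\<iota> (U (\<delta> c))) y)" for c x y
  define \<beta> where "\<beta> x y = (\<Sum>c\<in>UNIV. F c (comp c x) (comp c y))" for x y
  have left: "functional UNIV (\<lambda>x. F c (comp c x) (comp c y))" for c y
    unfolding F_def
    by (intro functional_scale_fun functional_act_comp[OF b_right[OF to_rep[OF \<iota>U comp_in]] U'p])
      (simp add: \<delta>_def)
  have right: "functional UNIV (\<lambda>y. F c (comp c x) (comp c y))" for c x
    unfolding F_def
    by (intro functional_scale_fun functional_act_comp[OF b_left[OF to_rep[OF U'p comp_in]] \<iota>U])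
      (simp add: \<delta>_def)
  have F_zero: "F c 0 y = 0" "F c y 0 = 0" if "y \<in> GM c" for c y
    using b_zero to_rep[OF \<iota>U that] to_rep[OF U'p that] by (simp_all add: F_def)
  have bil: "bilinear_on UNIV \<beta>"
    unfolding bilinear_on_def \<beta>_def using left right by (auto intro!: functional_sum_fun)
  have \<beta>_right: "\<beta> x y = F c (comp c x) y" if "y \<in> GM c" for x y c
  proof -
    have "\<beta> x y = (\<Sum>e\<in>UNIV. if e = c then F c (comp c x) y else 0)"
      unfolding \<beta>_def gM.component_homogeneous[OF that]
      by (intro sum.cong) (auto simp: F_zero(2)[OF comp_in])
    then show ?thesis by simp
  qed
  have \<beta>_left: "\<beta> x y = F c x (comp c y)" if "x \<in> GM c" for x y c
  proof -
    have "\<beta> x y = (\<Sum>e\<in>UNIV. if e = c then F c x (comp c y) else 0)"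
      unfolding \<beta>_def gM.component_homogeneous[OF that]
      by (intro sum.cong) (auto simp: F_zero(1)[OF comp_in])
    then show ?thesis by simp
  qed
  have key: "F (c + d) (act a x) y = F c x (act (\<iota> a) y)"
    if a: "a \<in> GA d" and x: "x \<in> GM c" and y: "y \<in> GM (c + d)" for a c d x y
  proof -
    let ?r = "rep c"
    have ay: "act (\<iota> a) y \<in> GM c"
      by (rule act_degree[OF iota_degree[OF a] y]) simp
    have move_p: "b ?r (act (U' (\<delta> c) * p) x) z = b ?r (act (U' (\<delta> c)) x) (act (\<iota> p) z)"
      if "z \<in> GM ?r" for z
    proof -
      have "act (U' (\<delta> c) * p) x = act p (act (U' (\<delta> c)) x)" by (simp add: pc act_mult)
      then show ?thesis using b_adjoint[OF p0 to_rep[OF U'[OF \<delta>D] x] that] by simp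
    qed
    have rhs: "b ?r (act (U' (\<delta> c) * p) x) (act (\<iota> (U (\<delta> c))) (act (\<iota> a) y)) =
        b ?r (act (U' (\<delta> c)) x) (act (\<iota> (a * U (\<delta> c) * p)) y)"
      unfolding move_p[OF to_rep[OF \<iota>U ay]] by (simp add: iota_mult act_mult)
    show ?thesis
    proof (cases "d \<in> D")
      case False
      \<comment> \<open>then \<open>p a\<close> is a torsion element, and both sides vanish\<close>
      then have "null_degree \<phi> GA p d" using dich by (auto simp: D_def)
      then obtain t where t: "t \<noteq> 0" "\<phi> t * (p * a) = 0" using a unfolding null_degree_def by blast
      have "act (U' (\<delta> (c + d)) * p) (act a x) = 0"
        using torsion_acts_as_zero[OF t, of x] by (simp add: act_mult)
      then have lhs: "F (c + d) (act a x) y = 0"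
        using b_zero(1)[OF to_rep[OF \<iota>U y]] by (simp add: F_def)
      have "\<phi> t * (a * U (\<delta> c) * p) = \<phi> t * (p * a) * U (\<delta> c)" by (simp add: pc pc' mult.assoc)
      then have "\<phi> t * \<iota> (a * U (\<delta> c) * p) = 0" using t(2) iota_0 by (simp flip: iota_scale)
      then have "act (\<iota> (a * U (\<delta> c) * p)) y = 0" by (rule torsion_acts_as_zero[OF t(1)])
      then show ?thesis
        using lhs rhs b_zero(2)[OF to_rep[OF U'[OF \<delta>D] x]] by (simp add: F_def)
    next
      case True
      have r: "rep (c + d) = ?r" by (rule rep_add[OF True])
      define V where "V = U (\<delta> (c + d))"
      define V' where "V' = U' (\<delta> (c + d))"
      define t where "t = s (\<delta> (c + d))"
      note V = U[OF \<delta>D, of "c + d", folded V_def] and V' = U'[OF \<delta>D, of "c + d", folded V'_def]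
        and VV' = UU'[OF \<delta>D, of "c + d", folded V_def V'_def t_def]
      have Vy: "act (\<iota> V) y \<in> GM ?r"
        using to_rep[OF \<iota>U y] by (simp add: V_def r)
      have ax: "act a x \<in> GM (c + d)" by (rule act_degree[OF a x]) (simp add: add.commute)
      have lhs_in: "act (V' * p) (act a x) \<in> GM ?r"
        using to_rep[OF U'p ax] by (simp add: V'_def r)
      \<comment> \<open>units move \<open>a\<close> to degree zero, where adjointness is known\<close>
      have a0: "V' * a * U (\<delta> c) \<in> GA 0"
        using gA.mult_degree[OF gA.mult_degree[OF V' a] U[OF \<delta>D, of c]] by (simp add: \<delta>_def r algebra_simps)
      have "\<rho> (s (\<delta> c)) * b ?r (act (V' * p) (act a x)) (act (\<iota> V) y) =
          b ?r (act (\<phi> (s (\<delta> c))) (act (V' * p) (act a x))) (act (\<iota> V) y)"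
        by (simp add: b_scale_left[OF lhs_in Vy])
      also have "act (\<phi> (s (\<delta> c))) (act (V' * p) (act a x)) =
          act (V' * a * U (\<delta> c)) (act (U' (\<delta> c) * p) x)"
      proof -
        have "V' * a * U (\<delta> c) * (U' (\<delta> c) * p) = V' * a * (U (\<delta> c) * U' (\<delta> c) * p)"
          by (simp only: mult.assoc)
        also have "\<dots> = V' * a * (\<phi> (s (\<delta> c)) * p)" by (simp only: UU'[OF \<delta>D])
        also have "\<dots> = \<phi> (s (\<delta> c)) * (V' * p * a)"
          by (metis mult.assoc pc phi_central)
        finally show ?thesis by (simp flip: act_mult)
      qed
      also have "b ?r (act (V' * a * U (\<delta> c)) (act (U' (\<delta> c) * p) x)) (act (\<iota> V) y) =
          b ?r (act (U' (\<delta> c) * p) x) (act (\<iota> (V' * a * U (\<delta> c))) (act (\<iota> V) y))"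
        by (rule b_adjoint[OF a0 to_rep[OF U'p x] Vy])
      also have "\<dots> = b ?r (act (U' (\<delta> c)) x) (act (\<iota> p) (act (\<iota> (V' * a * U (\<delta> c))) (act (\<iota> V) y)))"
        by (rule move_p[OF deg0[OF \<iota>0[OF a0] Vy]])
      also have "act (\<iota> p) (act (\<iota> (V' * a * U (\<delta> c))) (act (\<iota> V) y)) =
          act (\<phi> t) (act (\<iota> (a * U (\<delta> c) * p)) y)"
      proof -
        have "V * (V' * a * U (\<delta> c)) * p = (V * V' * p) * (a * U (\<delta> c))"
          by (metis mult.assoc pc)
        also have "\<dots> = \<phi> t * (a * U (\<delta> c) * p)"
          unfolding VV' by (metis mult.assoc pc)
        finally have "\<iota> p * (\<iota> (V' * a * U (\<delta> c)) * \<iota> V) = \<phi> t * \<iota> (a * U (\<delta> c) * p)"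
          by (simp flip: iota_mult iota_scale)
        then show ?thesis by (simp flip: act_mult)
      qed
      also have "b ?r (act (U' (\<delta> c)) x) (act (\<phi> t) (act (\<iota> (a * U (\<delta> c) * p)) y)) =
          \<rho> t * b ?r (act (U' (\<delta> c)) x) (act (\<iota> (a * U (\<delta> c) * p)) y)"
      proof (rule b_scale_right[OF to_rep[OF U'[OF \<delta>D] x]])
        have "act (\<iota> p) (act (\<iota> (U (\<delta> c))) (act (\<iota> a) y)) \<in> GM ?r"
          by (rule deg0[OF \<iota>0[OF p0] to_rep[OF \<iota>U ay]])
        then show "act (\<iota> (a * U (\<delta> c) * p)) y \<in> GM ?r" by (simp add: iota_mult act_mult)
      qed
      finally show ?thesis
        using rho_s[OF \<delta>D, of c] rho_s[OF \<delta>D, of "c + d", folded t_def]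
        unfolding F_def rhs r V_def[symmetric] V'_def[symmetric] t_def[symmetric]
        by (simp add: field_simps)
    qed
  qed
  show thesis
  proof (rule that[of \<beta>])
    show "bilinear_on UNIV \<beta>" by (rule bil)
    show "\<beta> x y = 0" if "c \<noteq> c'" "x \<in> GM c" "y \<in> GM c'" for c c' x y
      unfolding \<beta>_left[OF that(2)] gM.component_homogeneous[OF that(3)]
      using that F_zero(2)[OF that(2)] by simp
    show "\<beta> (act a x) y = \<beta> x (act (\<iota> a) y)" for a x y
    proof -
      have hom: "\<beta> (act a x) y = \<beta> x (act (\<iota> a) y)" if a: "a \<in> GA d" for a d
      proof -
        have "\<beta> (act a x) y = (\<Sum>c\<in>UNIV. F c (act a (comp (c - d) x)) (comp c y))"
          by (simp add: \<beta>_def comp_act[OF a])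
        also have "\<dots> = (\<Sum>c\<in>UNIV. F (c + d) (act a (comp c x)) (comp (c + d) y))"
          by (rule sum.reindex_bij_witness[of _ "\<lambda>c. c + d" "\<lambda>c. c - d"]) auto
        also have "\<dots> = (\<Sum>c\<in>UNIV. F c (comp c x) (act (\<iota> a) (comp (c + d) y)))"
          by (intro sum.cong refl key[OF a comp_in comp_in])
        also have "\<dots> = \<beta> x (act (\<iota> a) y)"
          by (simp add: \<beta>_def comp_act[OF iota_degree[OF a]])
        finally show ?thesis .
      qed
      have fun1: "functional UNIV (\<lambda>x. \<beta> x y)" and fun2: "functional UNIV (\<beta> x)" for x y
        using bil by (auto simp: bilinear_on_def)
      have "\<beta> (act a x) y = \<beta> (\<Sum>d\<in>UNIV. act (component GA d a) x) y"
        by (simp add: sum_component[OF gA.direct] flip: act_sum_left)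
      also have "\<dots> = (\<Sum>d\<in>UNIV. \<beta> (act (component GA d a) x) y)"
        by (rule functional_sum[OF fun1 submodule_UNIV, THEN conjunct1]) simp
      also have "\<dots> = (\<Sum>d\<in>UNIV. \<beta> x (act (\<iota> (component GA d a)) y))"
        by (intro sum.cong refl hom[OF component_in[OF gA.direct]])
      also have "\<dots> = \<beta> x (\<Sum>d\<in>UNIV. act (\<iota> (component GA d a)) y)"
        by (rule functional_sum[OF fun2 submodule_UNIV, THEN conjunct1, symmetric]) simp
      also have "\<dots> = \<beta> x (act (\<iota> a) y)"
        by (simp add: sum_component[OF gA.direct] flip: act_sum_left iota_sum)
      finally show ?thesis .
    qed
    show "tensor_eval (\<lambda>x. g (act p x)) u = 0"
      if g: "functional UNIV g" and zero: "\<And>y. tensor_eval (\<lambda>x. \<beta> x y) u = 0" for g u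
    proof -
      have "tensor_eval (\<lambda>x. g (act p (comp c x))) u = 0" for c
      proof -
        let ?f = "\<lambda>x. act (U' (\<delta> c) * p) (comp c x)"
        have f: "?f x \<in> GM (rep c)" for x by (rule to_rep[OF U'p comp_in])
        \<comment> \<open>the values \<open>y = \<iota>(U') z\<close> recover the form in the base degree\<close>
        have "b (rep c) (?f x) z = \<beta> x (act (\<iota> (U' (\<delta> c))) z)" if z: "z \<in> GM (rep c)" for x z
        proof -
          have U'U0: "U' (\<delta> c) * U (\<delta> c) \<in> GA 0"
            using gA.mult_degree[OF U'[OF \<delta>D] U[OF \<delta>D], of c c] by simp
          have "b (rep c) (?f x) (act (\<iota> (U (\<delta> c))) (act (\<iota> (U' (\<delta> c))) z)) =
              b (rep c) (?f x) (act (\<iota> (U' (\<delta> c) * U (\<delta> c))) z)"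
            by (simp add: iota_mult act_mult)
          also have "\<dots> = b (rep c) (act (U' (\<delta> c) * U (\<delta> c)) (?f x)) z"
            by (rule b_adjoint[OF U'U0 f z, symmetric])
          also have "act (U' (\<delta> c) * U (\<delta> c)) (?f x) = act (\<phi> (s (\<delta> c))) (?f x)"
          proof -
            have "U' (\<delta> c) * U (\<delta> c) * (U' (\<delta> c) * p) = (U' (\<delta> c) * U (\<delta> c) * p) * U' (\<delta> c)"
              by (simp add: pc pc' mult.assoc)
            also have "\<dots> = \<phi> (s (\<delta> c)) * (U' (\<delta> c) * p)"
              unfolding U'U[OF \<delta>D] by (simp add: pc pc' mult.assoc)
            finally show ?thesis by (simp flip: act_mult)
          qed
          finally show ?thesis
            using rho_s[OF \<delta>D, of c]
            by (simp add: \<beta>_right[OF from_rep[OF \<iota>U' z]] F_def b_scale_left[OF f z])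
        qed
        then have "tensor_eval (\<lambda>x. b (rep c) x z) (formal_map ?f u) = 0" if "z \<in> GM (rep c)" for z
          using zero that by (simp add: tensor_eval_map)
        moreover have "formal_map ?f u \<in> formal (GM (rep c))"
          using keys_formal_map[of u UNIV ?f] f by simp
        ultimately have "tensor_eval (\<lambda>x. g (act (U (\<delta> c)) x)) (formal_map ?f u) = 0"
          by (intro nondegenerate_onD[OF b_nondegenerate[of "rep c"]] functional_act[OF g]) auto
        moreover have "g (act (U (\<delta> c)) (?f x)) = \<rho> (s (\<delta> c)) * g (act p (comp c x))" for x
        proof -
          have "act (U (\<delta> c)) (?f x) = act (\<phi> (s (\<delta> c))) (act p (comp c x))"
            using arg_cong[OF UU'[OF \<delta>D, of c], of "\<lambda>z. act z (comp c x)"]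
            by (simp only: act_mult)
          then show ?thesis using g by (simp add: functional_def)
        qed
        ultimately show ?thesis
          using rho_s[OF \<delta>D, of c] by (simp add: tensor_eval_map tensor_eval_scale)
      qed
      then have "tensor_eval (\<lambda>x. \<Sum>c\<in>UNIV. g (act p (comp c x))) u = 0"
        by (simp add: tensor_eval_sum_fun)
      moreover have "(\<Sum>c\<in>UNIV. g (act p (comp c x))) = g (act p x)" for x
        using functional_comp_sum[OF g, of "act p x"] by (simp only: comp_act_0[OF p0])
      ultimately show ?thesis by simp
    qed
    show "tensor_eval (\<lambda>y. g (act (\<iota> p) y)) u = 0"
      if g: "functional UNIV g" and zero: "\<And>x. tensor_eval (\<beta> x) u = 0" for g u
    proof -
      have "tensor_eval (\<lambda>y. g (act (\<iota> p) (comp c y))) u = 0" for c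
      proof -
        let ?f = "\<lambda>y. act (\<iota> (U (\<delta> c) * p)) (comp c y)"
        have Up: "\<iota> (U (\<delta> c) * p) \<in> GA (- \<delta> c)"
          using iota_degree[OF gA.mult_degree[OF U[OF \<delta>D] p0]] by simp
        have f: "?f x \<in> GM (rep c)" for x by (rule to_rep[OF Up comp_in])
        have "b (rep c) z (?f y) = \<beta> (act (U (\<delta> c)) z) y" if z: "z \<in> GM (rep c)" for y z
        proof -
          have Uz: "act (U (\<delta> c)) z \<in> GM c" by (rule from_rep[OF U[OF \<delta>D] z])
          have y: "act (\<iota> (U (\<delta> c))) (comp c y) \<in> GM (rep c)" by (rule to_rep[OF \<iota>U comp_in])
          have "U' (\<delta> c) * p * U (\<delta> c) = \<phi> (s (\<delta> c)) * p"
            using U'U[OF \<delta>D, of c] by (simp add: pc pc' mult.assoc)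
          then have "act (U' (\<delta> c) * p) (act (U (\<delta> c)) z) = act (\<phi> (s (\<delta> c))) (act p z)"
            by (simp flip: act_mult)
          then have "\<beta> (act (U (\<delta> c)) z) y = b (rep c) (act p z) (act (\<iota> (U (\<delta> c))) (comp c y))"
            using rho_s[OF \<delta>D, of c]
            by (simp add: \<beta>_left[OF Uz] F_def b_scale_left[OF deg0[OF p0 z] y])
          also have "\<dots> = b (rep c) z (?f y)"
            unfolding b_adjoint[OF p0 z y] by (simp add: iota_mult act_mult)
          finally show ?thesis ..
        qed
        then have "tensor_eval (b (rep c) z) (formal_map ?f u) = 0" if "z \<in> GM (rep c)" for z
          using zero that by (simp add: tensor_eval_map)
        moreover have "formal_map ?f u \<in> formal (GM (rep c))"
          using keys_formal_map[of u UNIV ?f] f by simp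
        ultimately have "tensor_eval (\<lambda>x. g (act (\<iota> (U' (\<delta> c))) x)) (formal_map ?f u) = 0"
          by (intro nondegenerate_onD[OF b_nondegenerate[of "rep c"]] functional_act[OF g]) auto
        moreover have "g (act (\<iota> (U' (\<delta> c))) (?f y)) = \<rho> (s (\<delta> c)) * g (act (\<iota> p) (comp c y))" for y
        proof -
          have "U (\<delta> c) * p * U' (\<delta> c) = \<phi> (s (\<delta> c)) * p"
            using UU'[OF \<delta>D, of c] by (simp add: pc pc' mult.assoc)
          then have "\<iota> (U' (\<delta> c)) * \<iota> (U (\<delta> c) * p) = \<phi> (s (\<delta> c)) * \<iota> p"
            by (metis iota_mult iota_scale)
          then have "act (\<iota> (U' (\<delta> c))) (?f y) = act (\<phi> (s (\<delta> c))) (act (\<iota> p) (comp c y))"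
            by (simp flip: act_mult)
          then show ?thesis using g by (simp add: functional_def)
        qed
        ultimately show ?thesis
          using rho_s[OF \<delta>D, of c] by (simp add: tensor_eval_map tensor_eval_scale)
      qed
      then have "tensor_eval (\<lambda>x. \<Sum>c\<in>UNIV. g (act (\<iota> p) (comp c x))) u = 0"
        by (simp add: tensor_eval_sum_fun)
      moreover have "(\<Sum>c\<in>UNIV. g (act (\<iota> p) (comp c x))) = g (act (\<iota> p) x)" for x
        using functional_comp_sum[OF g, of "act (\<iota> p) x"] by (simp only: comp_act_0[OF \<iota>0[OF p0]])
      ultimately show ?thesis by simp
    qed
    show "\<beta> (act a x) y = \<beta> (act a' x) y" if "p * a = p * a'" for a a' x y
    proof -
      have "act (U' (\<delta> c) * p) (comp c (act a x)) = act (U' (\<delta> c)) (comp c (act (p * a) x))" for a c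
        by (simp add: act_mult comp_act_0[OF p0])
      then show ?thesis by (simp add: \<beta>_def F_def that)
    qed
  qed
qed

text \<open>
  The forms transported on the parts of a decomposition of unity are added.  By orthogonality the
  summands can be recovered from their sum \<open>\<beta>\<close>: \<open>\<beta>(P\<^sub>k x, y) = q \<beta>\<^sub>k(x, y)\<close>.
\<close>

lemma glued_form:
  fixes P :: "'k \<Rightarrow> 'a"
  assumes K: "finite K" and P: "\<And>k. k \<in> K \<Longrightarrow> P k \<in> central0 GA"
    and q: "q \<noteq> 0" and sum_P: "(\<Sum>k\<in>K. P k) = \<phi> q"
    and orth: "\<And>k k'. k \<in> K \<Longrightarrow> k' \<in> K \<Longrightarrow> k \<noteq> k' \<Longrightarrow> P k * P k' = 0"
    and idem: "\<And>k. k \<in> K \<Longrightarrow> P k * P k = \<phi> q * P k"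
    and dich: "\<And>k d. k \<in> K \<Longrightarrow> unit_degree \<phi> GA (P k) d \<or> null_degree \<phi> GA (P k) d"
  obtains \<beta> where "bilinear_on UNIV \<beta>" and "nondegenerate_on UNIV \<beta>"
    and "\<And>c c' x y. c \<noteq> c' \<Longrightarrow> x \<in> GM c \<Longrightarrow> y \<in> GM c' \<Longrightarrow> \<beta> x y = 0"
    and "\<And>a x y. \<beta> (act a x) y = \<beta> x (act (\<iota> a) y)"
proof -
  define good where "good p \<beta> \<longleftrightarrow> bilinear_on UNIV \<beta> \<and>
      (\<forall>c c' x y. c \<noteq> c' \<longrightarrow> x \<in> GM c \<longrightarrow> y \<in> GM c' \<longrightarrow> \<beta> x y = 0) \<and>
      (\<forall>a x y. \<beta> (act a x) y = \<beta> x (act (\<iota> a) y)) \<and>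
      (\<forall>g u. functional UNIV g \<longrightarrow> (\<forall>y. tensor_eval (\<lambda>x. \<beta> x y) u = 0) \<longrightarrow>
        tensor_eval (\<lambda>x. g (act p x)) u = 0) \<and>
      (\<forall>g u. functional UNIV g \<longrightarrow> (\<forall>x. tensor_eval (\<beta> x) u = 0) \<longrightarrow>
        tensor_eval (\<lambda>y. g (act (\<iota> p) y)) u = 0) \<and>
      (\<forall>a a' x y. p * a = p * a' \<longrightarrow> \<beta> (act a x) y = \<beta> (act a' x) y)" for p \<beta>
  have "\<exists>\<beta>. good (P k) \<beta>" if k: "k \<in> K" for k
    unfolding good_def by (rule transported_form[OF P[OF k] dich[OF k]]) blast
  then obtain \<beta> where good: "\<And>k. k \<in> K \<Longrightarrow> good (P k) (\<beta> k)" by metis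
  note good = good[unfolded good_def]
  have bil: "bilinear_on UNIV (\<beta> k)" if "k \<in> K" for k
    using good[OF that] by (elim conjE)
  have ort: "\<beta> k x y = 0" if "k \<in> K" "c \<noteq> c'" "x \<in> GM c" "y \<in> GM c'" for k c c' x y
    using good[OF that(1)] that(2-4) by (elim conjE) blast
  have adj: "\<beta> k (act a x) y = \<beta> k x (act (\<iota> a) y)" if "k \<in> K" for k a x y
    using good[OF that] by (elim conjE) blast
  have nd1: "tensor_eval (\<lambda>x. g (act (P k) x)) u = 0"
    if "k \<in> K" "functional UNIV g" "\<forall>y. tensor_eval (\<lambda>x. \<beta> k x y) u = 0" for k g u
    using good[OF that(1)] that(2,3) by (elim conjE) blast
  have nd2: "tensor_eval (\<lambda>y. g (act (\<iota> (P k)) y)) u = 0"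
    if "k \<in> K" "functional UNIV g" "\<forall>x. tensor_eval (\<beta> k x) u = 0" for k g u
    using good[OF that(1)] that(2,3) by (elim conjE) blast
  have factor: "\<beta> k (act a x) y = \<beta> k (act a' x) y" if "k \<in> K" "P k * a = P k * a'" for k a a' x y
    using good[OF that(1)] that(2) by (elim conjE) blast
  define B where "B x y = (\<Sum>k\<in>K. \<beta> k x y)" for x y
  have \<rho>q: "\<rho> q \<noteq> 0" using q rho_eq_0 by blast
  have B_P: "B (act (P k) x) y = \<rho> q * \<beta> k x y" if k: "k \<in> K" for k x y
  proof -
    have "\<beta> k' (act (P k) x) y = (if k' = k then \<rho> q * \<beta> k x y else 0)" if k': "k' \<in> K" for k'
    proof (cases "k' = k")
      case True
      have "\<beta> k (act (P k) x) y = \<beta> k (act (\<phi> q) x) y"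
        by (rule factor[OF k]) (simp add: idem[OF k] phi_central)
      then show ?thesis using True bil[OF k] by (simp add: bilinear_on_def functional_def)
    next
      case False
      have "\<beta> k' (act (P k) x) y = \<beta> k' (act (\<phi> 0) x) y"
      proof (rule factor[OF k'])
        have "\<phi> 0 = 0" using phi_add[of 0 0] by simp
        then show "P k' * P k = P k' * \<phi> 0" using orth[OF k' k False] by simp
      qed
      then show ?thesis using False bil[OF k'] by (simp add: bilinear_on_def functional_def rho_0)
    qed
    then show ?thesis using K k by (simp add: B_def)
  qed
  have B_adj: "B (act a x) y = B x (act (\<iota> a) y)" for a x y
    using adj by (simp add: B_def)
  show thesis
  proof (rule that[of B])
    show "bilinear_on UNIV B"
      using bil unfolding bilinear_on_def B_def by (auto intro!: functional_sum_fun)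
    show "B x y = 0" if "c \<noteq> c'" "x \<in> GM c" "y \<in> GM c'" for c c' x y
      using ort[OF _ that] by (simp add: B_def)
    show "B (act a x) y = B x (act (\<iota> a) y)" for a x y by (rule B_adj)
    show "nondegenerate_on UNIV B"
      unfolding nondegenerate_on_def
    proof (intro ballI impI allI)
      fix u g
      assume g: "functional UNIV g"
      assume "(\<forall>y\<in>UNIV. tensor_eval (\<lambda>x. B x y) u = 0) \<or> (\<forall>x\<in>UNIV. tensor_eval (B x) u = 0)"
      then have "\<rho> q * tensor_eval g u = 0"
      proof
        assume *: "\<forall>y\<in>UNIV. tensor_eval (\<lambda>x. B x y) u = 0"
        have "tensor_eval (\<lambda>x. \<beta> k x y) u = 0" if k: "k \<in> K" for k y
        proof -
          have "\<rho> q * tensor_eval (\<lambda>x. \<beta> k x y) u = tensor_eval (\<lambda>x. B x (act (\<iota> (P k)) y)) u"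
            by (simp add: tensor_eval_scale B_P[OF k] flip: B_adj)
          then show ?thesis using * \<rho>q by simp
        qed
        then have "(\<Sum>k\<in>K. tensor_eval (\<lambda>x. g (act (P k) x)) u) = 0"
          using nd1[OF _ g] by simp
        moreover have "(\<Sum>k\<in>K. g (act (P k) x)) = \<rho> q * g x" for x
        proof -
          have "(\<Sum>k\<in>K. g (act (P k) x)) = g (act (\<phi> q) x)"
            using functional_sum[OF g submodule_UNIV, of K "\<lambda>k. act (P k) x"]
            by (simp add: sum_P flip: act_sum_left)
          then show ?thesis using g by (simp add: functional_def)
        qed
        ultimately show ?thesis by (simp add: tensor_eval_scale flip: tensor_eval_sum_fun)
      next
        assume *: "\<forall>x\<in>UNIV. tensor_eval (B x) u = 0"
        have "tensor_eval (\<beta> k x) u = 0" if k: "k \<in> K" for k x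
        proof -
          have "\<rho> q * tensor_eval (\<beta> k x) u = tensor_eval (\<lambda>y. B (act (P k) x) y) u"
            by (simp add: B_P[OF k] tensor_eval_scale)
          then show ?thesis using * \<rho>q by simp
        qed
        then have "(\<Sum>k\<in>K. tensor_eval (\<lambda>x. g (act (\<iota> (P k)) x)) u) = 0"
          using nd2[OF _ g] by simp
        moreover have "(\<Sum>k\<in>K. g (act (\<iota> (P k)) x)) = \<rho> q * g x" for x
        proof -
          have "(\<Sum>k\<in>K. g (act (\<iota> (P k)) x)) = g (act (\<phi> q) x)"
            using functional_sum[OF g submodule_UNIV, of K "\<lambda>k. act (\<iota> (P k)) x"]
            by (simp add: sum_P iota_phi flip: act_sum_left iota_sum)
          then show ?thesis using g by (simp add: functional_def)
        qed
        ultimately show ?thesis by (simp add: tensor_eval_scale flip: tensor_eval_sum_fun)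
      qed
      then show "tensor_eval g u = 0" using \<rho>q by simp
    qed
  qed
qed

end

section \<open>Quotients of group algebras\<close>

lemma poly_mapping_sum_single:
  fixes f :: "'w \<Rightarrow>\<^sub>0 't::comm_monoid_add"
  shows "(\<Sum>w\<in>Poly_Mapping.keys f. Poly_Mapping.single w (Poly_Mapping.lookup f w)) = f"
proof (rule poly_mapping_eqI)
  fix v
  have "Poly_Mapping.lookup (\<Sum>w\<in>I. Poly_Mapping.single w (Poly_Mapping.lookup f w)) v =
      (\<Sum>w\<in>I. if w = v then Poly_Mapping.lookup f v else 0)" for I
    by (induction I rule: infinite_finite_induct) (auto simp: lookup_add lookup_single when_def)
  then show "Poly_Mapping.lookup (\<Sum>w\<in>Poly_Mapping.keys f. Poly_Mapping.single w (Poly_Mapping.lookup f w)) v =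
      Poly_Mapping.lookup f v"
    by (auto simp: in_keys_iff)
qed

text \<open>
  A grading-preserving surjection \<open>\<pi>\<close> from \<open>T[W]\<close> onto a graded algebra \<open>A\<close>.
\<close>

locale group_algebra_quotient =
  T: graded_alg \<phi>T GT + A: graded_alg \<phi>A GA
  for \<phi>T :: "'r::idom \<Rightarrow> 't::{comm_ring,comm_monoid_mult}"
    and GT :: "'c::{finite,ab_group_add} \<Rightarrow> 't set"
    and \<phi>A :: "'r \<Rightarrow> 'a::{ring,monoid_mult}"
    and GA :: "'c \<Rightarrow> 'a set" +
  fixes \<nu> :: "'w::group_add \<Rightarrow> 'c"
    and \<pi> :: "('w \<Rightarrow>\<^sub>0 't) \<Rightarrow> 'a"
  assumes \<nu>_add: "\<nu> (v + w) = \<nu> v + \<nu> w"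
    and hom: "group_algebra_hom \<phi>T \<phi>A \<pi>"
    and surj: "surj \<pi>"
    and degree: "\<pi> ` group_algebra_grading GT \<nu> c \<subseteq> GA c"
begin

text \<open>\<open>\<tau> t\<close> and \<open>\<omega> w\<close> are the images in \<open>A\<close> of \<open>t \<in> T\<close> and \<open>w \<in> W\<close>.\<close>

definition \<tau> :: "'t \<Rightarrow> 'a" where "\<tau> t = \<pi> (Poly_Mapping.single 0 t)"

definition \<omega> :: "'w \<Rightarrow> 'a" where "\<omega> w = \<pi> (Poly_Mapping.single w 1)"

lemma pi_add: "\<pi> (f + g) = \<pi> f + \<pi> g" and pi_mult: "\<pi> (f * g) = \<pi> f * \<pi> g"
  and tau_phi: "\<tau> (\<phi>T r) = \<phi>A r"
  using hom unfolding group_algebra_hom_def \<tau>_def by blast+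

lemma pi_0: "\<pi> 0 = 0"
proof -
  have "\<pi> 0 + \<pi> 0 = \<pi> 0 + 0" using pi_add[of 0 0] by simp
  then show ?thesis by (rule add_left_imp_eq)
qed

lemma pi_sum: "\<pi> (sum f I) = (\<Sum>i\<in>I. \<pi> (f i))"
  by (induction I rule: infinite_finite_induct) (auto simp: pi_0 pi_add)

lemma pi_single: "\<pi> (Poly_Mapping.single w t) = \<tau> t * \<omega> w"
  by (simp add: \<tau>_def \<omega>_def mult_single flip: pi_mult)

lemma tau_add: "\<tau> (x + y) = \<tau> x + \<tau> y"
  by (simp add: \<tau>_def single_add pi_add)

lemma tau_mult: "\<tau> (x * y) = \<tau> x * \<tau> y"
  by (simp add: \<tau>_def mult_single flip: pi_mult)

lemma tau_0: "\<tau> 0 = 0"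
  by (simp add: \<tau>_def pi_0)

lemma tau_1: "\<tau> 1 = 1"
  using tau_phi[of 1] by (simp add: T.phi_1 A.phi_1)

lemma tau_minus: "\<tau> (- x) = - \<tau> x"
  using tau_add[of x "- x"] by (simp add: tau_0 eq_neg_iff_add_eq_0 add.commute)

lemma tau_diff: "\<tau> (x - y) = \<tau> x - \<tau> y"
  using tau_add[of x "- y"] by (simp add: tau_minus)

lemma tau_sum: "\<tau> (sum f I) = (\<Sum>i\<in>I. \<tau> (f i))"
  by (induction I rule: infinite_finite_induct) (auto simp: tau_0 tau_add)

lemma tau_power: "\<tau> (x ^ n) = \<tau> x ^ n"
  by (induction n) (auto simp: tau_1 tau_mult)

lemma omega_add: "\<omega> (v + w) = \<omega> v * \<omega> w"
  by (simp add: \<omega>_def mult_single flip: pi_mult)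

lemma omega_inverse: "\<omega> w * \<omega> (- w) = 1" "\<omega> (- w) * \<omega> w = 1"
proof -
  have "\<omega> 0 = 1" using tau_1 by (simp add: \<omega>_def \<tau>_def)
  then show "\<omega> w * \<omega> (- w) = 1" "\<omega> (- w) * \<omega> w = 1" by (simp_all flip: omega_add)
qed

lemma nu_0: "\<nu> 0 = 0"
  using \<nu>_add[of 0 0] by simp

lemma nu_minus: "\<nu> (- w) = - \<nu> w"
  using \<nu>_add[of w "- w"] nu_0 by (simp add: eq_neg_iff_add_eq_0 add.commute)

lemma tau_central: "\<tau> t * a = a * \<tau> t"
proof -
  obtain f where f: "a = \<pi> f" using surj by blast
  have "\<tau> t * \<pi> (Poly_Mapping.single w t') = \<pi> (Poly_Mapping.single w t') * \<tau> t" for w t'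
    by (simp add: \<tau>_def mult_single mult.commute flip: pi_mult)
  then have "\<tau> t * \<pi> (\<Sum>w\<in>Poly_Mapping.keys f. Poly_Mapping.single w (Poly_Mapping.lookup f w)) =
      \<pi> (\<Sum>w\<in>Poly_Mapping.keys f. Poly_Mapping.single w (Poly_Mapping.lookup f w)) * \<tau> t"
    by (simp add: pi_sum sum_distrib_left sum_distrib_right)
  then show ?thesis by (simp add: poly_mapping_sum_single f)
qed

lemma single_degree:
  assumes "t \<in> GT c"
  shows "Poly_Mapping.single w t \<in> group_algebra_grading GT \<nu> (c + \<nu> w)"
  unfolding group_algebra_grading_def using assms T.zero_in
  by (auto simp: lookup_single when_def)

lemma tau_degree: "t \<in> GT c \<Longrightarrow> \<tau> t \<in> GA c"
  using single_degree[of t c 0] degree by (auto simp: nu_0 \<tau>_def)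

lemma omega_degree: "\<omega> w \<in> GA (\<nu> w)"
  using single_degree[OF T.one_degree, of w] degree by (auto simp: \<omega>_def)

lemma tau_central0: "t \<in> GT 0 \<Longrightarrow> \<tau> t \<in> central0 GA"
  unfolding central0_def using tau_central tau_degree by blast

text \<open>The monomials of degree \<open>d\<close> are the images of \<open>t \<cdot> w\<close> with \<open>t\<close> homogeneous of degree \<open>d - \<nu>(w)\<close>.\<close>

definition monomials :: "'c \<Rightarrow> 'a set" where
  "monomials d = {\<tau> t * \<omega> w | t w c. t \<in> GT c \<and> c + \<nu> w = d}"

lemma component_monomial: "\<tau> (component GT c x) * \<omega> w \<in> monomials (c + \<nu> w)"
  unfolding monomials_def using component_in[OF T.direct] by blast

lemma monomials_degree: "monomials d \<subseteq> GA d"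
  unfolding monomials_def using A.mult_degree[OF tau_degree omega_degree] by blast

lemma sum_of_monomials:
  "\<pi> f = (\<Sum>(w, c)\<in>Poly_Mapping.keys f \<times> UNIV. \<tau> (component GT c (Poly_Mapping.lookup f w)) * \<omega> w)"
proof -
  have "\<pi> f = \<pi> (\<Sum>w\<in>Poly_Mapping.keys f. Poly_Mapping.single w (Poly_Mapping.lookup f w))"
    by (simp add: poly_mapping_sum_single)
  also have "\<dots> = (\<Sum>w\<in>Poly_Mapping.keys f. \<tau> (\<Sum>c\<in>UNIV. component GT c (Poly_Mapping.lookup f w)) * \<omega> w)"
    by (simp add: pi_sum pi_single sum_component[OF T.direct])
  finally show ?thesis
    by (simp add: tau_sum sum_distrib_right sum.cartesian_product)
qed

text \<open>
  Over a finite algebra, finitely many monomials suffice; by projection, those of degree \<open>d\<close>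
  span \<open>A\<^sub>d\<close>.
\<close>

lemma finite_spanning_monomials:
  assumes fg: "finitely_generated (\<lambda>r a. \<phi>A r * a)"
  obtains X where "finite X" and "X \<subseteq> (\<Union>d. monomials d)"
    and "\<And>a. \<exists>f. a = (\<Sum>x\<in>X. \<phi>A (f x) * x)"
proof -
  interpret m: module "\<lambda>r a. \<phi>A r * a" by (rule A.module)
  obtain S where S: "finite S" "\<And>a. \<exists>f. a = (\<Sum>s\<in>S. \<phi>A (f s) * s)"
    using fg unfolding finitely_generated_def by blast
  obtain g where g: "\<And>s. s = \<pi> (g s)" using surj unfolding surj_def by metis
  let ?mon = "\<lambda>s (w, c). \<tau> (component GT c (Poly_Mapping.lookup (g s) w)) * \<omega> w"
  define X where "X = (\<Union>s\<in>S. ?mon s ` (Poly_Mapping.keys (g s) \<times> UNIV))"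
  have finX: "finite X" using S(1) by (simp add: X_def)
  have "X \<subseteq> (\<Union>d. monomials d)"
  proof
    fix x assume "x \<in> X"
    then obtain s w c where "x = \<tau> (component GT c (Poly_Mapping.lookup (g s) w)) * \<omega> w"
      by (auto simp: X_def)
    then have "x \<in> monomials (c + \<nu> w)" by (simp add: component_monomial)
    then show "x \<in> (\<Union>d. monomials d)" by blast
  qed
  moreover have "\<exists>f. a = (\<Sum>x\<in>X. \<phi>A (f x) * x)" for a
  proof -
    have "s \<in> m.span X" if "s \<in> S" for s
    proof -
      have "s = (\<Sum>p\<in>Poly_Mapping.keys (g s) \<times> UNIV. ?mon s p)"
        by (subst g) (rule sum_of_monomials)
      also have "\<dots> \<in> m.span X"
        using that by (intro m.span_sum m.span_base) (auto simp: X_def)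
      finally show ?thesis .
    qed
    moreover obtain f where "a = (\<Sum>s\<in>S. \<phi>A (f s) * s)" using S(2) by blast
    ultimately have "a \<in> m.span X"
      by (auto intro!: m.span_sum m.span_scale)
    then show ?thesis unfolding m.span_finite[OF finX] by auto
  qed
  ultimately show thesis using that finX by blast
qed

end

text \<open>
  The quotient is finite over \<open>R\<close>, and the image of \<open>T\<close> in it has no nilpotent elements.
\<close>

locale reduced_group_algebra_quotient = group_algebra_quotient \<phi>T GT \<phi>A GA \<nu> \<pi>
  for \<phi>T :: "'r::idom \<Rightarrow> 't::{comm_ring,comm_monoid_mult}"
    and GT :: "'c::{finite,ab_group_add} \<Rightarrow> 't set"
    and \<phi>A :: "'r \<Rightarrow> 'a::{ring,monoid_mult}"
    and GA :: "'c \<Rightarrow> 'a set"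
    and \<nu> :: "'w::group_add \<Rightarrow> 'c"
    and \<pi> :: "('w \<Rightarrow>\<^sub>0 't) \<Rightarrow> 'a" +
  assumes fg: "finitely_generated (\<lambda>r a. \<phi>A r * a)"
    and reduced: "reduced (range (\<lambda>t. \<pi> (Poly_Mapping.single 0 t)))"
begin

lemma tau_reduced: "\<tau> (t ^ Suc n) = 0 \<Longrightarrow> \<tau> t = 0"
  using reduced unfolding reduced_def by (metis \<tau>_def rangeI tau_power)

text \<open>
  The image of \<open>T\<close> becomes von Neumann regular after inverting the non-zero elements of \<open>R\<close>:
  \<open>x = \<tau> t\<close> satisfies a relation \<open>\<Sum> r\<^sub>i x\<^sup>i = 0\<close> over \<open>R\<close>, and by reducedness its lowest term may
  be taken in degree at most one.
\<close>

lemma von_neumann_regular: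
  assumes t: "t \<in> GT 0"
  obtains s y where "s \<noteq> 0" and "y \<in> GT 0" and "\<phi>A s * \<tau> t = \<tau> (t * t * y)"
proof -
  obtain X where X: "finite X" "\<And>a. \<exists>f. a = (\<Sum>x\<in>X. \<phi>A (f x) * x)"
    by (rule finite_spanning_monomials[OF fg]) blast
  obtain c where c: "\<And>a. a = (\<Sum>x\<in>X. \<phi>A (c a x) * x)" using X(2) by metis
  define k where "k = card X"
  obtain r i where i: "i \<in> {..k}" "r i \<noteq> 0"
    and r: "\<And>x. x \<in> X \<Longrightarrow> (\<Sum>i\<le>k. r i * c (\<tau> t ^ i) x) = 0"
    using more_rows_than_columns_dependent[OF X(1), of "{..k}" "\<lambda>i. c (\<tau> t ^ i)"]
    by (auto simp: k_def)
  have phi_sum: "\<phi>A (sum f I) = (\<Sum>i\<in>I. \<phi>A (f i))" for f :: "nat \<Rightarrow> 'r" and I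
    by (induction I rule: infinite_finite_induct)
      (use A.phi_add[of 0 0] in \<open>auto simp: A.phi_add\<close>)
  have "\<tau> (\<Sum>i\<le>k. \<phi>T (r i) * t ^ i) = (\<Sum>i\<le>k. \<phi>A (r i) * (\<Sum>x\<in>X. \<phi>A (c (\<tau> t ^ i) x) * x))"
    by (simp add: tau_sum tau_mult tau_phi tau_power flip: c)
  also have "\<dots> = (\<Sum>x\<in>X. \<phi>A (\<Sum>i\<le>k. r i * c (\<tau> t ^ i) x) * x)"
    unfolding sum_distrib_left
    by (subst sum.swap) (simp add: sum_distrib_right phi_sum A.phi_mult mult.assoc)
  also have "\<dots> = 0" using r A.phi_add[of 0 0] by simp
  finally have rel: "\<tau> (\<Sum>i\<le>k. \<phi>T (r i) * t ^ i) = 0" .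
  define m where "m = (LEAST i. r i \<noteq> 0)"
  have m: "r m \<noteq> 0" "\<And>i. i < m \<Longrightarrow> r i = 0"
    unfolding m_def using LeastI[of "\<lambda>i. r i \<noteq> 0", OF i(2)] by (auto dest: not_less_Least)
  have "m \<le> i" unfolding m_def using i(2) by (rule Least_le)
  then have mk: "m \<le> k" using i(1) by simp
  define y where "y = (\<Sum>i\<in>{Suc m..k}. \<phi>T (r i) * t ^ (i - Suc m))"
  have t_power: "t ^ n \<in> GT 0" for n using T.power_degree[OF t, of n] by simp
  have "\<phi>T a * t ^ n \<in> GT 0" for a n
    using T.mult_degree[OF T.phi_degree t_power] by simp
  then have y: "y \<in> GT 0" by (auto simp: y_def intro: T.sum_degree)
  have "(\<Sum>i\<le>k. \<phi>T (r i) * t ^ i) = (\<Sum>i\<in>{m..k}. \<phi>T (r i) * t ^ i)"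
    using m(2) T.phi_add[of 0 0] by (intro sum.mono_neutral_right) (auto simp: not_le)
  also have "\<dots> = \<phi>T (r m) * t ^ m + (\<Sum>i\<in>{Suc m..k}. \<phi>T (r i) * t ^ i)"
    by (rule sum.atLeast_Suc_atMost[OF mk])
  also have "(\<Sum>i\<in>{Suc m..k}. \<phi>T (r i) * t ^ i) = t ^ m * (t * y)"
  proof -
    have "t ^ i = t ^ m * (t * t ^ (i - Suc m))" if "i \<in> {Suc m..k}" for i
      using that by (simp flip: power_Suc power_add)
    then show ?thesis
      unfolding y_def sum_distrib_left by (intro sum.cong refl) (simp add: ac_simps)
  qed
  \<comment> \<open>so \<open>t (r\<^sub>m + t y)\<close> has nilpotent image\<close>
  finally have "\<tau> (t ^ m * (\<phi>T (r m) + t * y)) = 0"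
    using rel by (simp add: distrib_left mult.commute)
  then have "\<tau> (t ^ m * (\<phi>T (r m) + t * y)) * \<tau> (t * (\<phi>T (r m) + t * y) ^ m) = 0" by simp
  then have "\<tau> ((t * (\<phi>T (r m) + t * y)) ^ Suc m) = 0"
    by (simp add: power_mult_distrib ac_simps flip: tau_mult)
  from tau_reduced[OF this] have "\<tau> (t * \<phi>T (r m) + t * t * y) = 0"
    by (simp add: distrib_left mult.assoc)
  then have "\<tau> t * \<phi>A (r m) = - \<tau> (t * t * y)"
    by (simp add: tau_add tau_mult tau_phi eq_neg_iff_add_eq_0)
  then have "\<phi>A (r m) * \<tau> t = \<tau> (t * t * (- y))"
    by (simp add: A.phi_central tau_minus)
  moreover have "- y \<in> GT 0" using T.diff_degree[OF T.zero_in y] by simp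
  ultimately show thesis using that m(1) by blast
qed

text \<open>
  Up to a scalar \<open>s\<close>, a homogeneous monomial is a unit in the factor of \<open>A\<close> cut out by a
  central idempotent, and vanishes outside of that factor.  The power \<open>t\<^sup>n\<close> with \<open>n = |C|\<close> has degree zero,
  and the idempotent is the one generating the ideal of \<open>t\<^sup>n\<close>.
\<close>

lemma monomial_idempotent:
  assumes "v \<in> monomials d"
  obtains v' e s where "v' \<in> GA (- d)" and "e \<in> central0 GA" and "s \<noteq> 0"
    and "v * v' = e" and "v' * v = e" and "e * e = \<phi>A s * e" and "e * v = \<phi>A s * v"
proof -
  obtain t w c where t: "t \<in> GT c" and v: "v = \<tau> t * \<omega> w" and d: "d = c + \<nu> w"
    using assms unfolding monomials_def by blast
  define n where "n = card (UNIV :: 'c set)"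
  have "n > 0" by (simp add: n_def card_gt_0_iff)
  then obtain k where k: "n = Suc k" by (cases n) auto
  have c0: "(\<Sum>i<n. c) = 0" unfolding n_def by (rule card_multiple_eq_0)
  then have ck: "(\<Sum>i<k. c) = - c" by (simp add: k eq_neg_iff_add_eq_0)
  have tn: "t ^ n \<in> GT 0" using T.power_degree[OF t, of n] c0 by simp
  have tk: "t ^ k \<in> GT (- c)" using T.power_degree[OF t, of k] ck by simp
  obtain s y where s: "s \<noteq> 0" and y: "y \<in> GT 0" and reg: "\<phi>A s * \<tau> (t ^ n) = \<tau> (t ^ n * t ^ n * y)"
    by (rule von_neumann_regular[OF tn])
  define e where "e = \<tau> (t ^ n * y)"
  define v' where "v' = \<omega> (- w) * \<tau> (t ^ k * y)"
  have e: "e \<in> central0 GA"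
    unfolding e_def using T.mult_degree[OF tn y] by (intro tau_central0) simp
  have ec: "e * a = a * e" for a using e by (simp add: central0_def)
  have "(t ^ n * y - \<phi>T s) * t ^ n = t ^ n * t ^ n * y - \<phi>T s * t ^ n"
    by (simp add: algebra_simps)
  then have "\<tau> ((t ^ n * y - \<phi>T s) * t ^ n) = 0"
    by (simp add: tau_diff tau_mult[of "\<phi>T s"] tau_phi reg)
  then have "\<tau> ((t ^ n * y - \<phi>T s) * t ^ n) * \<tau> ((t ^ n * y - \<phi>T s) ^ k) = 0" by simp
  then have "\<tau> (((t ^ n * y - \<phi>T s) * t) ^ Suc k) = 0"
    by (simp add: power_mult_distrib ac_simps k flip: tau_mult)
  from tau_reduced[OF this] have et: "e * \<tau> t = \<phi>A s * \<tau> t"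
    by (simp add: left_diff_distrib tau_diff e_def tau_mult tau_phi)
  show thesis
  proof (rule that[of v' e s])
    have "- d = \<nu> (- w) + (- c + 0)" by (simp add: d nu_minus)
    then show "v' \<in> GA (- d)"
      using A.mult_degree[OF omega_degree tau_degree[OF T.mult_degree[OF tk y]], of "- w"]
      by (simp only: v'_def)
    show "e \<in> central0 GA" "s \<noteq> 0" by fact+
    have 1: "v * v' = \<tau> t * (\<omega> w * \<omega> (- w)) * \<tau> (t ^ k * y)"
      by (simp add: v v'_def mult.assoc)
    then show "v * v' = e"
      by (simp add: omega_inverse e_def k mult.assoc flip: tau_mult)
    have "v' * v = \<omega> (- w) * (\<tau> (t ^ k * y) * \<tau> t) * \<omega> w"
      by (simp add: v v'_def mult.assoc)
    also have "\<tau> (t ^ k * y) * \<tau> t = e"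
      by (simp add: e_def k ac_simps flip: tau_mult)
    also have "\<omega> (- w) * e * \<omega> w = e * (\<omega> (- w) * \<omega> w)"
      by (metis ec mult.assoc)
    finally show "v' * v = e" by (simp add: omega_inverse)
    show "e * v = \<phi>A s * v" using et by (simp add: v flip: mult.assoc)
    have "e * e = e * \<tau> t * \<tau> (t ^ k * y)"
      by (simp add: e_def k ac_simps flip: tau_mult)
    also have "\<dots> = \<phi>A s * e"
      unfolding et by (simp add: e_def k mult.assoc flip: tau_mult)
    finally show "e * e = \<phi>A s * e" .
  qed
qed

end

lemma (in graded_alg) central0_closed:
  assumes "x \<in> central0 G" and "y \<in> central0 G"
  shows "x * y \<in> central0 G" and "x - y \<in> central0 G"
proof -
  have xy: "x \<in> G 0" "y \<in> G 0" "\<And>a. x * a = a * x" "\<And>a. y * a = a * y"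
    using assms unfolding central0_def by blast+
  have "x * y * a = a * (x * y)" for a by (metis mult.assoc xy(3,4))
  moreover have "(x - y) * a = a * (x - y)" for a
    using xy(3)[of a] xy(4)[of a] by (simp add: left_diff_distrib right_diff_distrib)
  ultimately show "x * y \<in> central0 G" "x - y \<in> central0 G"
    using mult_degree[OF xy(1,2)] diff_degree[OF xy(1,2)] by (simp_all add: central0_def)
qed

lemma (in graded_alg) phi_central0: "\<phi> r \<in> central0 G"
  unfolding central0_def using phi_degree phi_central by blast

text \<open>
  Let \<open>e x\<close> be \<open>s x\<close> times a central idempotent.  The elements \<open>P S\<close> are, up to the common
  factor \<open>\<Prod>s\<close>, orthogonal idempotents with sum \<open>1\<close>, and \<open>S\<close> is the set of those \<open>x\<close> for
  which \<open>e x / s x\<close> is \<open>1\<close> (and not \<open>0\<close>) on the part cut out by \<open>P S\<close>.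
\<close>

definition (in graded_alg) partition_of_unity ::
    "'x set \<Rightarrow> ('x \<Rightarrow> 'a) \<Rightarrow> ('x \<Rightarrow> 'r) \<Rightarrow> ('x set \<Rightarrow> 'a) \<Rightarrow> bool" where
  "partition_of_unity X e s P \<longleftrightarrow>
    (\<forall>S\<subseteq>X. P S \<in> central0 G) \<and> (\<Sum>S\<in>Pow X. P S) = \<phi> (prod s X) \<and>
    (\<forall>S\<subseteq>X. \<forall>S'\<subseteq>X. S \<noteq> S' \<longrightarrow> P S * P S' = 0) \<and>
    (\<forall>S\<subseteq>X. P S * P S = \<phi> (prod s X) * P S) \<and>
    (\<forall>S\<subseteq>X. \<forall>x\<in>X. P S * e x = (if x \<in> S then \<phi> (s x) * P S else 0))"

lemma (in graded_alg) partition_of_unityD: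
  assumes "partition_of_unity X e s P"
  shows "S \<subseteq> X \<Longrightarrow> P S \<in> central0 G" and "(\<Sum>S\<in>Pow X. P S) = \<phi> (prod s X)"
    and "S \<subseteq> X \<Longrightarrow> S' \<subseteq> X \<Longrightarrow> S \<noteq> S' \<Longrightarrow> P S * P S' = 0"
    and "S \<subseteq> X \<Longrightarrow> P S * P S = \<phi> (prod s X) * P S"
    and "S \<subseteq> X \<Longrightarrow> x \<in> X \<Longrightarrow> P S * e x = (if x \<in> S then \<phi> (s x) * P S else 0)"
  using assms by (simp_all add: partition_of_unity_def)

lemma (in graded_alg) partition_of_unityI:
  assumes "\<And>S. S \<subseteq> X \<Longrightarrow> P S \<in> central0 G" and "(\<Sum>S\<in>Pow X. P S) = \<phi> (prod s X)"
    and "\<And>S S'. S \<subseteq> X \<Longrightarrow> S' \<subseteq> X \<Longrightarrow> S \<noteq> S' \<Longrightarrow> P S * P S' = 0"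
    and "\<And>S. S \<subseteq> X \<Longrightarrow> P S * P S = \<phi> (prod s X) * P S"
    and "\<And>S x. S \<subseteq> X \<Longrightarrow> x \<in> X \<Longrightarrow> P S * e x = (if x \<in> S then \<phi> (s x) * P S else 0)"
  shows "partition_of_unity X e s P"
  unfolding partition_of_unity_def by (intro conjI allI impI ballI; rule assms; assumption)

lemma (in graded_alg) partition_of_unity_exists:
  assumes "finite X" and "\<And>x. x \<in> X \<Longrightarrow> e x \<in> central0 G"
    and "\<And>x. x \<in> X \<Longrightarrow> e x * e x = \<phi> (s x) * e x"
  shows "\<exists>P. partition_of_unity X e s P"
  using assms
proof (induction X rule: finite_induct)
  case empty
  show ?case
    by (rule exI[of _ "\<lambda>_. 1"]) (use phi_central0[of 1] in \<open>simp add: partition_of_unity_def phi_1\<close>)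
next
  case (insert x X)
  obtain P where "partition_of_unity X e s P" using insert.IH insert.prems by blast
  note P = partition_of_unityD(1)[OF this] and sum = partition_of_unityD(2)[OF this]
    and orth = partition_of_unityD(3)[OF this] and idem = partition_of_unityD(4)[OF this]
    and Pe = partition_of_unityD(5)[OF this]
  \<comment> \<open>the new idempotent and its complement, both multiplied by \<open>s x\<close>\<close>
  define E where "E b = (if b then e x else \<phi> (s x) - e x)" for b
  have Ec: "E b \<in> central0 G" for b
    using insert.prems(1)[of x] central0_closed(2) phi_central0 by (simp add: E_def)
  have E_comm: "E b * a = a * E b" for a b using Ec[of b] unfolding central0_def by blast
  have ee: "e x * e x = \<phi> (s x) * e x" using insert.prems(2)[of x] by simp
  have E_idem: "E b * E b = \<phi> (s x) * E b" for b
    using ee phi_central[of "s x" "e x"] by (simp add: E_def left_diff_distrib right_diff_distrib)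
  have E_orth: "E b * E b' = 0" if "b \<noteq> b'" for b b'
    using ee phi_central[of "s x" "e x"] that
    by (cases b; cases b') (simp_all add: E_def left_diff_distrib right_diff_distrib)
  have E_e: "E b * e x = (if b then \<phi> (s x) * E b else 0)" for b
    using ee by (simp add: E_def left_diff_distrib)
  define P' where "P' S = P (S - {x}) * E (x \<in> S)" for S
  have sub: "S - {x} \<subseteq> X" if "S \<subseteq> insert x X" for S using that by blast
  have prod: "P' S * P' S' = P (S - {x}) * P (S' - {x}) * (E (x \<in> S) * E (x \<in> S'))" for S S'
    using E_comm[of "x \<in> S" "P (S' - {x})"] unfolding P'_def by (metis mult.assoc)
  have 1: "P' S \<in> central0 G" if "S \<subseteq> insert x X" for S
    unfolding P'_def by (rule central0_closed(1)[OF P[OF sub[OF that]] Ec])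
  have 2: "(\<Sum>S\<in>Pow (insert x X). P' S) = \<phi> (prod s (insert x X))"
  proof -
    have inj: "inj_on (insert x) (Pow X)"
      using insert.hyps(2) unfolding inj_on_def by (metis PowD insert_ident subsetD)
    have "Pow X \<inter> insert x ` Pow X = {}" using insert.hyps(2) by auto
    then have "(\<Sum>S\<in>Pow (insert x X). P' S) = (\<Sum>S\<in>Pow X. P' S) + (\<Sum>S\<in>insert x ` Pow X. P' S)"
      unfolding Pow_insert using insert.hyps(1) by (intro sum.union_disjoint) auto
    also have "(\<Sum>S\<in>insert x ` Pow X. P' S) = (\<Sum>S\<in>Pow X. P' (insert x S))"
      by (simp add: sum.reindex[OF inj])
    also have "(\<Sum>S\<in>Pow X. P' S) + (\<Sum>S\<in>Pow X. P' (insert x S)) = (\<Sum>S\<in>Pow X. P S * \<phi> (s x))"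
      unfolding sum.distrib[symmetric]
    proof (rule sum.cong[OF refl])
      fix S assume "S \<in> Pow X"
      then have "x \<notin> S" using insert.hyps(2) by blast
      then show "P' S + P' (insert x S) = P S * \<phi> (s x)"
        by (simp add: P'_def E_def flip: distrib_left)
    qed
    also have "\<dots> = \<phi> (prod s (insert x X))"
      using insert.hyps by (simp add: sum phi_mult mult.commute[of "s x"] flip: sum_distrib_right)
    finally show ?thesis .
  qed
  have 3: "P' S * P' S' = 0" if S: "S \<subseteq> insert x X" "S' \<subseteq> insert x X" "S \<noteq> S'" for S S'
  proof (cases "S - {x} = S' - {x}")
    case True
    then have "(x \<in> S) \<noteq> (x \<in> S')" using S(3) by blast
    then show ?thesis by (simp add: prod E_orth)
  next
    case False
    then show ?thesis using orth[OF sub[OF S(1)] sub[OF S(2)]] by (simp add: prod)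
  qed
  have 4: "P' S * P' S = \<phi> (prod s (insert x X)) * P' S" if S: "S \<subseteq> insert x X" for S
  proof -
    have "P' S * P' S = \<phi> (prod s X) * P (S - {x}) * (\<phi> (s x) * E (x \<in> S))"
      unfolding prod idem[OF sub[OF S]] E_idem ..
    also have "\<dots> = \<phi> (s x) * \<phi> (prod s X) * P' S"
      unfolding P'_def by (metis mult.assoc phi_central)
    finally show ?thesis using insert.hyps by (simp add: phi_mult)
  qed
  have 5: "P' S * e y = (if y \<in> S then \<phi> (s y) * P' S else 0)"
    if S: "S \<subseteq> insert x X" and y: "y \<in> insert x X" for S y
  proof (cases "y = x")
    case True
    have "P' S * e x = P (S - {x}) * (E (x \<in> S) * e x)" by (simp add: P'_def mult.assoc)
    also have "\<dots> = (if x \<in> S then \<phi> (s x) * P' S else 0)"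
    proof -
      have "P (S - {x}) * (\<phi> (s x) * E (x \<in> S)) = \<phi> (s x) * P' S"
        unfolding P'_def by (metis mult.assoc phi_central)
      then show ?thesis by (cases "x \<in> S") (simp_all add: E_e)
    qed
    finally show ?thesis using True by simp
  next
    case False
    then have yX: "y \<in> X" using y by blast
    have "P' S * e y = P (S - {x}) * e y * E (x \<in> S)"
      unfolding P'_def by (metis mult.assoc E_comm)
    then show ?thesis
      using False by (simp add: Pe[OF sub[OF S] yX] P'_def mult.assoc)
  qed
  have "partition_of_unity (insert x X) e s P'"
    by (rule partition_of_unityI) (fact 1 2 3 4 5)+
  then show ?case by (rule exI[of _ P'])
qed

context reduced_group_algebra_quotient
begin

text \<open>
  Over the field of fractions of \<open>R\<close>, the algebra \<open>A\<close> is a finite product of algebras in which every graded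
  piece is zero or contains a unit.
\<close>

lemma central_decomposition:
  obtains K :: "'a set set" and P :: "'a set \<Rightarrow> 'a" and q :: 'r
  where "finite K" and "q \<noteq> 0" and "\<And>k. k \<in> K \<Longrightarrow> P k \<in> central0 GA" and "(\<Sum>k\<in>K. P k) = \<phi>A q"
    and "\<And>k k'. k \<in> K \<Longrightarrow> k' \<in> K \<Longrightarrow> k \<noteq> k' \<Longrightarrow> P k * P k' = 0"
    and "\<And>k. k \<in> K \<Longrightarrow> P k * P k = \<phi>A q * P k"
    and "\<And>k d. k \<in> K \<Longrightarrow> unit_degree \<phi>A GA (P k) d \<or> null_degree \<phi>A GA (P k) d"
proof -
  obtain X where X: "finite X" "X \<subseteq> (\<Union>d. monomials d)"
    and span: "\<And>a. \<exists>f. a = (\<Sum>x\<in>X. \<phi>A (f x) * x)"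
    by (rule finite_spanning_monomials[OF fg]) blast
  define inverse_up_to where "inverse_up_to x d v' e s \<longleftrightarrow>
      x \<in> monomials d \<and> v' \<in> GA (- d) \<and> e \<in> central0 GA \<and> s \<noteq> 0 \<and>
      x * v' = e \<and> v' * x = e \<and> e * e = \<phi>A s * e \<and> e * x = \<phi>A s * x" for x d v' e s
  have "\<exists>d v' e s. inverse_up_to x d v' e s" if "x \<in> X" for x
  proof -
    obtain d where d: "x \<in> monomials d" using X(2) \<open>x \<in> X\<close> by blast
    show ?thesis
      unfolding inverse_up_to_def by (rule monomial_idempotent[OF d]) (use d in blast)
  qed
  then obtain deg v' e s where *: "\<And>x. x \<in> X \<Longrightarrow> inverse_up_to x (deg x) (v' x) (e x) (s x)"
    by metis
  have mon: "x \<in> monomials (deg x)" and v': "v' x \<in> GA (- deg x)" and e: "e x \<in> central0 GA"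
    and s: "s x \<noteq> 0" and inv: "x * v' x = e x" "v' x * x = e x"
    and ee: "e x * e x = \<phi>A (s x) * e x" and ex: "e x * x = \<phi>A (s x) * x" if "x \<in> X" for x
    using *[OF that] unfolding inverse_up_to_def by blast+
  have X_degree: "x \<in> GA (deg x)" if "x \<in> X" for x using mon[OF that] monomials_degree by blast
  have "\<exists>P. A.partition_of_unity X e s P" by (rule A.partition_of_unity_exists[OF X(1)]) (fact e ee)+
  then obtain P where "A.partition_of_unity X e s P" ..
  note P = A.partition_of_unityD[OF this]
  show thesis
  proof (rule that[of "Pow X" "prod s X" P])
    show "finite (Pow X)" "prod s X \<noteq> 0" using X(1) s by auto
    show "unit_degree \<phi>A GA (P S) d \<or> null_degree \<phi>A GA (P S) d" if "S \<in> Pow X" for S d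
    proof (cases "\<exists>x\<in>S. deg x = d")
      case True
      then obtain x where x: "x \<in> S" "x \<in> X" "deg x = d" using \<open>S \<in> Pow X\<close> by blast
      have "e x * P S = P S * e x" using e[OF x(2)] unfolding central0_def by blast
      then have "e x * P S = \<phi>A (s x) * P S" using P(5)[of S x] x \<open>S \<in> Pow X\<close> by simp
      then show ?thesis
        unfolding unit_degree_def using x X_degree v' s inv by metis
    next
      case False
      have "null_degree \<phi>A GA (P S) d"
        unfolding null_degree_def
      proof
        fix a assume a: "a \<in> GA d"
        obtain f where f: "a = (\<Sum>x\<in>X. \<phi>A (f x) * x)" using span by blast
        have "a = component GA d (\<Sum>x\<in>X. \<phi>A (f x) * x)"
          using A.component_homogeneous[OF a, of d] f by simp
        also have "\<dots> = (\<Sum>x\<in>X. component GA d (\<phi>A (f x) * x))"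
          by (rule A.component_sum)
        also have "\<dots> = (\<Sum>x\<in>X. if deg x = d then \<phi>A (f x) * x else 0)"
        proof (rule sum.cong[OF refl])
          fix x assume "x \<in> X"
          then have "\<phi>A (f x) * x \<in> GA (deg x)"
            using A.mult_degree[OF A.phi_degree X_degree] by simp
          then show "component GA d (\<phi>A (f x) * x) = (if deg x = d then \<phi>A (f x) * x else 0)"
            using A.component_homogeneous by auto
        qed
        finally have a_sum: "a = (\<Sum>x\<in>X. if deg x = d then \<phi>A (f x) * x else 0)" .
        have "\<phi>A (prod s X) * (P S * (\<phi>A (f x) * x)) = 0" if x: "x \<in> X" "deg x = d" for x
        proof -
          have "x \<notin> S" using False x by blast
          then have "P S * e x = 0" using P(5)[of S x] x \<open>S \<in> Pow X\<close> by simp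
          then have "P S * (\<phi>A (s x) * x) = 0"
            by (metis ex[OF x(1)] mult.assoc mult_zero_left)
          moreover have "prod s X = prod s (X - {x}) * s x"
            by (simp add: prod.remove[OF X(1) x(1)] mult.commute)
          then have "\<phi>A (prod s X) * (P S * (\<phi>A (f x) * x)) =
              \<phi>A (prod s (X - {x})) * \<phi>A (f x) * (P S * (\<phi>A (s x) * x))"
            by (metis A.phi_mult A.phi_central mult.assoc)
          ultimately show ?thesis by simp
        qed
        then have "\<phi>A (prod s X) * (P S * a) = 0"
          unfolding a_sum sum_distrib_left by (intro sum.neutral) auto
        then show "\<exists>s. s \<noteq> 0 \<and> \<phi>A s * (P S * a) = 0"
          using X(1) s by (intro exI[of _ "prod s X"]) auto
      qed
      then show ?thesis ..
    qed
  qed (use P in auto)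
qed

end

section \<open>The involution on the quotient\<close>

context group_algebra_quotient
begin

lemma induced_involution:
  assumes inv: "involution \<phi>T GT \<iota>"
    and \<iota>A: "\<forall>f. \<iota>A (\<pi> f) = \<pi> (group_algebra_involution \<iota> f)"
  shows induced_involution_add: "\<iota>A (a + b) = \<iota>A a + \<iota>A b"
    and induced_involution_mult: "\<iota>A (a * b) = \<iota>A b * \<iota>A a"
    and induced_involution_scale: "\<iota>A (\<phi>A r * a) = \<phi>A r * \<iota>A a"
    and induced_involution_1: "\<iota>A 1 = 1"
    and induced_involution_degree: "a \<in> GA d \<Longrightarrow> \<iota>A a \<in> GA (- d)"
proof -
  have \<iota>_add: "\<iota> (x + y) = \<iota> x + \<iota> y" and \<iota>_scale: "\<iota> (\<phi>T r * x) = \<phi>T r * \<iota> x"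
    and \<iota>\<iota>: "\<iota> (\<iota> x) = x" and \<iota>_mult: "\<iota> (x * y) = \<iota> y * \<iota> x"
    and \<iota>_degree: "x \<in> GT c \<Longrightarrow> \<iota> x \<in> GT (- c)" for x y r c
    using inv unfolding involution_def by blast+
  have "\<iota> 0 + \<iota> 0 = \<iota> 0 + 0" using \<iota>_add[of 0 0] by simp
  then have \<iota>_0: "\<iota> 0 = 0" by (rule add_left_imp_eq)
  have \<iota>_1: "\<iota> 1 = 1" using \<iota>_mult[of "\<iota> 1" 1] by (simp add: \<iota>\<iota>)
  have \<iota>_phi: "\<iota> (\<phi>T r) = \<phi>T r" for r using \<iota>_scale[of r 1] by (simp add: \<iota>_1)
  have superset: "group_algebra_involution \<iota> f =
      (\<Sum>w\<in>S. Poly_Mapping.single (- w) (\<iota> (Poly_Mapping.lookup f w)))"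
    if "finite S" "Poly_Mapping.keys f \<subseteq> S" for f :: "'w \<Rightarrow>\<^sub>0 't" and S
    unfolding group_algebra_involution_def
    by (rule sum.mono_neutral_left) (use that in \<open>auto simp: \<iota>_0 in_keys_iff\<close>)
  have gi_add: "group_algebra_involution \<iota> (f + g) =
      group_algebra_involution \<iota> f + group_algebra_involution \<iota> g" for f g :: "'w \<Rightarrow>\<^sub>0 't"
  proof -
    let ?S = "Poly_Mapping.keys f \<union> Poly_Mapping.keys g"
    have "Poly_Mapping.keys (f + g) \<subseteq> ?S" by (rule keys_add)
    then show ?thesis
      by (simp add: superset[of ?S] lookup_add \<iota>_add single_add sum.distrib)
  qed
  have gi_single: "group_algebra_involution \<iota> (Poly_Mapping.single w t) = Poly_Mapping.single (- w) (\<iota> t)"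
    for w :: 'w and t
    by (subst superset[of "{w}"]) auto
  have pi_single: "\<iota>A (\<pi> (Poly_Mapping.single w t)) = \<pi> (Poly_Mapping.single (- w) (\<iota> t))" for w t
    using \<iota>A gi_single by simp
  show add: "\<iota>A (a + b) = \<iota>A a + \<iota>A b" for a b
  proof -
    obtain f g where "a = \<pi> f" "b = \<pi> g" using surj by (metis surjD)
    then show ?thesis using \<iota>A gi_add by (simp flip: pi_add)
  qed
  have "\<iota>A 0 + \<iota>A 0 = \<iota>A 0 + 0" using add[of 0 0] by simp
  then have "\<iota>A 0 = 0" by (rule add_left_imp_eq)
  then have sum: "\<iota>A (sum f I) = (\<Sum>i\<in>I. \<iota>A (f i))" for f :: "'x \<Rightarrow> 'a" and I
    by (induction I rule: infinite_finite_induct) (auto simp: add)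
  have mult_single: "\<iota>A (\<pi> (Poly_Mapping.single v s) * \<pi> (Poly_Mapping.single w t)) =
      \<iota>A (\<pi> (Poly_Mapping.single w t)) * \<iota>A (\<pi> (Poly_Mapping.single v s))" for v w s t
    by (simp add: pi_single mult_single \<iota>_mult minus_add flip: pi_mult)
  show mult: "\<iota>A (a * b) = \<iota>A b * \<iota>A a" for a b
  proof -
    obtain f g where fg: "a = \<pi> f" "b = \<pi> g" using surj by (metis surjD)
    define F where "F h w = \<pi> (Poly_Mapping.single w (Poly_Mapping.lookup h w))" for h w
    have ab: "a = (\<Sum>w\<in>Poly_Mapping.keys f. F f w)" "b = (\<Sum>w\<in>Poly_Mapping.keys g. F g w)"
      by (simp_all add: fg F_def poly_mapping_sum_single flip: pi_sum)
    have "\<iota>A (F f v * F g w) = \<iota>A (F g w) * \<iota>A (F f v)" for v w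
      unfolding F_def by (rule mult_single)
    then show ?thesis
      unfolding ab by (simp add: sum sum_product) (rule sum.swap)
  qed
  have \<iota>A_phi: "\<iota>A (\<phi>A r) = \<phi>A r" for r
    using pi_single[of 0 "\<phi>T r"] by (simp add: \<iota>_phi flip: \<tau>_def tau_phi)
  show "\<iota>A (\<phi>A r * a) = \<phi>A r * \<iota>A a" for r a
    by (simp add: mult \<iota>A_phi A.phi_central)
  show "\<iota>A 1 = 1" using \<iota>A_phi[of 1] by (simp add: A.phi_1)
  have monomial: "\<iota>A m \<in> GA (- d)" if "m \<in> monomials d" for m d
  proof -
    obtain t w c where t: "t \<in> GT c" "m = \<tau> t * \<omega> w" "c + \<nu> w = d"
      using \<open>m \<in> monomials d\<close> unfolding monomials_def by blast
    have "\<iota>A m = \<pi> (Poly_Mapping.single (- w) (\<iota> t))"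
      unfolding t(2) pi_single[symmetric] by (simp add: group_algebra_quotient.pi_single[OF group_algebra_quotient_axioms])
    also have "\<dots> = \<tau> (\<iota> t) * \<omega> (- w)" by (rule group_algebra_quotient.pi_single[OF group_algebra_quotient_axioms])
    also have "\<dots> \<in> GA (- c + \<nu> (- w))"
      by (rule A.mult_degree[OF tau_degree[OF \<iota>_degree[OF t(1)]] omega_degree])
    also have "- c + \<nu> (- w) = - d" using t(3) by (auto simp: nu_minus)
    finally show ?thesis .
  qed
  show "\<iota>A a \<in> GA (- d)" if a: "a \<in> GA d" for a d
  proof -
    obtain f where f: "a = \<pi> f" using surj by (metis surjD)
    let ?I = "Poly_Mapping.keys f \<times> (UNIV :: 'c set)"
    define m where "m = (\<lambda>(w, c). \<tau> (component GT c (Poly_Mapping.lookup f w)) * \<omega> w)"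
    define e where "e = (\<lambda>(w, c). c + \<nu> w)"
    have m: "m i \<in> monomials (e i)" for i
      by (cases i) (simp add: m_def e_def component_monomial)
    have "a = component GA d (\<Sum>i\<in>?I. m i)"
      using A.component_homogeneous[OF a, of d] by (simp add: f sum_of_monomials m_def)
    also have "\<dots> = (\<Sum>i\<in>?I. component GA d (m i))" by (rule A.component_sum)
    also have "\<dots> = (\<Sum>i\<in>?I. if e i = d then m i else 0)"
    proof (rule sum.cong[OF refl])
      fix i
      have "m i \<in> GA (e i)" using m monomials_degree by blast
      then show "component GA d (m i) = (if e i = d then m i else 0)"
        by (auto simp: A.component_homogeneous)
    qed
    finally have "\<iota>A a = (\<Sum>i\<in>?I. \<iota>A (if e i = d then m i else 0))"
      unfolding sum[symmetric] by (rule arg_cong)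
    also have "\<dots> \<in> GA (- d)"
      using monomial m A.zero_in \<open>\<iota>A 0 = 0\<close> by (intro A.sum_degree) auto
    finally show ?thesis .
  qed
qed

end

section \<open>Polarisability and self-duality\<close>

context graded_setting
begin

lemma finitely_generated_graded_pieces:
  assumes fg: "finitely_generated (\<lambda>r a. \<phi> r * a)"
  shows "finitely_generated_submodule UNIV" and "finitely_generated_submodule (GM c)"
proof -
  interpret m: module "\<lambda>r x. act (\<phi> r) x" by (rule module_act)
  obtain S where S: "finite S" "\<And>a. \<exists>f. a = (\<Sum>s\<in>S. \<phi> (f s) * s)"
    using fg unfolding finitely_generated_def by blast
  obtain T where T: "finite T" "\<And>x. \<exists>f. x = (\<Sum>t\<in>T. act (f t) t)"
    using graded_module unfolding graded_module_def finitely_generated_def by blast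
  define G where "G = (\<lambda>(s, t). act s t) ` (S \<times> T)"
  have finG: "finite G" using S(1) T(1) by (simp add: G_def)
  have span: "x \<in> m.span G" for x
  proof -
    obtain f where x: "x = (\<Sum>t\<in>T. act (f t) t)" using T(2) by blast
    have "act (f t) t \<in> m.span G" if t: "t \<in> T" for t
    proof -
      obtain g where "f t = (\<Sum>s\<in>S. \<phi> (g s) * s)" using S(2) by blast
      then have "act (f t) t = (\<Sum>s\<in>S. act (\<phi> (g s)) (act s t))"
        by (simp add: act_sum_left act_mult)
      also have "\<dots> \<in> m.span G"
        using t by (intro m.span_sum m.span_scale m.span_base) (auto simp: G_def)
      finally show ?thesis .
    qed
    then show ?thesis unfolding x by (rule m.span_sum)
  qed
  then have gen: "\<exists>f. x = (\<Sum>g\<in>G. act (\<phi> (f g)) g)" for x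
    using span[of x] unfolding m.span_finite[OF finG] by auto
  then show "finitely_generated_submodule UNIV"
    unfolding finitely_generated_submodule_def using finG submodule_UNIV by blast
  let ?G = "comp c ` G"
  have "\<exists>f. n = (\<Sum>g\<in>?G. act (\<phi> (f g)) g)" if n: "n \<in> GM c" for n
  proof -
    obtain f where "n = (\<Sum>g\<in>G. act (\<phi> (f g)) g)" using gen by blast
    then have "n = (\<Sum>g\<in>G. act (\<phi> (f g)) (comp c g))"
      using gM.component_homogeneous[OF n, of c]
      by (metis (no_types, lifting) comp_act_0[OF gA.phi_degree] gM.component_sum sum.cong)
    also have "\<dots> \<in> m.span ?G" by (intro m.span_sum m.span_scale m.span_base) auto
    finally show ?thesis unfolding m.span_finite[OF finite_imageI[OF finG]] by auto
  qed
  then show "finitely_generated_submodule (GM c)"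
    unfolding finitely_generated_submodule_def
    using finG GM_submodule comp_in by (intro conjI exI[of _ ?G]) auto
qed

text \<open>A polarisation restricts to non-degenerate forms on the graded pieces.\<close>

lemma restricted_form:
  assumes bil: "bilinear_on UNIV b" and nd: "nondegenerate_on UNIV b"
    and orth: "\<And>c c' x y. c \<noteq> c' \<Longrightarrow> x \<in> GM c \<Longrightarrow> y \<in> GM c' \<Longrightarrow> b x y = 0"
  shows "bilinear_on (GM c) b" and "nondegenerate_on (GM c) b"
proof -
  have left: "functional UNIV (b x)" and right: "functional UNIV (\<lambda>x. b x y)" for x y
    using bil by (auto simp: bilinear_on_def)
  show "bilinear_on (GM c) b" using bil by (auto simp: bilinear_on_def functional_def)
  have only_c: "(\<Sum>e\<in>UNIV. f e) = f c" if "\<And>e. e \<noteq> c \<Longrightarrow> f e = 0" for f :: "'c \<Rightarrow> 'l"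
    using that sum.mono_neutral_right[of UNIV "{c}" f] by auto
  have proj_right: "b x y = b x (comp c y)" if x: "x \<in> GM c" for x y
    unfolding functional_comp_sum[OF left, of x y]
    by (rule only_c) (use orth[OF _ x comp_in] in auto)
  have proj_left: "b x y = b (comp c x) y" if y: "y \<in> GM c" for x y
    unfolding functional_comp_sum[OF right, of x y]
    by (rule only_c) (use orth[OF _ comp_in y] in auto)
  show "nondegenerate_on (GM c) b"
    unfolding nondegenerate_on_def
  proof (intro ballI allI impI)
    fix u g
    assume "u \<in> formal (GM c)" and g: "functional (GM c) g"
    then have u: "Poly_Mapping.keys u \<subseteq> UNIV \<times> GM c" by simp
    assume ker: "(\<forall>y\<in>GM c. tensor_eval (\<lambda>x. b x y) u = 0) \<or> (\<forall>x\<in>GM c. tensor_eval (b x) u = 0)"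
    have "tensor_eval (\<lambda>x. b x y) u = tensor_eval (\<lambda>x. b x (comp c y)) u" for y
      by (rule tensor_eval_cong[OF u]) (rule proj_right)
    moreover have "tensor_eval (b x) u = tensor_eval (b (comp c x)) u" for x
      by (rule tensor_eval_cong[OF u]) (rule proj_left)
    ultimately have ker': "(\<forall>y\<in>UNIV. tensor_eval (\<lambda>x. b x y) u = 0) \<or> (\<forall>x\<in>UNIV. tensor_eval (b x) u = 0)"
      using ker comp_in by metis
    have "functional UNIV (\<lambda>x. g (comp c x))"
      using functional_act_comp[OF g gA.one_degree, of c] by (simp add: act_1)
    then have "tensor_eval (\<lambda>x. g (comp c x)) u = 0"
      by (intro nondegenerate_onD[OF nd _ ker']) auto
    moreover have "tensor_eval (\<lambda>x. g (comp c x)) u = tensor_eval g u"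
      by (rule tensor_eval_cong[OF u]) (simp add: gM.component_homogeneous)
    ultimately show "tensor_eval g u = 0" by simp
  qed
qed

end

theorem proposition3p13:
  fixes \<phi>T :: "'r::idom \<Rightarrow> 't::{comm_ring,comm_monoid_mult}"
    and GT :: "'c::{finite,ab_group_add} \<Rightarrow> 't set"
    and \<iota> :: "'t \<Rightarrow> 't"
    and \<nu> :: "'w::group_add \<Rightarrow> 'c"
    and \<phi>A :: "'r \<Rightarrow> 'a::{ring,monoid_mult}"
    and GA :: "'c \<Rightarrow> 'a set"
    and \<pi> :: "('w \<Rightarrow>\<^sub>0 't) \<Rightarrow> 'a"
    and \<iota>A :: "'a \<Rightarrow> 'a"
    and act :: "'a \<Rightarrow> 'm::ab_group_add \<Rightarrow> 'm"
    and GM :: "'c \<Rightarrow> 'm set"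
    and j :: "'r fract \<Rightarrow> 'l::field"
  assumes "noetherian TYPE('r)"
    and "graded_algebra \<phi>T GT"
    and "involution \<phi>T GT \<iota>"
    and "\<forall>v w. \<nu> (v + w) = \<nu> v + \<nu> w"
    and "graded_algebra \<phi>A GA"
    and "finitely_generated (\<lambda>r a. \<phi>A r * a)"
    and "group_algebra_hom \<phi>T \<phi>A \<pi>"
    and "surj \<pi>"
    and "\<forall>c. \<pi> ` group_algebra_grading GT \<nu> c \<subseteq> GA c"
    and "reduced (range (\<lambda>t. \<pi> (Poly_Mapping.single 0 t)))"
    and "\<forall>f. \<iota>A (\<pi> f) = \<pi> (group_algebra_involution \<iota> f)"
    and "graded_module \<phi>A GA act GM"
    and "torsion_free (\<lambda>r m. act (\<phi>A r) m)"
    and "ring_homomorphism j"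
  shows "polarisable (\<lambda>r. j (Fract r 1)) \<phi>A \<iota>A act GM \<longleftrightarrow>
         (\<forall>c. self_dual_base_change (\<lambda>r. j (Fract r 1)) \<phi>A \<iota>A (GA 0) act (GM c))"
proof -
  let ?\<rho> = "\<lambda>r. j (Fract r 1)"
  interpret Q: reduced_group_algebra_quotient \<phi>T GT \<phi>A GA \<nu> \<pi>
    using assms by unfold_locales auto
  note induced = Q.induced_involution[OF assms(3) assms(11)]
  have j: "j (x + y) = j x + j y" "j (x * y) = j x * j y" "j 1 = 1" for x y
    using assms(14) by (auto simp: ring_homomorphism_def)
  have \<rho>: "ring_homomorphism ?\<rho>"
    unfolding ring_homomorphism_def
    by (simp add: j flip: j(1,2) One_fract_def)
  have \<rho>_0: "r = 0" if "?\<rho> r = 0" for r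
  proof (rule ccontr)
    assume "r \<noteq> 0"
    then have "Fract r 1 * Fract 1 r = 1" by (simp add: One_fract_def eq_fract)
    then have "?\<rho> r * j (Fract 1 r) = 1" by (simp add: j(3) flip: j(2))
    then show False using that by simp
  qed
  interpret S: graded_setting ?\<rho> \<phi>A act GA GM \<iota>A
    using assms(5,12,13) \<rho> \<rho>_0 induced
    by unfold_locales (auto simp: graded_algebra_def graded_module_def)
  note fg = S.finitely_generated_graded_pieces[OF assms(6)]
  have acts: "S.acts_on (GA 0) (GM c)" for c
    unfolding S.acts_on_def
    using S.GM_submodule Q.A.subspace Q.A.one_degree S.act_degree[of _ 0] by auto
  have pol: "polarisable ?\<rho> \<phi>A \<iota>A act GM \<longleftrightarrow>
    (\<exists>b. S.bilinear_on UNIV b \<and> S.nondegenerate_on UNIV b \<and>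
      (\<forall>c c'. c \<noteq> c' \<longrightarrow> (\<forall>x\<in>GM c. \<forall>y\<in>GM c'. b x y = 0)) \<and>
      (\<forall>T x y. b (act T x) y = b x (act (\<iota>A T) y)))"
    by (rule S.polarisable_iff_form[OF fg(1)])
  have dual: "self_dual_base_change ?\<rho> \<phi>A \<iota>A (GA 0) act (GM c) \<longleftrightarrow>
    (\<exists>b. S.bilinear_on (GM c) b \<and> S.nondegenerate_on (GM c) b \<and>
      (\<forall>a\<in>GA 0. \<forall>x\<in>GM c. \<forall>y\<in>GM c. b (act a x) y = b x (act (\<iota>A a) y)))" for c
    by (rule S.self_dual_iff_form[OF acts fg(2)])
      (use induced induced(5)[of _ 0] in auto)
  show ?thesis
  proof
    assume "polarisable ?\<rho> \<phi>A \<iota>A act GM"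
    then obtain b where b: "S.bilinear_on UNIV b" "S.nondegenerate_on UNIV b"
      and orth: "\<And>c c' x y. c \<noteq> c' \<Longrightarrow> x \<in> GM c \<Longrightarrow> y \<in> GM c' \<Longrightarrow> b x y = 0"
      and adj: "\<And>T x y. b (act T x) y = b x (act (\<iota>A T) y)"
      unfolding pol by blast
    have "S.bilinear_on (GM c) b" for c
      by (rule S.restricted_form(1)[OF b]) (use orth in blast)
    moreover have "S.nondegenerate_on (GM c) b" for c
      by (rule S.restricted_form(2)[OF b]) (use orth in blast)
    ultimately show "\<forall>c. self_dual_base_change ?\<rho> \<phi>A \<iota>A (GA 0) act (GM c)"
      unfolding dual using adj by blast
  next
    assume "\<forall>c. self_dual_base_change ?\<rho> \<phi>A \<iota>A (GA 0) act (GM c)"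
    then obtain b where b: "\<And>c. S.bilinear_on (GM c) (b c)" "\<And>c. S.nondegenerate_on (GM c) (b c)"
      "\<And>c a x y. a \<in> GA 0 \<Longrightarrow> x \<in> GM c \<Longrightarrow> y \<in> GM c \<Longrightarrow> b c (act a x) y = b c x (act (\<iota>A a) y)"
      unfolding dual by metis
    interpret F: graded_setting_forms ?\<rho> \<phi>A act GA GM \<iota>A b
      by unfold_locales (fact b)+
    obtain K :: "'a set set" and P and q where K: "finite K" "q \<noteq> 0" "\<And>k. k \<in> K \<Longrightarrow> P k \<in> central0 GA"
      "(\<Sum>k\<in>K. P k) = \<phi>A q" "\<And>k k'. k \<in> K \<Longrightarrow> k' \<in> K \<Longrightarrow> k \<noteq> k' \<Longrightarrow> P k * P k' = 0"
      "\<And>k. k \<in> K \<Longrightarrow> P k * P k = \<phi>A q * P k"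
      "\<And>k d. k \<in> K \<Longrightarrow> unit_degree \<phi>A GA (P k) d \<or> null_degree \<phi>A GA (P k) d"
    proof (rule Q.central_decomposition, goal_cases)
      case (1 K P q)
      show ?case by (rule 1(1)[OF 1(2-8)])
    qed
    obtain \<beta> where "S.bilinear_on UNIV \<beta>" "S.nondegenerate_on UNIV \<beta>"
      "\<And>c c' x y. c \<noteq> c' \<Longrightarrow> x \<in> GM c \<Longrightarrow> y \<in> GM c' \<Longrightarrow> \<beta> x y = 0"
      "\<And>a x y. \<beta> (act a x) y = \<beta> x (act (\<iota>A a) y)"
    proof (rule F.glued_form[OF K(1,3,2,4-7)], goal_cases)
      case (7 \<beta>)
      show ?case by (rule 7(1)[OF 7(2-5)])
    qed assumption+
    then show "polarisable ?\<rho> \<phi>A \<iota>A act GM" unfolding pol by blast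
  qed
qed

end
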